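(* Let $r,s\in\mathbb{N}\cup\{\infty\}$ with $s<r$, and let $\mathcal{F}$ and $\mathcal{F}'$ be $C^r$ foliations on manifolds $M$ and $M'$, respectively. Suppose that some $\phi\in C^{r,s}(\mathcal{F},\mathcal{F}')$ is $C^r$ on some neighbourhood of a closed subset $E\subset M$. Then any neighbourhood of $\phi$ in $C^{r,s}_{SP}(\mathcal{F},\mathcal{F}')$ contains some $\psi\in C^r(\mathcal{F},\mathcal{F}')$ which equals $\phi$ on some neighbourhood of $E$. In particular, the set $C^r(\mathcal{F},\mathcal{F}')$ is dense in $C^{r,s}_{SP}(\mathcal{F},\mathcal{F}')$.
   Context: A $C^r$ foliation of dimension $p$ and codimension $q$ has foliation charts $\theta:U\to T\times B$ with $T\subset\mathbb{R}^q$ open and $B\subset\mathbb{R}^p$ convex open; the composite $U\to T$ of $\theta$ with the projection to $T$ is the local projection, and $T$ is the local quotient of $U$. A foliation map $\mathcal{F}\to\mathcal{F}'$ is a map $M\to M'$ sending each leaf of $\mathcal{F}$ into a leaf of $\mathcal{F}'$. $C^r(\mathcal{F},\mathcal{F}')$ is the set of $C^r$ foliation maps. A foliation map $\phi:\mathcal{F}\to\mathcal{F}'$ is of class $C^{r,s}$ if it is of class $C^s$ and, for any domains $U$, $U'$ of foliation charts of $\mathcal{F}$, $\mathcal{F}'$ with $\phi(U)\subset U'$, the composite of $\phi:U\to U'$ with the local projection $U'\to T'$ is $C^r$. $C^{r,s}(\mathcal{F},\mathcal{F}')$ is the set of such maps, and $C^{r,s}_{SP}(\mathcal{F},\mathcal{F}')$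 is this set with the subspace topology from the strong plaquewise topology of $C^s(\mathcal{F},\mathcal{F}')$. Strong plaquewise topology (sp-topology) on $C^s(\mathcal{F},\mathcal{F}')$: for $s$ finite, a base is given by the sets $\mathcal{N}^s(\phi,\Theta,\Theta',\mathcal{K},\mathcal{E})$, where $\phi\in C^s(\mathcal{F},\mathcal{F}')$, $\Theta=\{(U_i,\theta_i)\}$ is a locally finite family of foliation charts of $\mathcal{F}$, $\Theta'=\{(U'_i,\theta'_i)\}$ is a family of foliation charts of $\mathcal{F}'$ with the same index set and with local projections $\pi'_i$, $\mathcal{K}=\{K_i\}$ is a family of compact sets with $K_i\subset U_i$ and $\phi(K_i)\subset U'_i$, and $\mathcal{E}=\{\epsilon_i\}$ is a family of positive numbers. It consists of the $\psi\in C^s(\mathcal{F},\mathcal{F}')$ such that, for all $i$, $x\in K_i$ and $0\le k\le s$: $\psi(K_i)\subset U'_i$, $\pi'_i\psi(x)=\pi'_i\phi(x)$, and $\|D^k(\theta'_i\psi\theta_i^{-1})(\theta_i(x))-D^k(\theta'_i\phi\theta_i^{-1})(\theta_i(x))\|<\epsilon_i$. (The relation $s<r$ forces $s$ to be finite.) *)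

theory Defs
  imports "HOL-Analysis.Analysis" "HOL-Library.Extended_Nat"
begin

text \<open>
  The class \<open>euclidean_space\<close> has no member of dimension 0.  To allow foliations of dimension 0
  or codimension 0, $\mathbb{R}^n$ is represented by an arbitrary $n$-dimensional linear subspace
  \<open>V\<close> of a Euclidean type (\<open>V = UNIV\<close> being the usual situation), and derivatives are taken along
  \<open>V\<close> only.
\<close>

section \<open>Differentiability of class $C^k$ in a Euclidean space\<close>

definition dir_deriv :: "'a::real_normed_vector \<Rightarrow> ('a \<Rightarrow> 'b::real_normed_vector) \<Rightarrow> 'a \<Rightarrow> 'b"
  where "dir_deriv v f = (\<lambda>x. vector_derivative (\<lambda>t. f (x + t *\<^sub>R v)) (at 0))"

text \<open>\<open>deriv_along [v\<^sub>1, \<dots>, v\<^sub>k] f x\<close> is the value $D^k f(x)(v_1,\dots,v_k)$ for \<open>f\<close> of class $C^k$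
  near \<open>x\<close>; it only depends on the germ of \<open>f\<close> at \<open>x\<close>.\<close>

fun deriv_along :: "'a list \<Rightarrow> ('a::real_normed_vector \<Rightarrow> 'b::real_normed_vector) \<Rightarrow> 'a \<Rightarrow> 'b"
  where
    "deriv_along [] f = f"
  | "deriv_along (v # vs) f = dir_deriv v (deriv_along vs f)"

text \<open>\<open>W\<close> is meant to be open in the subspace \<open>V\<close>.\<close>

fun C_nat_on :: "'a::real_normed_vector set \<Rightarrow> nat \<Rightarrow> 'a set \<Rightarrow> ('a \<Rightarrow> 'b::real_normed_vector) \<Rightarrow> bool"
  where
    "C_nat_on V 0 W f \<longleftrightarrow> continuous_on W f"
  | "C_nat_on V (Suc k) W f \<longleftrightarrow>
       (\<forall>x\<in>W. f differentiable (at x within V)) \<and> (\<forall>v\<in>V. C_nat_on V k W (dir_deriv v f))"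

definition C_on :: "'a::real_normed_vector set \<Rightarrow> enat \<Rightarrow> 'a set \<Rightarrow> ('a \<Rightarrow> 'b::real_normed_vector) \<Rightarrow> bool"
  where "C_on V r W f \<longleftrightarrow> (\<forall>k. enat k \<le> r \<longrightarrow> C_nat_on V k W f)"

text \<open>The operator norm $\|D^k f(x) - D^k g(x)\|$ of a difference of \<open>k\<close>-linear maps on \<open>V\<close>.\<close>

definition deriv_dist ::
    "'a::real_normed_vector set \<Rightarrow> nat \<Rightarrow> ('a \<Rightarrow> 'b::real_normed_vector) \<Rightarrow> ('a \<Rightarrow> 'b) \<Rightarrow> 'a \<Rightarrow> real"
  where "deriv_dist V k f g x =
    (SUP vs \<in> {vs. length vs = k \<and> set vs \<subseteq> V \<inter> cball 0 1}.
       norm (deriv_along vs f x - deriv_along vs g x))"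


section \<open>Foliations\<close>

text \<open>
  A chart \<open>(U, \<theta>)\<close> is given by a total function \<open>\<theta>\<close> of which only the restriction to \<open>U\<close> matters.
  A foliation is its maximal foliated atlas; this also determines the $C^r$ structure of the
  ambient manifold, whose points form the type \<open>'m\<close>.
\<close>

type_synonym ('m, 'q, 'p) chart = "'m set \<times> ('m \<Rightarrow> 'q \<times> 'p)"

record ('m, 'q, 'p) fol =
  transv :: "'q set"
  tang :: "'p set"
  charts :: "('m, 'q, 'p) chart set"

definition model :: "('m, 'q, 'p) fol \<Rightarrow> ('q \<times> 'p) set"
  where "model F = transv F \<times> tang F"

definition foliated_chart ::
    "'q::euclidean_space set \<Rightarrow> 'p::euclidean_space set \<Rightarrow> ('m::topological_space, 'q, 'p) chart \<Rightarrow> bool"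
  where "foliated_chart Q P c \<longleftrightarrow> open (fst c) \<and>
    (\<exists>T B g. openin (top_of_set Q) T \<and> openin (top_of_set P) B \<and> convex B \<and>
             homeomorphism (fst c) (T \<times> B) (snd c) g)"

text \<open>The expression of \<open>\<phi>\<close> in the charts \<open>c\<close> and \<open>c'\<close>, that is, $\theta'\phi\theta^{-1}$; it is
  meaningful on \<open>snd c ` (fst c \<inter> \<phi> -` fst c')\<close>.\<close>

definition local_expr ::
    "('m, 'q, 'p) chart \<Rightarrow> ('n, 'u, 'v) chart \<Rightarrow> ('m \<Rightarrow> 'n) \<Rightarrow> 'q \<times> 'p \<Rightarrow> 'u \<times> 'v"
  where "local_expr c c' \<phi> = snd c' \<circ> \<phi> \<circ> inv_into (fst c) (snd c)"

text \<open>Changes of charts are $C^r$ and locally of the form $(x,y) \mapsto (h(x), g(x,y))$.\<close>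

definition compatible ::
    "('q::euclidean_space \<times> 'p::euclidean_space) set \<Rightarrow> enat \<Rightarrow>
     ('m, 'q, 'p) chart \<Rightarrow> ('m, 'q, 'p) chart \<Rightarrow> bool"
  where "compatible V r c d \<longleftrightarrow>
    (let W = snd c ` (fst c \<inter> fst d); \<tau> = local_expr c d id in
      C_on V r W \<tau> \<and>
      (\<forall>z\<in>W. \<exists>N. openin (top_of_set W) N \<and> z \<in> N \<and>
         (\<forall>a\<in>N. \<forall>b\<in>N. fst a = fst b \<longrightarrow> fst (\<tau> a) = fst (\<tau> b))))"

definition foliation ::
    "enat \<Rightarrow> nat \<Rightarrow> nat \<Rightarrow>
     ('m::{t2_space, second_countable_topology}, 'q::euclidean_space, 'p::euclidean_space) fol \<Rightarrow> bool"
  where "foliation r p q F \<longleftrightarrow>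
    subspace (transv F) \<and> dim (transv F) = q \<and>
    subspace (tang F) \<and> dim (tang F) = p \<and>
    (\<forall>c\<in>charts F. foliated_chart (transv F) (tang F) c) \<and>
    (\<Union>c\<in>charts F. fst c) = UNIV \<and>
    (\<forall>c\<in>charts F. \<forall>d\<in>charts F. compatible (model F) r c d) \<and>
    (\<forall>c. foliated_chart (transv F) (tang F) c \<and>
         (\<forall>d\<in>charts F. compatible (model F) r c d \<and> compatible (model F) r d c)
         \<longrightarrow> c \<in> charts F)"

definition local_proj :: "('m, 'q, 'p) chart \<Rightarrow> 'm \<Rightarrow> 'q"
  where "local_proj c = fst \<circ> snd c"

text \<open>Two points are related if they lie in a common plaque, a fibre of a local projection.
  The leaves are the classes of the generated equivalence relation.\<close>

definition plaque_rel :: "('m, 'q, 'p) fol \<Rightarrow> ('m \<times> 'm) set"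
  where "plaque_rel F =
    {(x, y). \<exists>c\<in>charts F. x \<in> fst c \<and> y \<in> fst c \<and> local_proj c x = local_proj c y}"

definition leaves :: "('m, 'q, 'p) fol \<Rightarrow> 'm set set"
  where "leaves F = UNIV // (plaque_rel F)\<^sup>*"


section \<open>Foliation maps\<close>

definition foliation_map :: "('m, 'q, 'p) fol \<Rightarrow> ('n, 'u, 'v) fol \<Rightarrow> ('m \<Rightarrow> 'n) \<Rightarrow> bool"
  where "foliation_map F F' \<phi> \<longleftrightarrow> (\<forall>L\<in>leaves F. \<exists>L'\<in>leaves F'. \<phi> ` L \<subseteq> L')"

text \<open>\<open>\<phi>\<close> is of class $C^k$ on the open set \<open>N\<close>.\<close>

definition C_map_on ::
    "enat \<Rightarrow> 'm set \<Rightarrow>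
     ('m::topological_space, 'q::euclidean_space, 'p::euclidean_space) fol \<Rightarrow>
     ('n::topological_space, 'u::euclidean_space, 'v::euclidean_space) fol \<Rightarrow>
     ('m \<Rightarrow> 'n) \<Rightarrow> bool"
  where "C_map_on k N F F' \<phi> \<longleftrightarrow> continuous_on N \<phi> \<and>
    (\<forall>c\<in>charts F. \<forall>c'\<in>charts F'.
       C_on (model F) k (snd c ` (fst c \<inter> N \<inter> \<phi> -` fst c')) (local_expr c c' \<phi>))"

definition C_fol ::
    "enat \<Rightarrow> ('m::topological_space, 'q::euclidean_space, 'p::euclidean_space) fol \<Rightarrow>
     ('n::topological_space, 'u::euclidean_space, 'v::euclidean_space) fol \<Rightarrow> ('m \<Rightarrow> 'n) set"
  where "C_fol k F F' = {\<phi>. foliation_map F F' \<phi> \<and> C_map_on k UNIV F F' \<phi>}"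

definition C2_fol ::
    "enat \<Rightarrow> enat \<Rightarrow> ('m::topological_space, 'q::euclidean_space, 'p::euclidean_space) fol \<Rightarrow>
     ('n::topological_space, 'u::euclidean_space, 'v::euclidean_space) fol \<Rightarrow> ('m \<Rightarrow> 'n) set"
  where "C2_fol r s F F' = {\<phi> \<in> C_fol s F F'.
    \<forall>c\<in>charts F. \<forall>c'\<in>charts F'. \<phi> ` fst c \<subseteq> fst c' \<longrightarrow>
      C_on (model F) r (snd c ` fst c) (local_proj c' \<circ> \<phi> \<circ> inv_into (fst c) (snd c))}"


section \<open>The strong plaquewise topology\<close>

definition sp_nbhd ::
    "nat \<Rightarrow> ('m::topological_space, 'q::euclidean_space, 'p::euclidean_space) fol \<Rightarrow>
     ('n::topological_space, 'u::euclidean_space, 'v::euclidean_space) fol \<Rightarrow> ('m \<Rightarrow> 'n) \<Rightarrow>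
     'i set \<Rightarrow> ('i \<Rightarrow> ('m, 'q, 'p) chart) \<Rightarrow> ('i \<Rightarrow> ('n, 'u, 'v) chart) \<Rightarrow> ('i \<Rightarrow> 'm set) \<Rightarrow>
     ('i \<Rightarrow> real) \<Rightarrow> ('m \<Rightarrow> 'n) set"
  where "sp_nbhd s F F' \<phi> I \<Theta> \<Theta>' K \<epsilon> =
    {\<psi> \<in> C_fol (enat s) F F'. \<forall>i\<in>I.
       \<psi> ` K i \<subseteq> fst (\<Theta>' i) \<and>
       (\<forall>x\<in>K i. local_proj (\<Theta>' i) (\<psi> x) = local_proj (\<Theta>' i) (\<phi> x) \<and>
          (\<forall>k\<le>s. deriv_dist (model F) k (local_expr (\<Theta> i) (\<Theta>' i) \<psi>) (local_expr (\<Theta> i) (\<Theta>' i) \<phi>)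
                     (snd (\<Theta> i) x) < \<epsilon> i))}"

definition locally_finite_family :: "'i set \<Rightarrow> ('i \<Rightarrow> 'm::topological_space set) \<Rightarrow> bool"
  where "locally_finite_family I U \<longleftrightarrow>
    (\<forall>x. \<exists>N. open N \<and> x \<in> N \<and> finite {i \<in> I. U i \<inter> N \<noteq> {}})"

text \<open>Index sets may be taken to consist of natural numbers: in a second countable space, only
  countably many members of a locally finite family are nonempty, and an index \<open>i\<close> whose chart has
  empty domain imposes no condition.\<close>

definition sp_base ::
    "nat \<Rightarrow> ('m::topological_space, 'q::euclidean_space, 'p::euclidean_space) fol \<Rightarrow>
     ('n::topological_space, 'u::euclidean_space, 'v::euclidean_space) fol \<Rightarrow> ('m \<Rightarrow> 'n) set set"
  where "sp_base s F F' =
    {sp_nbhd s F F' \<phi> I \<Theta> \<Theta>' K \<epsilon> | \<phi> (I :: nat set) \<Theta> \<Theta>' K \<epsilon>.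
       \<phi> \<in> C_fol (enat s) F F' \<and> locally_finite_family I (\<lambda>i. fst (\<Theta> i)) \<and>
       (\<forall>i\<in>I. \<Theta> i \<in> charts F \<and> \<Theta>' i \<in> charts F' \<and>
          compact (K i) \<and> K i \<subseteq> fst (\<Theta> i) \<and> \<phi> ` K i \<subseteq> fst (\<Theta>' i) \<and> \<epsilon> i > 0)}"

definition sp_topology ::
    "nat \<Rightarrow> ('m::topological_space, 'q::euclidean_space, 'p::euclidean_space) fol \<Rightarrow>
     ('n::topological_space, 'u::euclidean_space, 'v::euclidean_space) fol \<Rightarrow> ('m \<Rightarrow> 'n) topology"
  where "sp_topology s F F' = topology_generated_by (sp_base s F F')"

lemma topspace_sp_topology: "topspace (sp_topology s F F') = C_fol (enat s) F F'"
proof -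
  have "\<phi> \<in> \<Union> (sp_base s F F')" if "\<phi> \<in> C_fol (enat s) F F'" for \<phi>
  proof -
    have "sp_nbhd s F F' \<phi> ({} :: nat set) \<Theta> \<Theta>' K \<epsilon> \<in> sp_base s F F'" for \<Theta> \<Theta>' K \<epsilon>
      unfolding sp_base_def
      by (rule CollectI, intro exI conjI) (use that in \<open>auto simp: locally_finite_family_def\<close>)
    moreover have "\<phi> \<in> sp_nbhd s F F' \<phi> ({} :: nat set) \<Theta> \<Theta>' K \<epsilon>" for \<Theta> \<Theta>' K \<epsilon>
      using that by (simp add: sp_nbhd_def)
    ultimately show ?thesis by blast
  qed
  moreover have "\<Union> (sp_base s F F') \<subseteq> C_fol (enat s) F F'"
    by (auto simp: sp_base_def sp_nbhd_def)
  ultimately show ?thesis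
    by (auto simp: sp_topology_def topology_generated_by_topspace)
qed

definition C2_fol_SP ::
    "enat \<Rightarrow> nat \<Rightarrow> ('m::topological_space, 'q::euclidean_space, 'p::euclidean_space) fol \<Rightarrow>
     ('n::topological_space, 'u::euclidean_space, 'v::euclidean_space) fol \<Rightarrow> ('m \<Rightarrow> 'n) topology"
  where "C2_fol_SP r s F F' = subtopology (sp_topology s F F') (C2_fol r (enat s) F F')"

end

theory Submission
  imports Defs
begin

text \<open>
  Every map is corrected only along the plaques of the target. If \<open>\<phi>\<close> is expressed by
  $(x,y) \mapsto (h(x,y), u(x,y))$ in a pair of charts, then $h$ is already $C^r$ because
    \<open>\<phi>\<close> is
  $C^{r,s}$, and only $u$, which takes its values along the plaque, is replaced by
  $G_z = u + \lambda (S_z(\mu u) - u)$, where $\lambda$ and $\mu$ are bump functions and $S_z$ is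
  convolution with a mollifier of radius $z$. The map $G_z$ is smooth where $\lambda = 1$ and it
  is $C^r$ wherever $u$ is.

  The point $x$ and the scale $z$ (with $S_0 = \mathrm{id}$) are treated simultaneously: all
  derivatives of $G_z$ of order at most $s$ are continuous in $(z,x)$, a property that is stable
  under composition with changes of charts. The deformation therefore satisfies the conditions
  that define a strong plaquewise neighbourhood for all small $z$, by compactness; no
  quantitative estimate is needed. Along an exhaustion by compact sets, countably many such
  corrections, each of which meets only finitely many of the conditions, yield the result.
\<close>


section \<open>Families of functions with jointly continuous derivatives\<close>

text \<open>The obstacle is that a map must be smoothed without moving its values across plaques.
  Averaging all target coordinates would break the leaf condition and the exact equality of local
  projections demanded by \<open>sp_nbhd\<close>. Since changes of target charts have the form
  (h(x), g(x,y)), altering the plaque coordinate alone has a meaning independent of the chart, and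
  it leaves the transverse half, already of class C^r, as it is. A correction gains regularity only
  where the cutoff equals 1. In the transition zone it mixes \<open>u\<close> with its average and
  keeps whatever regularity \<open>u\<close> has there. So corrections over overlapping coordinate
  balls can follow one another: what has been gained is never lost. Membership in a neighbourhood is
  recast as a collection of abstract conditions, each carried by a compact set, dependent only on
  the germ along it, and open along families. The requirement that a ball be mapped into a target
  chart has the same shape, so the same mechanism protects it until that ball is treated.\<close>

text \<open>Continuity has to be required explicitly in the successor case, because there is no
  differentiability in the parameter \<open>z\<close>.\<close>

fun C_par :: "'a::real_normed_vector set \<Rightarrow> nat \<Rightarrow> ('z::topological_space
  \<times> 'a) set \<Rightarrow>
    ('z \<Rightarrow> 'a \<Rightarrow> 'b::real_normed_vector) \<Rightarrow> bool"
  where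
    "C_par V 0 A G \<longleftrightarrow> continuous_on A (\<lambda>p. G (fst p) (snd p))"
  | "C_par V (Suc k) A G \<longleftrightarrow> continuous_on A (\<lambda>p. G (fst p) (snd p)) \<and>
       (\<forall>p\<in>A. G (fst p) differentiable (at (snd p) within V)) \<and>
       (\<forall>v\<in>V. C_par V k A (\<lambda>z. dir_deriv v (G z)))"

lemma C_par_cont: "C_par V k A G \<Longrightarrow> continuous_on A (\<lambda>p. G (fst p) (snd p))"
  by (cases k) auto

text \<open>The line through \<open>x\<close> in direction \<open>v\<close> stays in
  \<open>V\<close>, so a derivative within \<open>V\<close> already controls the two-sided limit
  that defines \<open>dir_deriv\<close>, a notion that does not mention \<open>V\<close>.\<close>

lemma dir_deriv_eq:
  assumes "(f has_derivative f') (at x within V)" "subspace V" "x \<in> V" "v \<in> V"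
  shows "dir_deriv v f x = f' v"
proof -
  have 1: "((\<lambda>t. x + t *\<^sub>R v) has_derivative (\<lambda>t. t *\<^sub>R v)) (at 0)"
    by (auto intro!: derivative_eq_intros)
  have "range (\<lambda>t::real. x + t *\<^sub>R v) \<subseteq> V"
    using assms by (auto intro!: subspace_add subspace_scale)
  then have "(f has_derivative f') (at (x + 0 *\<^sub>R v) within range (\<lambda>t::real. x + t
    *\<^sub>R v))"
    using has_derivative_subset[OF assms(1)] by simp
  from diff_chain_within[OF 1 this] have
    "((\<lambda>t. f (x + t *\<^sub>R v)) has_derivative (\<lambda>t. f' (t *\<^sub>R v))) (at 0)"
    by (simp add: o_def)
  moreover have "(\<lambda>t. f' (t *\<^sub>R v)) = (\<lambda>t. t *\<^sub>R f' v)"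
    using has_derivative_bounded_linear[OF assms(1)] by (simp add: linear_simps)
  ultimately show ?thesis
    unfolding dir_deriv_def by (intro vector_derivative_at) (simp add: has_vector_derivative_def)
qed

lemma differentiable_dir_deriv:
  assumes "f differentiable (at x within V)" "subspace V" "x \<in> V"
  obtains f' where "(f has_derivative f') (at x within V)"
    "\<And>v. v \<in> V \<Longrightarrow> dir_deriv v f x = f' v"
proof -
  obtain f' where f': "(f has_derivative f') (at x within V)" using assms(1)
    by (auto simp: differentiable_def)
  show thesis by (rule that[OF f' dir_deriv_eq[OF f' assms(2,3)]])
qed

lemma dir_deriv_cong:
  assumes "open U" "x \<in> U" "\<And>y. y \<in> U \<inter> V \<Longrightarrow> f y = g y"
    "subspace V" "x \<in> V" "v \<in> V"
  shows "dir_deriv v f x = dir_deriv v g x"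
proof -
  have "((\<lambda>t::real. x + t *\<^sub>R v) \<longlongrightarrow> x + 0 *\<^sub>R v) (at 0)"
    by (intro tendsto_intros)
  then have "eventually (\<lambda>t. x + t *\<^sub>R v \<in> U) (at 0)"
    using assms(1,2) by (auto dest: topological_tendstoD)
  then have "eventually (\<lambda>t. x + t *\<^sub>R v \<in> U) (nhds 0)"
    using assms(2) by (simp add: eventually_nhds_conv_at)
  then have "eventually (\<lambda>t. f (x + t *\<^sub>R v) = g (x + t *\<^sub>R v)) (nhds 0)"
    by (rule eventually_mono) (use assms in \<open>auto intro!: subspace_add subspace_scale\<close>)
  then show ?thesis
    unfolding dir_deriv_def by (intro vector_derivative_cong_eq) (auto elim: eventually_mono)
qed

lemma has_derivative_cong_within:
  assumes "(f has_derivative f') (at x within V)" "open U" "x \<in> U"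
    "\<And>y. y \<in> U \<inter> V \<Longrightarrow> f y = g y" "x \<in> V"
  shows "(g has_derivative f') (at x within V)"
proof -
  obtain d where "d > 0" "ball x d \<subseteq> U" using assms open_contains_ball by metis
  then show ?thesis
    by (intro has_derivative_transform_within[OF assms(1) _ assms(5)] assms(4)) (auto simp: dist_commute)
qed

lemma differentiable_cong_within:
  assumes "f differentiable (at x within V)" "open U" "x \<in> U"
    "\<And>y. y \<in> U \<inter> V \<Longrightarrow> f y = g y" "x \<in> V"
  shows "g differentiable (at x within V)"
proof -
  obtain f' where "(f has_derivative f') (at x within V)" using assms(1) by (auto simp: differentiable_def)
  then have "(g has_derivative f') (at x within V)"
    by (rule has_derivative_cong_within) (use assms in auto)
  then show ?thesis by (auto simp: differentiable_def)
qed

lemma openin_slice: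
  assumes "openin (top_of_set (UNIV \<times> V)) A" "(z, x) \<in> A"
  obtains U where "open U" "x \<in> U"
    "\<And>y. y \<in> U \<inter> V \<Longrightarrow> (z, y) \<in> A" "x \<in> V"
proof -
  obtain T where T: "open T" "A = (UNIV \<times> V) \<inter> T"
    using assms(1) by (auto simp: openin_open)
  have "open (Pair z -` T)"
    by (intro open_vimage T continuous_intros)
  then show thesis using that[of "Pair z -` T"] T assms(2) by auto
qed

lemma C_par_mono:
  assumes "C_par V k A G" "A' \<subseteq> A" "j \<le> k"
  shows "C_par V j A' G"
  using assms
proof (induction k arbitrary: j G)
  case 0
  then show ?case by (auto intro: continuous_on_subset)
next
  case (Suc k)
  then show ?case
    by (cases j) (auto intro: continuous_on_subset)
qed

text \<open>Relative openness of \<open>A\<close> makes each slice a neighbourhood within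
  \<open>V\<close>, so equal values force equal directional derivatives at every order. Its main use
  is to replace a directional derivative by a differentiation formula that is known on
  \<open>A\<close> only.\<close>

lemma C_par_cong:
  assumes "C_par V k A G" "openin (top_of_set (UNIV \<times> V)) A" "subspace V"
    and "\<And>z x. (z, x) \<in> A \<Longrightarrow> G z x = H z x"
  shows "C_par V k A H"
  using assms(1,4)
proof (induction k arbitrary: G H)
  case 0
  then have "continuous_on A (\<lambda>p. G (fst p) (snd p)) \<longleftrightarrow>
    continuous_on A (\<lambda>p. H (fst p) (snd p))"
    by (intro continuous_on_cong) auto
  with 0 show ?case by simp
next
  case (Suc k)
  have eq: "continuous_on A (\<lambda>p. G (fst p) (snd p)) \<longleftrightarrow>
    continuous_on A (\<lambda>p. H (fst p) (snd p))"
    using Suc.prems by (intro continuous_on_cong) auto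
  have "H z differentiable (at x within V)" if "(z, x) \<in> A" for z x
  proof -
    obtain U where U: "open U" "x \<in> U"
      "\<And>y. y \<in> U \<inter> V \<Longrightarrow> (z, y) \<in> A" "x \<in> V"
      using openin_slice[OF assms(2) \<open>(z, x) \<in> A\<close>] by metis
    have "G z differentiable (at x within V)" using Suc.prems(1) that by force
    then show ?thesis
      by (rule differentiable_cong_within[of "G z" _ _ U]) (use Suc.prems(2) U in auto)
  qed
  moreover have "C_par V k A (\<lambda>z. dir_deriv v (H z))" if "v \<in> V" for v
  proof (rule Suc.IH)
    show "C_par V k A (\<lambda>z. dir_deriv v (G z))" using Suc.prems that by simp
    fix z x assume "(z, x) \<in> A"
    obtain U where U: "open U" "x \<in> U"
      "\<And>y. y \<in> U \<inter> V \<Longrightarrow> (z, y) \<in> A" "x \<in> V"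
      using openin_slice[OF assms(2) \<open>(z, x) \<in> A\<close>] by metis
    show "dir_deriv v (G z) x = dir_deriv v (H z) x"
      by (rule dir_deriv_cong[of U x V]) (use U Suc.prems(2) that assms(3) in auto)
  qed
  ultimately show ?case using Suc.prems eq by auto
qed

lemma C_par_local:
  assumes "\<And>p. p \<in> A \<Longrightarrow> \<exists>U. open U \<and> p \<in> U \<and>
    C_par V k (A \<inter> U) G"
  shows "C_par V k A G"
  using assms
proof (induction k arbitrary: G)
  case 0
  have "continuous_on A (\<lambda>p. G (fst p) (snd p))"
    unfolding continuous_on_def
  proof
    fix p assume "p \<in> A"
    from 0[OF this] obtain U
      where U: "open U" "p \<in> U" "continuous_on (A \<inter> U) (\<lambda>p. G (fst p) (snd p))"
      by auto
    then have "((\<lambda>p. G (fst p) (snd p)) \<longlongrightarrow> G (fst p) (snd p)) (at p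
      within A \<inter> U)"
      using \<open>p \<in> A\<close> by (simp add: continuous_on_def)
    then show "((\<lambda>p. G (fst p) (snd p)) \<longlongrightarrow> G (fst p) (snd p)) (at p within A)"
      using at_within_nhd[OF U(2,1), of "A \<inter> U" A] by (simp add: Int_assoc)
  qed
  then show ?case by simp
next
  case (Suc k)
  have "continuous_on A (\<lambda>p. G (fst p) (snd p))"
    unfolding continuous_on_def
  proof
    fix p assume "p \<in> A"
    from Suc.prems[OF this] obtain U
      where U: "open U" "p \<in> U" "continuous_on (A \<inter> U) (\<lambda>p. G (fst p) (snd p))"
      by auto
    then have "((\<lambda>p. G (fst p) (snd p)) \<longlongrightarrow> G (fst p) (snd p)) (at p
      within A \<inter> U)"
      using \<open>p \<in> A\<close> by (simp add: continuous_on_def)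
    then show "((\<lambda>p. G (fst p) (snd p)) \<longlongrightarrow> G (fst p) (snd p)) (at p within A)"
      using at_within_nhd[OF U(2,1), of "A \<inter> U" A] by (simp add: Int_assoc)
  qed
  moreover have "C_par V k A (\<lambda>z. dir_deriv v (G z))" if "v \<in> V" for v
  proof (rule Suc.IH)
    fix p assume "p \<in> A"
    then obtain U where "open U" "p \<in> U" "C_par V (Suc k) (A \<inter> U) G" using Suc.prems by blast
    then show "\<exists>U. open U \<and> p \<in> U \<and>
      C_par V k (A \<inter> U) (\<lambda>z. dir_deriv v (G z))"
      using that by auto
  qed
  moreover have "G (fst p) differentiable (at (snd p) within V)" if "p \<in> A" for p
    using Suc.prems[OF that] that by auto
  ultimately show ?case by simp
qed

lemma C_nat_on_imp_continuous_on:
  assumes "C_nat_on V k W f" "W \<subseteq> V" shows "continuous_on W f"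
proof (cases k)
  case 0 then show ?thesis using assms by simp
next
  case (Suc j)
  then have "f differentiable (at x within V)" if "x \<in> W" for x using assms that by simp
  then have "continuous (at x within V) f" if "x \<in> W" for x
    using that differentiable_imp_continuous_within by blast
  then show ?thesis
    using assms(2) by (auto simp: continuous_on_eq_continuous_within intro: continuous_within_subset)
qed

lemma C_par_imp_C_nat_on:
  assumes "C_par V k A G" "\<And>x. x \<in> W \<Longrightarrow> (z, x) \<in> A"
  shows "C_nat_on V k W (G z)"
  using assms
proof (induction k arbitrary: G)
  case 0
  then have c: "continuous_on A (\<lambda>p. G (fst p) (snd p))" by simp
  have "continuous_on W (\<lambda>x. (\<lambda>p. G (fst p) (snd p)) (z, x))"
    by (rule continuous_on_compose2[OF c]) (use 0 in \<open>auto intro!: continuous_intros\<close>)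
  then show ?case by simp
next
  case (Suc k)
  then show ?case by force
qed

lemma C_nat_on_imp_C_par:
  assumes "C_nat_on V k W f" "W \<subseteq> V" "\<And>z x. (z, x) \<in> A \<Longrightarrow> x \<in> W"
  shows "C_par V k A (\<lambda>_. f)"
  using assms
proof (induction k arbitrary: f)
  case 0
  then show ?case
    by (auto intro!: continuous_on_compose2[of W f A snd] continuous_intros)
next
  case (Suc k)
  have "continuous_on W f" using Suc.prems C_nat_on_imp_continuous_on by blast
  then have "continuous_on A (\<lambda>p. f (snd p))"
    using Suc.prems by (auto intro!: continuous_on_compose2[of W f A snd] continuous_intros)
  then show ?case using Suc by (auto simp: split_paired_all)
qed

text \<open>A single function is a family that is constant in the parameter. The rules of calculus
  are therefore proved once, for families, and read off for functions; \<open>real\<close> is an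
  arbitrary choice of parameter space.\<close>

lemma C_nat_on_iff_C_par:
  assumes "W \<subseteq> V"
  shows "C_nat_on V k W f \<longleftrightarrow>
    C_par V k (UNIV \<times> W :: (real \<times> _) set) (\<lambda>_. f)"
proof
  show "C_par V k (UNIV \<times> W :: (real \<times> _) set) (\<lambda>_. f)" if "C_nat_on V k W f"
    by (rule C_nat_on_imp_C_par[OF that assms]) simp
  show "C_nat_on V k W f" if "C_par V k (UNIV \<times> W :: (real \<times> _) set) (\<lambda>_. f)"
    by (rule C_par_imp_C_nat_on[OF that, of _ 0]) simp
qed

lemma C_nat_on_mono:
  assumes "C_nat_on V k W f" "W \<subseteq> V" "W' \<subseteq> W" "j \<le> k"
  shows "C_nat_on V j W' f"
proof -
  have "C_par V k (UNIV \<times> W :: (real \<times> _) set) (\<lambda>_. f)"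
    using assms C_nat_on_iff_C_par by blast
  then have "C_par V j (UNIV \<times> W' :: (real \<times> _) set) (\<lambda>_. f)"
    by (rule C_par_mono) (use assms in auto)
  then show ?thesis
    by (rule C_par_imp_C_nat_on[of _ _ _ _ _ 0]) simp
qed

lemma C_par_const: "C_par V k A (\<lambda>z x. c)"
proof (induction k arbitrary: c)
  case (Suc k)
  have "dir_deriv v (\<lambda>x. c) = (\<lambda>x. 0)" for v :: 'a
    by (rule ext) (simp add: dir_deriv_def)
  with Suc show ?case by simp
qed simp

section \<open>Calculus rules for parametrised families\<close>

context
  fixes V :: "'a::real_normed_vector set" and A :: "('z::topological_space \<times> 'a) set"
  assumes V: "subspace V" and A: "openin (top_of_set (UNIV \<times> V)) A"
begin

lemma snd_in_V: "p \<in> A \<Longrightarrow> snd p \<in> V" "(z, x) \<in> A \<Longrightarrow> x \<in> V"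
  using openin_imp_subset[OF A] by auto

lemma C_par_linear:
  assumes L: "bounded_linear L" and "C_par V k A G"
  shows "C_par V k A (\<lambda>z x. L (G z x))"
  using assms(2)
proof (induction k arbitrary: G)
  case 0
  then show ?case
    using bounded_linear.continuous_on[OF L, of A "\<lambda>p. G (fst p) (snd p)"] by simp
next
  case (Suc k)
  have "(\<lambda>x. L (G (fst p) x)) differentiable (at (snd p) within V)" if "p \<in> A" for p
  proof -
    have "G (fst p) differentiable (at (snd p) within V)" using Suc.prems that by auto
    then show ?thesis using bounded_linear.has_derivative[OF L] unfolding differentiable_def by blast
  qed
  moreover have "C_par V k A (\<lambda>z. dir_deriv v (\<lambda>x. L (G z x)))" if v: "v \<in> V" for v
  proof (rule C_par_cong[OF _ A V])
    show "C_par V k A (\<lambda>z x. L (dir_deriv v (G z) x))"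
      using Suc v by simp
    fix z x assume p: "(z, x) \<in> A"
    then have "G z differentiable (at x within V)" using Suc.prems by force
    then obtain g where g: "(G z has_derivative g) (at x within V)" "dir_deriv v (G z) x = g v"
      using differentiable_dir_deriv V snd_in_V(2)[OF p] v by metis
    then show "L (dir_deriv v (G z) x) = dir_deriv v (\<lambda>x. L (G z x)) x"
      using dir_deriv_eq[OF bounded_linear.has_derivative[OF L g(1)] V snd_in_V(2)[OF p] v] by simp
  qed
  ultimately show ?case
    using Suc.prems bounded_linear.continuous_on[OF L, of A "\<lambda>p. G (fst p) (snd p)"] by simp
qed

lemma C_par_add:
  assumes "C_par V k A G" "C_par V k A H"
  shows "C_par V k A (\<lambda>z x. G z x + H z x)"
  using assms
proof (induction k arbitrary: G H)
  case 0
  then show ?case by (auto intro!: continuous_intros)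
next
  case (Suc k)
  have "C_par V k A (\<lambda>z. dir_deriv v (\<lambda>x. G z x + H z x))" if v: "v \<in> V" for v
  proof (rule C_par_cong[OF _ A V])
    show "C_par V k A (\<lambda>z x. dir_deriv v (G z) x + dir_deriv v (H z) x)"
      using Suc v by simp
    fix z x assume p: "(z, x) \<in> A"
    then have "G z differentiable (at x within V)" "H z differentiable (at x within V)"
      using Suc.prems by force+
    then obtain g h where g: "(G z has_derivative g) (at x within V)" "dir_deriv v (G z) x = g v"
      "(H z has_derivative h) (at x within V)" "dir_deriv v (H z) x = h v"
      using differentiable_dir_deriv V snd_in_V(2)[OF p] v by metis
    then show "dir_deriv v (G z) x + dir_deriv v (H z) x = dir_deriv v (\<lambda>x. G z x + H z x) x"
      using dir_deriv_eq[OF has_derivative_add[OF g(1,3)] V snd_in_V(2)[OF p] v] by simp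
  qed
  then show ?case using Suc.prems
    by (auto intro!: continuous_intros differentiable_add)
qed

lemma C_par_sum:
  assumes "\<And>i. i \<in> I \<Longrightarrow> C_par V k A (G i)"
  shows "C_par V k A (\<lambda>z x. \<Sum>i\<in>I. G i z x)"
  using assms
proof (induction I rule: infinite_finite_induct)
  case (insert i I)
  then show ?case using C_par_add[of k "G i" "\<lambda>z x. \<Sum>i\<in>I. G i z x"] by simp
qed (simp_all add: C_par_const)

lemma C_par_Pair:
  assumes "C_par V k A G" "C_par V k A H"
  shows "C_par V k A (\<lambda>z x. (G z x, H z x))"
proof -
  have "bounded_linear (\<lambda>a. (a, 0))" "bounded_linear (\<lambda>b. (0, b))"
    by (auto intro!: bounded_linear_Pair bounded_linear_ident bounded_linear_zero)
  from C_par_add[OF C_par_linear[OF this(1) assms(1)] C_par_linear[OF this(2) assms(2)]]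
  show ?thesis by simp
qed

lemma C_par_bilinear:
  assumes B: "bounded_bilinear B" and "C_par V k A G" "C_par V k A H"
  shows "C_par V k A (\<lambda>z x. B (G z x) (H z x))"
  using assms(2,3)
proof (induction k arbitrary: G H)
  case 0
  then show ?case unfolding C_par.simps by (rule bounded_bilinear.continuous_on[OF B])
next
  case (Suc k)
  have dif: "(\<lambda>x. B (G (fst p) x) (H (fst p) x)) differentiable (at (snd p) within V)"
    if "p \<in> A" for p
  proof -
    have "G (fst p) differentiable (at (snd p) within V)" "H (fst p) differentiable (at (snd p) within V)"
      using Suc.prems that by auto
    then show ?thesis
      using bounded_bilinear.FDERIV[OF B] unfolding differentiable_def by blast
  qed
  have "C_par V k A (\<lambda>z. dir_deriv v (\<lambda>x. B (G z x) (H z x)))" if v: "v \<in> V" for v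
  proof (rule C_par_cong[OF _ A V])
    show "C_par V k A (\<lambda>z x. B (G z x) (dir_deriv v (H z) x) + B (dir_deriv v (G z) x) (H z x))"
      using Suc.prems v by (intro C_par_add Suc.IH) (auto intro: C_par_mono[where k="Suc k"])
    fix z x assume p: "(z, x) \<in> A"
    then have "G z differentiable (at x within V)" "H z differentiable (at x within V)"
      using Suc.prems by force+
    then obtain g h where g: "(G z has_derivative g) (at x within V)" "dir_deriv v (G z) x = g v"
      "(H z has_derivative h) (at x within V)" "dir_deriv v (H z) x = h v"
      using differentiable_dir_deriv V snd_in_V(2)[OF p] v by metis
    then show "B (G z x) (dir_deriv v (H z) x) + B (dir_deriv v (G z) x) (H z x) = dir_deriv v
      (\<lambda>x. B (G z x) (H z x)) x"
      using dir_deriv_eq[OF bounded_bilinear.FDERIV[OF B g(1,3)] V snd_in_V(2)[OF p] v] by simp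
  qed
  moreover have "continuous_on A (\<lambda>p. B (G (fst p) (snd p)) (H (fst p) (snd p)))"
    by (rule bounded_bilinear.continuous_on[OF B]) (use Suc.prems in simp_all)
  ultimately show ?case using dif by simp
qed

end

text \<open>Coordinates for the subspace \<open>V\<close>. Sums over the finite set \<open>B\<close>
  replace quantification over all directions in \<open>V\<close>, and \<open>B\<close> is empty if
  \<open>V\<close> is trivial, so dimension 0 is not a separate case.\<close>

lemma orthonormal_expansion:
  fixes V :: "'a::euclidean_space set"
  assumes "subspace V"
  obtains B where "finite B" "B \<subseteq> V" "\<And>b. b \<in> B \<Longrightarrow> norm b = 1"
    "\<And>x. x \<in> V \<Longrightarrow> (\<Sum>b\<in>B. (x \<bullet> b) *\<^sub>R b) = x"
proof -
  obtain B where B: "B \<subseteq> V" "pairwise orthogonal B"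
    "\<And>x. x \<in> B \<Longrightarrow> norm x = 1" "independent B" "span B = V"
    using orthonormal_basis_subspace[OF assms] by metis
  then have fin: "finite B" by (simp add: independent_imp_finite)
  have "(\<Sum>b\<in>B. (x \<bullet> b) *\<^sub>R b) = x" if "x \<in> V" for x
  proof -
    have "x \<in> span B" using that B by simp
    then obtain u where u: "x = (\<Sum>b\<in>B. u b *\<^sub>R b)" using span_finite[OF fin] by auto
    have "x \<bullet> b = u b" if "b \<in> B" for b
    proof -
      have "x \<bullet> b = (\<Sum>c\<in>B. u c * (c \<bullet> b))" by (simp add: u inner_sum_left)
      also have "\<dots> = (\<Sum>c\<in>B. if c = b then u b else 0)"
        using B that by (intro sum.cong) (auto simp: pairwise_def orthogonal_def norm_eq_1)
      finally show ?thesis using that fin by simp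
    qed
    then show ?thesis by (simp add: u cong: sum.cong)
  qed
  with B fin that show thesis by metis
qed

lemma dir_deriv_expansion:
  assumes "f differentiable (at x within V)" "subspace V" "x \<in> V"
    and B: "finite B" "B \<subseteq> V"
      and w: "(\<Sum>b\<in>B. (w \<bullet> b) *\<^sub>R b) = w" "w \<in> V"
  shows "dir_deriv w f x = (\<Sum>b\<in>B. (w \<bullet> b) *\<^sub>R dir_deriv b f x)"
proof -
  obtain f' where f': "(f has_derivative f') (at x within V)"
    "\<And>v. v \<in> V \<Longrightarrow> dir_deriv v f x = f' v"
    using differentiable_dir_deriv assms by metis
  interpret bounded_linear f' using f'(1) by (rule has_derivative_bounded_linear)
  have "f' w = f' (\<Sum>b\<in>B. (w \<bullet> b) *\<^sub>R b)" using w by simp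
  also have "\<dots> = (\<Sum>b\<in>B. (w \<bullet> b) *\<^sub>R f' b)" by (simp add: sum scale)
  finally show ?thesis using f' w B by (simp add: subset_iff)
qed

text \<open>Near \<open>x\<close> the map equals its own orthogonal projection to \<open>V'\<close>,
  whose derivative visibly takes values in \<open>V'\<close>. The chain rule needs this, since the
  outer map is differentiated in directions of \<open>V'\<close> only.\<close>

lemma dir_deriv_in_subspace:
  fixes V' :: "'b::euclidean_space set"
  assumes "f differentiable (at x within V)" "subspace V" "x \<in> V" "v \<in> V" "subspace V'"
    and "open U" "x \<in> U" "\<And>y. y \<in> U \<inter> V \<Longrightarrow> f y \<in> V'"
  shows "dir_deriv v f x \<in> V'"
proof -
  obtain B where B: "finite B" "B \<subseteq> V'"
    "\<And>x. x \<in> V' \<Longrightarrow> (\<Sum>b\<in>B. (x \<bullet> b) *\<^sub>R b) = x"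
    using orthonormal_expansion[OF assms(5)] by metis
  obtain f' where f': "(f has_derivative f') (at x within V)"
    "\<And>v. v \<in> V \<Longrightarrow> dir_deriv v f x = f' v"
    using differentiable_dir_deriv assms by metis
  have "((\<lambda>y. \<Sum>b\<in>B. (f y \<bullet> b) *\<^sub>R b) has_derivative (\<lambda>h.
    \<Sum>b\<in>B. (f' h \<bullet> b) *\<^sub>R b)) (at x within V)"
    by (auto intro!: derivative_eq_intros f')
  then have "dir_deriv v (\<lambda>y. \<Sum>b\<in>B. (f y \<bullet> b) *\<^sub>R b) x =
    (\<Sum>b\<in>B. (f' v \<bullet> b) *\<^sub>R b)"
    using assms by (intro dir_deriv_eq[of _
      "\<lambda>h. \<Sum>b\<in>B. (f' h \<bullet> b) *\<^sub>R b"]) auto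
  moreover have "dir_deriv v (\<lambda>y. \<Sum>b\<in>B. (f y \<bullet> b) *\<^sub>R b) x = dir_deriv v f x"
    using assms B by (intro dir_deriv_cong[of U x V]) auto
  ultimately show ?thesis
    using B assms by (auto intro!: subspace_sum subspace_scale)
qed

text \<open>In the plain chain rule the outer derivative is taken in the direction
  \<open>dir_deriv v (f z) x\<close>, which varies with the point and is not covered by
  \<open>C_par\<close>. Expanding this direction in a fixed basis of \<open>V'\<close> leaves only
  derivatives in fixed directions, composed with \<open>f\<close>, to which the induction hypothesis
  applies.\<close>

lemma C_par_compose:
  fixes V :: "'a::euclidean_space set" and V' :: "'b::euclidean_space set"
    and g :: "'z::topological_space \<Rightarrow> 'b \<Rightarrow> 'c::real_normed_vector"
  assumes V: "subspace V" and A: "openin (top_of_set (UNIV \<times> V)) A"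
    and V': "subspace V'" and A': "openin (top_of_set (UNIV \<times> V')) A'"
    and f: "C_par V k A f" and g: "C_par V' k A' g"
    and into: "\<And>z x. (z, x) \<in> A \<Longrightarrow> (z, f z x) \<in> A'"
  shows "C_par V k A (\<lambda>z x. g z (f z x))"
  using f g into
proof (induction k arbitrary: g)
  case 0
  then have c: "continuous_on A' (\<lambda>p. g (fst p) (snd p))" by simp
  have "continuous_on A (\<lambda>p. (\<lambda>p. g (fst p) (snd p)) (fst p, f (fst p) (snd p)))"
    by (rule continuous_on_compose2[OF c]) (use 0 in \<open>auto intro!: continuous_intros\<close>)
  then show ?case by simp
next
  case (Suc k)
  have c: "continuous_on A' (\<lambda>p. g (fst p) (snd p))"
    "continuous_on A (\<lambda>p. f (fst p) (snd p))"
    using Suc.prems by auto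
  have "continuous_on A (\<lambda>p. (\<lambda>p. g (fst p) (snd p)) (fst p, f (fst p) (snd p)))"
    by (rule continuous_on_compose2[OF c(1)]) (use Suc.prems c in \<open>auto intro!:
      continuous_intros\<close>)
  then have cont: "continuous_on A (\<lambda>p. g (fst p) (f (fst p) (snd p)))" by simp
  obtain B where B: "finite B" "B \<subseteq> V'"
    "\<And>x. x \<in> V' \<Longrightarrow> (\<Sum>b\<in>B. (x \<bullet> b) *\<^sub>R b) = x"
    using orthonormal_expansion[OF V'] by metis
  have main: "(\<lambda>x. g z (f z x)) differentiable (at x within V) \<and>
      (\<forall>v\<in>V. dir_deriv v (\<lambda>x. g z (f z x)) x = (\<Sum>b\<in>B. (dir_deriv v (f
        z) x \<bullet> b) *\<^sub>R dir_deriv b (g z) (f z x)))"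
    if p: "(z, x) \<in> A" for z x
  proof -
    obtain U where U: "open U" "x \<in> U"
      "\<And>y. y \<in> U \<inter> V \<Longrightarrow> (z, y) \<in> A" "x \<in> V"
      using openin_slice[OF A p] by metis
    have inV': "f z y \<in> V'" if "y \<in> U \<inter> V" for y
      using openin_imp_subset[OF A'] Suc.prems(3) U(3)[OF that] by auto
    have fd: "f z differentiable (at x within V)" using Suc.prems p by force
    then obtain f'
      where f': "(f z has_derivative f') (at x within V)"
        "\<And>v. v \<in> V \<Longrightarrow> dir_deriv v (f z) x = f' v"
      using differentiable_dir_deriv V U by metis
    have gd: "g z differentiable (at (f z x) within V')" using Suc.prems p by force
    then obtain g'
      where g': "(g z has_derivative g') (at (f z x) within V')"
        "\<And>v. v \<in> V' \<Longrightarrow> dir_deriv v (g z) (f z x) = g' v"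
      using differentiable_dir_deriv V' inV' U by (metis IntI)
    \<comment> \<open>Values in \<open>V'\<close> are known over \<open>U\<close> only, so the two
      derivatives are composed within \<open>V \<inter> U\<close>, which has the same filter at
      \<open>x\<close> as \<open>V\<close>.\<close>
    have "(f z has_derivative f') (at x within V \<inter> U)" using f' has_derivative_subset by blast
    moreover have "(g z has_derivative g') (at (f z x) within f z ` (V \<inter> U))"
      using g'(1) by (rule has_derivative_subset) (use inV' in auto)
    ultimately have "((g z \<circ> f z) has_derivative (g' \<circ> f')) (at x within V \<inter> U)"
      by (rule diff_chain_within)
    moreover have "at x within V \<inter> U = at x within V"
      using U by (intro at_within_nhd[of x U]) auto
    ultimately have comp:
      "((\<lambda>x. g z (f z x)) has_derivative (\<lambda>h. g' (f' h))) (at x within V)"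
      by (simp add: o_def)
    have "dir_deriv v (\<lambda>x. g z (f z x)) x = (\<Sum>b\<in>B. (dir_deriv v (f z) x \<bullet>
      b) *\<^sub>R dir_deriv b (g z) (f z x))" if "v \<in> V" for v
    proof -
      have in': "dir_deriv v (f z) x \<in> V'"
        using dir_deriv_in_subspace[OF fd V U(4) that V' U(1,2) inV'] by simp
      have "dir_deriv v (\<lambda>x. g z (f z x)) x = dir_deriv (dir_deriv v (f z) x) (g z) (f z x)"
        using dir_deriv_eq[OF comp V U(4) that] f'(2)[OF that] g'(2)[OF in'] by simp
      also have "\<dots> = (\<Sum>b\<in>B. (dir_deriv v (f z) x \<bullet> b) *\<^sub>R dir_deriv b
        (g z) (f z x))"
        using dir_deriv_expansion[OF gd V'] inV' U B in' by auto
      finally show ?thesis .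
    qed
    then show ?thesis using comp unfolding differentiable_def by blast
  qed
  have "C_par V k A (\<lambda>z. dir_deriv v (\<lambda>x. g z (f z x)))" if v: "v \<in> V" for v
  proof (rule C_par_cong[OF _ A V])
    show "C_par V k A (\<lambda>z x. \<Sum>b\<in>B. (dir_deriv v (f z) x \<bullet> b) *\<^sub>R
      dir_deriv b (g z) (f z x))"
    proof (rule C_par_sum[OF V A])
      fix b assume b: "b \<in> B"
      have 1: "C_par V k A (\<lambda>z x. dir_deriv v (f z) x \<bullet> b)"
        by (rule C_par_linear[OF V A bounded_linear_inner_left]) (use Suc.prems v in simp)
      have 2: "C_par V k A (\<lambda>z x. dir_deriv b (g z) (f z x))"
      proof (rule Suc.IH)
        show "C_par V k A f" by (rule C_par_mono[OF Suc.prems(1)]) auto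
        show "C_par V' k A' (\<lambda>z. dir_deriv b (g z))" using b B Suc.prems(2) by auto
      qed (rule Suc.prems(3))
      show "C_par V k A (\<lambda>z x. (dir_deriv v (f z) x \<bullet> b) *\<^sub>R dir_deriv b (g z)
        (f z x))"
        by (rule C_par_bilinear[OF V A bounded_bilinear_scaleR 1 2])
    qed
  qed (use main v in auto)
  moreover have "(\<lambda>x. g (fst p) (f (fst p) x)) differentiable (at (snd p) within V)"
    if "p \<in> A" for p
    using main[of "fst p" "snd p"] that by simp
  ultimately show ?case using cont by simp
qed

lemma openin_par:
  "openin (top_of_set V) W \<Longrightarrow> openin (top_of_set (UNIV \<times> V)) (UNIV \<times> W)"
  by (intro openin_Times) auto

lemma openin_par_UNIV: "openin (top_of_set (UNIV \<times> UNIV)) UNIV"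
  by (simp flip: UNIV_Times_UNIV)

lemma C_par_param:
  assumes "continuous_on A (\<lambda>p. c (fst p))"
  shows "C_par V k A (\<lambda>z x. c z)"
proof (cases k)
  case 0 then show ?thesis using assms by simp
next
  case (Suc j)
  have "dir_deriv v (\<lambda>x. c z) = (\<lambda>x. 0)" for v :: 'b and z
    by (rule ext) (simp add: dir_deriv_def)
  then show ?thesis using assms Suc C_par_const[of V j A "0::'c"] by simp
qed

lemma C_par_id:
  assumes "subspace V" "openin (top_of_set (UNIV \<times> V)) A"
  shows "C_par V k A (\<lambda>z x. x)"
proof (cases k)
  case 0 then show ?thesis by (auto intro!: continuous_intros)
next
  case (Suc j)
  have "C_par V j A (\<lambda>z. dir_deriv v (\<lambda>x. x))" if v: "v \<in> V" for v
  proof (rule C_par_cong[OF C_par_const[of V j A v] assms(2,1)])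
    fix z x assume "(z, x) \<in> A"
    then have "x \<in> V" using snd_in_V[OF assms] by blast
    then show "v = dir_deriv v (\<lambda>x. x) x"
      using dir_deriv_eq[OF has_derivative_ident assms(1) _ v] by simp
  qed
  then show ?thesis using Suc by (auto intro!: continuous_intros)
qed

lemma C_par_UNIV_imp:
  assumes "C_par UNIV k A G" "A' \<subseteq> A"
  shows "C_par V k A' G"
  using assms(1)
proof (induction k arbitrary: G)
  case 0 then show ?case using assms(2) by (auto intro: continuous_on_subset)
next
  case (Suc k)
  then have "continuous_on A' (\<lambda>p. G (fst p) (snd p))"
    using assms(2) by (auto intro: continuous_on_subset)
  moreover have "G (fst p) differentiable (at (snd p) within V)" if "p \<in> A'" for p
    using Suc.prems assms(2) that by (auto intro: differentiable_at_withinI)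
  ultimately show ?case using Suc by simp
qed

section \<open>The same rules for single functions\<close>

context
  fixes V :: "'a::real_normed_vector set" and W :: "'a set"
  assumes V: "subspace V" and W: "openin (top_of_set V) W"
begin

lemma C_nat_iff:
  "C_nat_on V k W f \<longleftrightarrow>
    C_par V k (UNIV \<times> W :: (real \<times> _) set) (\<lambda>_. f)"
  by (rule C_nat_on_iff_C_par) (use openin_imp_subset[OF W] in auto)

lemma C_nat_on_cong:
  "C_nat_on V k W f \<Longrightarrow> (\<And>x. x \<in> W \<Longrightarrow>
    f x = g x) \<Longrightarrow> C_nat_on V k W g"
  unfolding C_nat_iff by (erule C_par_cong[OF _ openin_par[OF W] V]) auto

lemma C_nat_on_local:
  assumes "\<And>x. x \<in> W \<Longrightarrow> \<exists>N. openin (top_of_set W) N \<and>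
    x \<in> N \<and> C_nat_on V k N f"
  shows "C_nat_on V k W f"
  unfolding C_nat_iff
proof (rule C_par_local)
  fix p :: "real \<times> 'a" assume "p \<in> UNIV \<times> W"
  then obtain N where N: "openin (top_of_set W) N" "snd p \<in> N" "C_nat_on V k N f"
    using assms by (cases p) auto
  obtain U where U: "open U" "N = W \<inter> U" using N(1) by (auto simp: openin_open)
  have "C_par V k (UNIV \<times> N :: (real \<times> _) set) (\<lambda>_. f)"
    by (rule C_nat_on_imp_C_par[OF N(3)]) (use U openin_imp_subset[OF W] in auto)
  then have "C_par V k ((UNIV \<times> W) \<inter> (UNIV \<times> U) :: (real \<times> _) set)
    (\<lambda>_. f)"
    by (simp add: U Times_Int_Times)
  moreover have "open (UNIV \<times> U :: (real \<times> _) set)" using U by (simp add: open_Times)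
  ultimately show
    "\<exists>U. open U \<and> p \<in> U \<and> C_par V k ((UNIV \<times> W) \<inter> U) (\<lambda>_. f)"
    using N(2) U(2) by (intro exI[of _ "UNIV \<times> U"]) (cases p, auto)
qed

lemma C_nat_on_linear:
  "bounded_linear L \<Longrightarrow> C_nat_on V k W f \<Longrightarrow>
    C_nat_on V k W (\<lambda>x. L (f x))"
  unfolding C_nat_iff by (rule C_par_linear[OF V openin_par[OF W]])

lemma C_nat_on_add:
  "C_nat_on V k W f \<Longrightarrow> C_nat_on V k W g \<Longrightarrow>
    C_nat_on V k W (\<lambda>x. f x + g x)"
  unfolding C_nat_iff by (rule C_par_add[OF V openin_par[OF W]])

lemma C_nat_on_Pair:
  "C_nat_on V k W f \<Longrightarrow> C_nat_on V k W g \<Longrightarrow>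
    C_nat_on V k W (\<lambda>x. (f x, g x))"
  unfolding C_nat_iff by (rule C_par_Pair[OF V openin_par[OF W]])

lemma C_nat_on_bilinear:
  "bounded_bilinear B \<Longrightarrow> C_nat_on V k W f \<Longrightarrow>
    C_nat_on V k W g \<Longrightarrow> C_nat_on V k W (\<lambda>x. B (f x) (g x))"
  unfolding C_nat_iff by (rule C_par_bilinear[OF V openin_par[OF W]])

lemma C_nat_on_const: "C_nat_on V k W (\<lambda>_. c)"
  unfolding C_nat_iff by (rule C_par_const)

lemma C_nat_on_id: "C_nat_on V k W (\<lambda>x. x)"
  unfolding C_nat_iff by (rule C_par_id[OF V openin_par[OF W]])

lemma C_nat_on_UNIV_imp:
  "C_nat_on UNIV k X f \<Longrightarrow> W \<subseteq> X \<Longrightarrow> C_nat_on V k W f"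
  unfolding C_nat_iff C_nat_on_iff_C_par[OF subset_UNIV] by (erule C_par_UNIV_imp) auto

end

lemma C_nat_on_compose:
  fixes V :: "'a::euclidean_space set" and V' :: "'b::euclidean_space set"
  assumes "subspace V" "openin (top_of_set V) W" "subspace V'" "openin (top_of_set V') W'"
    and "C_nat_on V k W f" "C_nat_on V' k W' g" "\<And>x. x \<in> W \<Longrightarrow> f x \<in> W'"
  shows "C_nat_on V k W (\<lambda>x. g (f x))"
  using assms(5,6) unfolding C_nat_iff[OF assms(1,2)] C_nat_iff[OF assms(3,4)]
  by (rule C_par_compose[OF assms(1) openin_par[OF assms(2)] assms(3) openin_par[OF assms(4)],
        where f="\<lambda>_. f" and g="\<lambda>_. g"]) (use assms(7) in auto)

section \<open>Smooth step and bump functions\<close>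

lemma C_nat_on_real_Suc:
  fixes f :: "real \<Rightarrow> real"
  assumes "open S" and d: "\<And>x. x \<in> S \<Longrightarrow> (f has_real_derivative f' x) (at x)"
    and "C_nat_on UNIV k S f'"
  shows "C_nat_on UNIV (Suc k) S f"
proof -
  have S: "openin (top_of_set UNIV) S" using assms by simp
  have "C_nat_on UNIV k S (dir_deriv v f)" for v
  proof (rule C_nat_on_cong[OF subspace_UNIV S])
    show "C_nat_on UNIV k S (\<lambda>x. v * f' x)"
      using C_nat_on_linear[OF subspace_UNIV S bounded_linear_mult_right assms(3)] .
    show "v * f' x = dir_deriv v f x" if "x \<in> S" for x
      using dir_deriv_eq[OF d[OF that, unfolded has_field_derivative_def] subspace_UNIV] by simp
  qed
  then show ?thesis using d by (auto simp: real_differentiable_def)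
qed

lemma C_nat_on_inverse: "C_nat_on UNIV k {x. x \<noteq> 0} (inverse :: real \<Rightarrow> real)"
proof (induction k)
  case 0 then show ?case by (auto intro!: continuous_intros)
next
  case (Suc k)
  have o: "open {x::real. x \<noteq> 0}" by (simp add: open_Collect_neq)
  then have S: "openin (top_of_set UNIV) {x::real. x \<noteq> 0}" by simp
  show ?case
  proof (rule C_nat_on_real_Suc[OF o])
    show "(inverse has_real_derivative - (inverse x * inverse x)) (at x)"
      if "x \<in> {x. x \<noteq> 0}" for x :: real
      using that DERIV_inverse[of x UNIV] by (simp add: power2_eq_square eval_nat_numeral)
    show "C_nat_on UNIV k {x. x \<noteq> 0} (\<lambda>x::real. - (inverse x * inverse x))"
      using C_nat_on_linear[OF subspace_UNIV S bounded_linear_minus[OF bounded_linear_ident]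
        C_nat_on_bilinear[OF subspace_UNIV S bounded_bilinear_mult Suc Suc]] by simp
  qed
qed

text \<open>The derivative of \<open>flat n\<close> is a linear combination of functions of the same
  family, so
  smoothness follows by induction for all \<open>n\<close> simultaneously.\<close>

definition flat :: "nat \<Rightarrow> real \<Rightarrow> real"
  where "flat n t = (if t > 0 then exp (- inverse t) * inverse t ^ n else 0)"

lemma flat_tendsto_0: "(flat n \<longlongrightarrow> 0) (at 0)"
proof (rule filterlim_split_at)
  show "(flat n \<longlongrightarrow> 0) (at_left 0)"
    by (rule tendsto_eventually) (auto simp: flat_def eventually_at_left_field intro!: exI[of _ "-1"])
  have "((\<lambda>t. inverse t ^ n / exp (inverse t)) \<longlongrightarrow> 0) (at_right (0::real))"
    by (rule filterlim_compose[OF tendsto_power_div_exp_0 filterlim_inverse_at_top_right])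
  moreover have "eventually (\<lambda>t. inverse t ^ n / exp (inverse t) = flat n t) (at_right 0)"
    by (auto simp: flat_def eventually_at_right_field exp_minus field_simps intro!: exI[of _ 1])
  ultimately show "(flat n \<longlongrightarrow> 0) (at_right 0)"
    by (rule Lim_transform_eventually)
qed

lemma flat_has_real_derivative:
  "(flat n has_real_derivative (flat (n + 2) t - of_nat n * flat (n + 1) t)) (at t)"
proof -
  consider "t > 0" | "t < 0" | "t = 0" by linarith
  then show ?thesis
  proof cases
    case 1
    have eq: "\<And>x. x \<in> {0<..} \<Longrightarrow>
      exp (- inverse x) * inverse x ^ n = flat n x" by (simp add: flat_def)
    have "((\<lambda>x. exp (- inverse x) * inverse x ^ n) has_real_derivative
        exp (- inverse t) * (inverse t * inverse t) * inverse t ^ n +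
        exp (- inverse t) * (of_nat n * inverse t ^ (n - 1) * - (inverse t * inverse t))) (at t)"
      using 1 by (auto intro!: derivative_eq_intros simp: power2_eq_square)
    also have "exp (- inverse t) * (inverse t * inverse t) * inverse t ^ n +
        exp (- inverse t) * (of_nat n * inverse t ^ (n - 1) * - (inverse t * inverse t))
        = flat (n + 2) t - of_nat n * flat (n + 1) t"
      using 1 by (cases n) (simp_all add: flat_def algebra_simps)
    finally show ?thesis
      by (rule has_field_derivative_transform_within_open[of _ _ _ "{0<..}"]) (use 1 eq in auto)
  next
    case 2
    have "((\<lambda>_. 0) has_real_derivative 0) (at t)" by simp
    then have "(flat n has_real_derivative 0) (at t)"
      by (rule has_field_derivative_transform_within_open[of _ _ _
        "{..<0}"]) (use 2 in \<open>auto simp: flat_def\<close>)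
    then show ?thesis using 2 by (simp add: flat_def)
  next
    case 3
    \<comment> \<open>The difference quotient of \<open>flat n\<close> at 0 is
      \<open>flat (n + 1)\<close> itself, because \<open>flat n 0 = 0\<close>.\<close>
    have "eventually (\<lambda>h. flat (n + 1) h = (flat n (0 + h) - flat n 0) / h) (at 0)"
      by (auto simp: flat_def eventually_at_filter field_simps)
    then have "((\<lambda>h. (flat n (0 + h) - flat n 0) / h) \<longlongrightarrow> 0) (at 0)"
      by (rule Lim_transform_eventually[OF flat_tendsto_0])
    then show ?thesis using 3 by (simp add: DERIV_def flat_def)
  qed
qed

lemma flat_smooth: "C_nat_on UNIV k UNIV (flat n)"
proof (induction k arbitrary: n)
  case 0
  show ?case using flat_has_real_derivative DERIV_isCont continuous_at_imp_continuous_on by simp blast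
next
  case (Suc k)
  have S: "openin (top_of_set UNIV) (UNIV::real set)" by simp
  have "C_nat_on UNIV k UNIV (\<lambda>t. flat (n + 2) t + (- of_nat n) * flat (n + 1) t)"
    by (rule C_nat_on_add[OF subspace_UNIV S Suc C_nat_on_linear[OF subspace_UNIV S
      bounded_linear_mult_right Suc]])
  then show ?case
    by (intro C_nat_on_real_Suc[of UNIV _ "\<lambda>t. flat (n + 2) t + (- of_nat n) * flat (n + 1) t"])
       (use flat_has_real_derivative[of n] in auto)
qed

definition smooth_step :: "real \<Rightarrow> real"
  where "smooth_step t = flat 0 t * inverse (flat 0 t + flat 0 (1 - t))"

lemma flat_0_nonneg: "flat 0 t \<ge> 0" and flat_0_pos: "t > 0 \<Longrightarrow> flat 0 t > 0"
  and flat_nonpos: "t \<le> 0 \<Longrightarrow> flat 0 t = 0"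
  by (auto simp: flat_def)

text \<open>\<open>t\<close> and \<open>1 - t\<close> cannot both be nonpositive, so one of the two
  terms is positive.\<close>

lemma smooth_step_denominator: "flat 0 t + flat 0 (1 - t) > 0"
  using flat_0_nonneg[of t] flat_0_nonneg[of "1 - t"] flat_0_pos[of t] flat_0_pos[of "1 - t"] by linarith

lemma smooth_step_smooth: "C_nat_on UNIV k UNIV smooth_step"
proof -
  have S: "openin (top_of_set UNIV) (UNIV::real set)" by simp
  have o: "openin (top_of_set UNIV) {x::real. x \<noteq> 0}" by (simp add: open_Collect_neq)
  have "C_nat_on UNIV k UNIV (\<lambda>t::real. 1 + - t)"
    by (intro C_nat_on_add[OF subspace_UNIV S] C_nat_on_const[OF subspace_UNIV S]
        C_nat_on_linear[OF subspace_UNIV S bounded_linear_minus[OF bounded_linear_ident]]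
          C_nat_on_id[OF subspace_UNIV S])
  then have "C_nat_on UNIV k UNIV (\<lambda>t. flat 0 (1 + - t))"
    by (rule C_nat_on_compose[OF subspace_UNIV S subspace_UNIV S _ flat_smooth]) simp
  then have "C_nat_on UNIV k UNIV (\<lambda>t. flat 0 t + flat 0 (1 - t))"
    using C_nat_on_add[OF subspace_UNIV S flat_smooth] by simp
  then have "C_nat_on UNIV k UNIV (\<lambda>t. inverse (flat 0 t + flat 0 (1 - t)))"
    by (rule C_nat_on_compose[OF subspace_UNIV S subspace_UNIV o _ C_nat_on_inverse])
       (metis less_irrefl mem_Collect_eq smooth_step_denominator)
  then show ?thesis
    unfolding smooth_step_def
      by (rule C_nat_on_bilinear[OF subspace_UNIV S bounded_bilinear_mult flat_smooth])
qed

lemma smooth_step_simps: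
  shows "t \<le> 0 \<Longrightarrow> smooth_step t = 0"
    and "t \<ge> 1 \<Longrightarrow> smooth_step t = 1"
    and "smooth_step t \<ge> 0"
proof -
  note d = smooth_step_denominator[of t]
  show "smooth_step t = 0" if "t \<le> 0" using that by (simp add: smooth_step_def flat_nonpos)
  show "smooth_step t = 1" if "t \<ge> 1" using that d by (simp add: smooth_step_def flat_nonpos)
  show "smooth_step t \<ge> 0" using d flat_0_nonneg[of t] by (simp add: smooth_step_def)
qed

text \<open>For 0 \<le> a < b this is a cutoff with value 1 up to distance \<open>a\<close> from
  \<open>y\<close> and 0 from distance \<open>b\<close> on. Using the squared distance avoids the
  singularity of the norm at \<open>y\<close>.\<close>

definition bump ::
  "'a::euclidean_space \<Rightarrow> real \<Rightarrow> real \<Rightarrow> 'a \<Rightarrow> real"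
  where "bump y a b x = smooth_step ((b\<^sup>2 - (x - y) \<bullet> (x - y)) / (b\<^sup>2 - a\<^sup>2))"

lemma bump_smooth: "C_nat_on UNIV k UNIV (bump y a b)"
proof -
  have S: "openin (top_of_set UNIV) (UNIV::'a set)" by simp
  have "C_nat_on UNIV k UNIV (\<lambda>x. x + - y)"
    by (intro C_nat_on_add[OF subspace_UNIV S] C_nat_on_const[OF subspace_UNIV S] C_nat_on_id[OF
      subspace_UNIV S])
  from C_nat_on_bilinear[OF subspace_UNIV S bounded_bilinear_inner this this]
  have "C_nat_on UNIV k UNIV (\<lambda>x. (x - y) \<bullet> (x - y))" by simp
  from C_nat_on_linear[OF subspace_UNIV S bounded_linear_mult_right this]
  have "C_nat_on UNIV k UNIV (\<lambda>x. (- 1 / (b\<^sup>2 - a\<^sup>2)) * ((x - y) \<bullet> (x - y)))" .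
  from C_nat_on_add[OF subspace_UNIV S C_nat_on_const[OF subspace_UNIV S] this]
  have "C_nat_on UNIV k UNIV (\<lambda>x. b\<^sup>2 / (b\<^sup>2 - a\<^sup>2) + (- 1 / (b\<^sup>2 -
    a\<^sup>2)) * ((x - y) \<bullet> (x - y)))" .
  from C_nat_on_compose[OF subspace_UNIV S subspace_UNIV _ this smooth_step_smooth]
  have "C_nat_on UNIV k UNIV (\<lambda>x. smooth_step (b\<^sup>2 / (b\<^sup>2 - a\<^sup>2) + (- 1 /
    (b\<^sup>2 - a\<^sup>2)) * ((x - y) \<bullet> (x - y))))" by simp
  then show ?thesis
    unfolding bump_def by (simp add: diff_divide_distrib)
qed

lemma bump_outside:
  "0 \<le> a \<Longrightarrow> a < b \<Longrightarrow> b \<le> dist x y \<Longrightarrow> bump y a b x = 0"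
  and bump_inside:
    "0 \<le> a \<Longrightarrow> a < b \<Longrightarrow> dist x y \<le> a \<Longrightarrow>
      bump y a b x = 1"
  and bump_nonneg: "bump y a b x \<ge> 0"
proof -
  have eq: "(x - y) \<bullet> (x - y) = (dist x y)\<^sup>2" by (simp add: dist_norm power2_norm_eq_inner)
  assume ab: "0 \<le> a" "a < b"
  then have d: "b\<^sup>2 - a\<^sup>2 > 0" using power_strict_mono[of a b 2] by simp
  show "bump y a b x = 0" if "b \<le> dist x y"
    unfolding bump_def eq using d that ab power_mono[of b "dist x y" 2]
    by (intro smooth_step_simps(1)) (simp add: divide_le_0_iff)
  show "bump y a b x = 1" if "dist x y \<le> a"
    unfolding bump_def eq using d that ab power_mono[of "dist x y" a 2]
    by (intro smooth_step_simps(2)) simp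
qed (simp add: bump_def smooth_step_simps)

text \<open>Differentiation under the integral sign. The integration variable is made part of the
  parameter of \<open>f\<close>, so the hypothesis supplies joint continuity of all derivatives in
  z, y and x while asking for no differentiability in y.\<close>

lemma C_par_integral:
  fixes f :: "('z::topological_space \<times> 'y::euclidean_space) \<Rightarrow> 'a::euclidean_space
    \<Rightarrow> 'b::euclidean_space"
  assumes "C_par UNIV k UNIV f"
  shows "C_par UNIV k UNIV (\<lambda>z x. integral (cbox a b) (\<lambda>y. f (z, y) x))"
  using assms
proof (induction k arbitrary: f)
  case 0
  then have c: "continuous_on UNIV (\<lambda>p. f (fst p) (snd p))" by simp
  have "continuous_on (UNIV \<times> cbox a b) (\<lambda>q. (\<lambda>p. f (fst p) (snd p)) ((fst
    (fst q), snd q), snd (fst q)))"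
    by (rule continuous_on_compose2[OF c]) (auto intro!: continuous_intros)
  then have "continuous_on UNIV (\<lambda>p. integral (cbox a b) (\<lambda>y. f (fst p, y) (snd p)))"
    by (intro integral_continuous_on_param) (simp add: case_prod_beta)
  then show ?case by simp
next
  case (Suc k)
  have c: "continuous_on UNIV (\<lambda>p. f (fst p) (snd p))"
    using Suc.prems by simp_all
  have dif: "f q differentiable (at x)" for q x
  proof -
    have "f (fst (q, x)) differentiable (at (snd (q, x)))" using Suc.prems unfolding C_par.simps by blast
    then show ?thesis by simp
  qed
  have cd: "continuous_on UNIV (\<lambda>p. dir_deriv v (f (fst p)) (snd p))" for v
    using Suc.prems C_par_cont[of UNIV k UNIV "\<lambda>q. dir_deriv v (f q)"] by simp
  have ct: "continuous_on S (\<lambda>y. dir_deriv v (f (z, y)) x)" for S v z x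
  proof -
    have "continuous_on S (\<lambda>y. ((z, y), x))" by (intro continuous_intros)
    then show ?thesis using continuous_on_compose2[OF cd[of v], of S "\<lambda>y. ((z, y), x)"] by simp
  qed
  have cf: "continuous_on S (\<lambda>y. f (z, y) x)" for S z x
  proof -
    have "continuous_on S (\<lambda>y. ((z, y), x))" by (intro continuous_intros)
    then show ?thesis using continuous_on_compose2[OF c, of S "\<lambda>y. ((z, y), x)"] by simp
  qed
  \<comment> \<open>The Leibniz rule asks for an operator-valued derivative that is continuous in
    operator norm. Assembling it from the partial derivatives along \<open>Basis\<close> reduces
    this to the scalar continuity facts \<open>cd\<close> and \<open>ct\<close>.\<close>
  define D where
    "D z x y = (\<Sum>i\<in>Basis. blinfun_scaleR_left (dir_deriv i (f (z, y)) x) o\<^sub>L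
      blinfun_inner_left i)" for z x y
  have D: "(f (z, y) has_derivative blinfun_apply (D z x y)) (at x)"
    and Dv: "blinfun_apply (D z x y) v = dir_deriv v (f (z, y)) x" for z x y v
  proof -
    obtain f' where f': "(f (z, y) has_derivative f') (at x)" "\<And>v. dir_deriv v (f (z, y)) x = f' v"
      by (rule differentiable_dir_deriv[OF dif[of "(z, y)" x] subspace_UNIV UNIV_I]) (rule that, auto)
    interpret bounded_linear f' using f'(1) by (rule has_derivative_bounded_linear)
    have "f' h = blinfun_apply (D z x y) h" for h
    proof -
      have "f' h = f' (\<Sum>i\<in>Basis. (h \<bullet> i) *\<^sub>R i)"
        by (simp add: euclidean_representation)
      also have "\<dots> = (\<Sum>i\<in>Basis. (h \<bullet> i) *\<^sub>R f' i)" by (simp add: sum scale)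
      finally show ?thesis by (simp add: D_def blinfun.sum_left f'(2))
    qed
    then have "f' = blinfun_apply (D z x y)" by (rule ext)
    then show "(f (z, y) has_derivative blinfun_apply (D z x y)) (at x)"
      "blinfun_apply (D z x y) v = dir_deriv v (f (z, y)) x" using f' by auto
  qed
  have cD: "continuous_on (UNIV \<times> cbox a b) (\<lambda>(x, y). D z x y)" for z
  proof -
    have "continuous_on (UNIV \<times> cbox a b) (\<lambda>q. ((z, snd q), fst q))"
      by (intro continuous_intros)
    then have "continuous_on (UNIV \<times> cbox a b) (\<lambda>q. dir_deriv v (f (z, snd q)) (fst
      q))" for v
      using continuous_on_compose2[OF cd[of v], of "UNIV \<times> cbox a b"
        "\<lambda>q. ((z, snd q), fst q)"] by simp
    then show ?thesis unfolding D_def case_prod_beta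
      by (intro continuous_on_sum bounded_bilinear.continuous_on[OF bounded_bilinear_blinfun_compose]
          bounded_linear.continuous_on[OF bounded_linear_blinfun_scaleR_left] continuous_on_const)
  qed
  have leib: "((\<lambda>x. integral (cbox a b) (\<lambda>y. f (z, y) x)) has_derivative integral
    (cbox a b) (D z x)) (at x)" for z x
    by (rule leibniz_rule[where U=UNIV and f="\<lambda>x y. f (z, y) x" and fx="D z" and ?x0.0=x
      and a=a and b=b])
       (use D cD in \<open>simp_all add: integrable_continuous cf\<close>)
  have "continuous_on S (D z x)" for S z x
    unfolding D_def
    by (intro continuous_on_sum bounded_bilinear.continuous_on[OF bounded_bilinear_blinfun_compose]
          bounded_linear.continuous_on[OF bounded_linear_blinfun_scaleR_left] continuous_on_const ct)
  then have "integral (cbox a b) (D z x) v = integral (cbox a b) (\<lambda>y. dir_deriv v (f (z, y))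
    x)" for z x v
    by (subst blinfun_apply_integral) (auto intro!: integrable_continuous simp: Dv)
  then have dd: "dir_deriv v (\<lambda>x. integral (cbox a b) (\<lambda>y. f (z, y) x))
      = (\<lambda>x. integral (cbox a b) (\<lambda>y. dir_deriv v (f (z, y)) x))" for v z
    using dir_deriv_eq[OF leib subspace_UNIV] by (intro ext) simp
  have "continuous_on (UNIV \<times> cbox a b) (\<lambda>q. (\<lambda>p. f (fst p) (snd p)) ((fst
    (fst q), snd q), snd (fst q)))"
    by (rule continuous_on_compose2[OF c]) (auto intro!: continuous_intros)
  then have "continuous_on UNIV (\<lambda>p. integral (cbox a b) (\<lambda>y. f (fst p, y) (snd p)))"
    by (intro integral_continuous_on_param) (simp add: case_prod_beta)
  moreover have
    "C_par UNIV k UNIV (\<lambda>z x. integral (cbox a b) (\<lambda>y. dir_deriv v (f (z, y)) x))" for v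
    using Suc.IH[of "\<lambda>q. dir_deriv v (f q)"] Suc.prems by simp
  ultimately show ?case
    using leib by (auto simp: dd differentiable_def)
qed


section \<open>Mollification\<close>

text \<open>The box contains the unit ball, outside which this bump vanishes, so the mass is the
  integral over the whole space.\<close>

definition mollifier_mass :: "'a::euclidean_space itself \<Rightarrow> real"
  where "mollifier_mass _ = integral (cbox (- One) One :: 'a set) (bump 0 (1/2) 1)"

text \<open>For \<open>z = 0\<close> this is the identity, so that the approximation of
  \<open>h\<close> becomes continuity
  in \<open>z\<close>.\<close>

definition mollify ::
  "('a::euclidean_space \<Rightarrow> 'b::euclidean_space) \<Rightarrow> real \<Rightarrow> 'a
    \<Rightarrow> 'b"
  where "mollify h z x = (1 / mollifier_mass TYPE('a)) *\<^sub>R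
    integral (cbox (- One) One) (\<lambda>y. bump 0 (1/2) 1 y *\<^sub>R h (x - z *\<^sub>R y))"

lemma bump_continuous: "continuous_on S (bump y a b)"
  using bump_smooth[of 0 y a b] continuous_on_subset by auto

lemma mollifier_mass_pos: "mollifier_mass TYPE('a::euclidean_space) > 0"
proof -
  let ?C = "cbox (- One) One :: 'a set"
  have int: "(bump 0 (1/2) 1 has_integral mollifier_mass TYPE('a)) ?C"
    unfolding mollifier_mass_def by (intro integrable_integral integrable_continuous bump_continuous)
  then have "mollifier_mass TYPE('a) \<ge> 0"
    by (rule has_integral_nonneg) (simp add: bump_nonneg)
  moreover have "mollifier_mass TYPE('a) \<noteq> 0"
  proof
    assume 0: "mollifier_mass TYPE('a) = 0"
    have "bump 0 (1/2) 1 (0::'a) = 0"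
    proof (rule has_integral_0_cbox_imp_0[OF bump_continuous])
      show "(bump 0 (1/2) 1 has_integral 0) ?C" using int 0 by simp
      show "box (- One) One \<noteq> ({} :: 'a set)" by (simp add: box_ne_empty)
    qed (auto simp: bump_nonneg mem_box)
    then show False by (simp add: bump_inside)
  qed
  ultimately show ?thesis by simp
qed

lemma mollify_0:
  fixes h :: "'a::euclidean_space \<Rightarrow> 'b::euclidean_space"
  shows "mollify h 0 x = h x"
proof -
  have "bump 0 (1/2) 1 integrable_on (cbox (- One) One :: 'a set)"
    by (intro integrable_continuous bump_continuous)
  then have "integral (cbox (- One) One) (\<lambda>y::'a. bump 0 (1/2) 1 y *\<^sub>R h x) =
    mollifier_mass TYPE('a) *\<^sub>R h x"
    unfolding mollifier_mass_def
      by (intro integral_unique has_integral_scaleR_left) (rule integrable_integral)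
  then show ?thesis using mollifier_mass_pos[where 'a='a] by (simp add: mollify_def)
qed

text \<open>In the form h(x - z y) all derivatives fall on \<open>h\<close> and nothing is divided
  by z. Only the order of differentiability of \<open>h\<close> is attained, but the continuity in
  the parameter includes z = 0.\<close>

lemma C_par_mollify:
  assumes "C_nat_on UNIV k UNIV h"
  shows "C_par UNIV k UNIV (mollify h)"
proof -
  have o: "openin (top_of_set (UNIV \<times> UNIV)) (UNIV :: ((real \<times> 'a) \<times> 'a) set)" 
    "openin (top_of_set (UNIV \<times> UNIV)) (UNIV :: (real \<times> 'a) set)" by (rule openin_par_UNIV)+
  have "C_par UNIV k UNIV (\<lambda>(q :: real \<times> 'a) x. - fst q *\<^sub>R snd q)"
    by (rule C_par_param) (intro continuous_intros)
  from C_par_add[OF subspace_UNIV o(1) C_par_id[OF subspace_UNIV o(1)] this]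
  have 1: "C_par UNIV k UNIV (\<lambda>(q :: real \<times> 'a) x. x - fst q *\<^sub>R snd q)" by simp
  have "C_par UNIV k UNIV (\<lambda>(q :: real \<times> 'a). h)"
    by (rule C_nat_on_imp_C_par[OF assms]) auto
  from C_par_compose[OF subspace_UNIV o(1) subspace_UNIV o(1) 1 this]
  have 2: "C_par UNIV k UNIV (\<lambda>(q :: real \<times> 'a) x. h (x - fst q *\<^sub>R snd q))" by simp
  have "C_par UNIV k UNIV (\<lambda>(q :: real \<times> 'a) (x::'a). bump 0 (1/2) 1 (snd q))"
    by (rule C_par_param) (intro continuous_on_compose2[OF bump_continuous[of UNIV]]
      continuous_intros subset_UNIV)
  from C_par_bilinear[OF subspace_UNIV o(1) bounded_bilinear_scaleR this 2]
  have "C_par UNIV k UNIV (\<lambda>(q :: real \<times> 'a) x. bump 0 (1/2) 1 (snd q) *\<^sub>R h (x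
    - fst q *\<^sub>R snd q))" .
  from C_par_integral[OF this, of "- One" One]
  have "C_par UNIV k UNIV (\<lambda>z x. integral (cbox (- One) One) (\<lambda>y. bump 0 (1/2) 1 y
    *\<^sub>R h (x - z *\<^sub>R y)))"
    by simp
  from C_par_linear[OF subspace_UNIV o(2) bounded_linear_scaleR_right this]
  show ?thesis unfolding mollify_def[abs_def] .
qed

text \<open>For nonzero z, taking x - z y as the new integration variable moves \<open>x\<close>
  into the bump function. All derivatives then fall on the bump, and \<open>h\<close> need only be
  continuous.\<close>

lemma mollify_smooth:
  fixes h :: "'a::euclidean_space \<Rightarrow> 'b::euclidean_space"
  assumes "continuous_on UNIV h" and supp: "\<And>y. y \<notin> cbox c d \<Longrightarrow> h y = 0"
    and "z \<noteq> 0"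
  shows "C_nat_on UNIV k UNIV (mollify h z)"
proof -
  define \<rho> :: "'a \<Rightarrow> real" where "\<rho> = bump 0 (1/2) 1"
  let ?C = "cbox (- One) One :: 'a set"
  have out: "\<rho> y = 0" if "y \<notin> ?C" for y
  proof -
    have "\<exists>i\<in>Basis. \<not> (- 1 \<le> y \<bullet> i \<and> y \<bullet> i \<le> 1)"
      using that by (simp add: mem_box)
    then obtain i where i: "i \<in> Basis" "y \<bullet> i < - 1 \<or> 1 < y \<bullet> i"
      using not_le by blast
    then have "norm y \<ge> 1" using Basis_le_norm[OF i(1), of y] by linarith
    then show ?thesis unfolding \<rho>_def by (intro bump_outside) auto
  qed
  have eq: "mollify h z x = (\<bar>1/z\<bar> ^ DIM('a) / mollifier_mass TYPE('a)) *\<^sub>R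
      integral (cbox c d) (\<lambda>y. \<rho> ((1/z) *\<^sub>R (x - y)) *\<^sub>R h y)" for x
  proof -
    define F where "F y = \<rho> y *\<^sub>R h (x - z *\<^sub>R y)" for y
    define G where "G y = \<rho> ((1/z) *\<^sub>R (x - y)) *\<^sub>R h y" for y
    have FG: "F ((- 1/z) *\<^sub>R y + (1/z) *\<^sub>R x) = G y" for y
    proof -
      have "(- 1/z) *\<^sub>R y + (1/z) *\<^sub>R x = (1/z) *\<^sub>R (x - y)"
        by (simp add: scaleR_right_diff_distrib)
      moreover have "x - z *\<^sub>R (1/z) *\<^sub>R (x - y) = y" using \<open>z \<noteq> 0\<close> by simp
      ultimately show ?thesis by (simp add: F_def G_def)
    qed
    have "continuous_on ?C F" unfolding F_def \<rho>_def
      by (intro continuous_intros bump_continuous continuous_on_compose2[OF assms(1)] subset_UNIV)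
    then have F: "(F has_integral integral ?C F) ?C" by (intro integrable_integral integrable_continuous)
    let ?D = "(\<lambda>y. (1 / (- 1/z)) *\<^sub>R y + - ((1 / (- 1/z)) *\<^sub>R ((1/z) *\<^sub>R
      x))) ` ?C"
    have G: "(G has_integral (1 / \<bar>- 1/z\<bar> ^ DIM('a)) *\<^sub>R integral ?C F) ?D"
      using has_integral_affinity[OF F, of "- 1/z" "(1/z) *\<^sub>R x"] \<open>z \<noteq> 0\<close>
        unfolding FG by simp
    \<comment> \<open>The domain \<open>?D\<close> produced by the substitution moves with
      \<open>x\<close>. Passing through the whole space, where the bump vanishes off
      \<open>?D\<close> and \<open>h\<close> vanishes off \<open>cbox c d\<close>, replaces it by a
      fixed box, as \<open>C_par_integral\<close> requires.\<close>
    have "(G has_integral (1 / \<bar>- 1/z\<bar> ^ DIM('a)) *\<^sub>R integral ?C F) UNIV"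
    proof (rule has_integral_on_superset[OF G])
      fix y assume y: "y \<notin> ?D"
      have "y = (1 / (- 1/z)) *\<^sub>R ((1/z) *\<^sub>R (x - y)) + - ((1 / (- 1/z)) *\<^sub>R
        ((1/z) *\<^sub>R x))"
        using \<open>z \<noteq> 0\<close> by (simp add: algebra_simps)
      with y have "(1/z) *\<^sub>R (x - y) \<notin> ?C" by blast
      then show "G y = 0" by (simp add: G_def out)
    qed simp
    moreover have "(\<lambda>y. if y \<in> cbox c d then G y else 0) = G" using supp by (auto simp: G_def)
    ultimately have "(G has_integral (1 / \<bar>- 1/z\<bar> ^ DIM('a)) *\<^sub>R integral ?C F) (cbox c d)"
      using has_integral_restrict_UNIV[of "cbox c d" G] by simp
    then have "integral (cbox c d) G = (1 / \<bar>1/z\<bar> ^ DIM('a)) *\<^sub>R integral ?C F"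
      by (simp add: integral_unique)
    then have "integral ?C F = \<bar>1/z\<bar> ^ DIM('a) *\<^sub>R integral (cbox c d) G"
      using \<open>z \<noteq> 0\<close> by simp
    then show ?thesis unfolding mollify_def F_def G_def \<rho>_def by simp
  qed
  have o: "openin (top_of_set (UNIV \<times> UNIV)) (UNIV :: ((real \<times> 'a) \<times> 'a) set)"
     "openin (top_of_set (UNIV \<times> UNIV)) (UNIV :: (real \<times> 'a) set)" by (rule openin_par_UNIV)+
  have "C_par UNIV k UNIV (\<lambda>(q :: real \<times> 'a) x. - snd q)"
    by (rule C_par_param) (intro continuous_intros)
  from C_par_linear[OF subspace_UNIV o(1) bounded_linear_scaleR_right
      C_par_add[OF subspace_UNIV o(1) C_par_id[OF subspace_UNIV o(1)] this], of "1/z"]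
  have 1: "C_par UNIV k UNIV (\<lambda>(q :: real \<times> 'a) x. (1/z) *\<^sub>R (x - snd q))" by simp
  have "C_par UNIV k UNIV (\<lambda>(q :: real \<times> 'a). \<rho>)"
    unfolding \<rho>_def by (rule C_nat_on_imp_C_par[OF bump_smooth]) auto
  from C_par_compose[OF subspace_UNIV o(1) subspace_UNIV o(1) 1 this]
  have 2: "C_par UNIV k UNIV (\<lambda>(q :: real \<times> 'a) x. \<rho> ((1/z) *\<^sub>R (x - snd
    q)))" by simp
  \<comment> \<open>\<open>h\<close> is evaluated at the integration variable only, so it counts as
    a continuous function of the parameter.\<close>
  have "C_par UNIV k UNIV (\<lambda>(q :: real \<times> 'a) (x::'a). h (snd q))"
    by (rule C_par_param) (intro continuous_on_compose2[OF assms(1)] continuous_intros subset_UNIV)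
  from C_par_bilinear[OF subspace_UNIV o(1) bounded_bilinear_scaleR 2 this]
  have "C_par UNIV k UNIV (\<lambda>(q :: real \<times> 'a) x. \<rho> ((1/z) *\<^sub>R (x - snd q))
    *\<^sub>R h (snd q))" .
  from C_par_integral[OF this, of c d]
  have "C_par UNIV k UNIV (\<lambda>(_::real) x. integral (cbox c d) (\<lambda>y. \<rho> ((1/z)
    *\<^sub>R (x - y)) *\<^sub>R h y))" by simp
  from C_par_linear[OF subspace_UNIV o(2) bounded_linear_scaleR_right this]
  have "C_par UNIV k UNIV (\<lambda>(_::real). mollify h z)" unfolding eq[abs_def] .
  then show ?thesis by (rule C_par_imp_C_nat_on[of _ _ _ _ _ 0]) simp
qed

section \<open>Smoothing a function on an open subset of a subspace\<close>

lemma subspace_projection: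
  fixes V :: "'a::euclidean_space set"
  assumes "subspace V"
  obtains L where "bounded_linear L" "\<And>x. L x \<in> V"
    "\<And>x. x \<in> V \<Longrightarrow> L x = x" "\<And>x. norm (L x) \<le> norm x"
proof -
  obtain B where B: "finite B" "B \<subseteq> V"
    "\<And>x. x \<in> V \<Longrightarrow> (\<Sum>b\<in>B. (x \<bullet> b) *\<^sub>R b) = x"
    using orthonormal_expansion[OF assms] by metis
  define L where "L x = (\<Sum>b\<in>B. (x \<bullet> b) *\<^sub>R b)" for x
  have "bounded_linear L"
    unfolding L_def by (intro bounded_linear_sum bounded_linear_scaleR_const bounded_linear_inner_left)
  moreover have V: "L x \<in> V" for x
    unfolding L_def using B(2) by (auto intro!: subspace_sum[OF assms] subspace_scale[OF assms])
  moreover have "norm (L x) \<le> norm x" for x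
  proof -
    have "w \<bullet> L x = (\<Sum>b\<in>B. (x \<bullet> b) * (w \<bullet> b))" for w
      by (simp add: L_def inner_sum_right)
    from this[of "L x"] have
      "L x \<bullet> L x = x \<bullet> (\<Sum>b\<in>B. (L x \<bullet> b) *\<^sub>R b)"
      by (simp add: inner_sum_right mult.commute)
    also have "\<dots> = x \<bullet> L x" using B(3)[OF V] by simp
    finally have "norm (L x) * norm (L x) \<le> norm x * norm (L x)"
      using norm_cauchy_schwarz[of x "L x"] by (simp add: power2_norm_eq_inner flip: power2_eq_square)
    then show ?thesis by (cases "norm (L x) = 0") (simp_all add: mult_le_cancel_right)
  qed
  ultimately show thesis using that B(3) unfolding L_def by blast
qed

text \<open>The nested radii make the cutoffs fit. The outer cutoff \<open>\<eta>\<close> is 1 up to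
  R/4 and 0 from R/2 on; \<open>\<mu>\<close> is 1 up to R/2 and 0 from 3R/4 on, safely inside the
  ball that \<open>W\<close> contains. So the extension \<open>h\<close> agrees with
  \<open>u\<close> wherever \<open>\<eta>\<close> does not vanish, which gives
  \<open>G 0 = u\<close>, and \<open>h\<close> can be continued by 0. The last two conclusions are
  the absence of loss on any open part of \<open>W\<close> and the gain within R/4.\<close>

lemma local_smoothing:
  fixes V :: "'a::euclidean_space set" and P :: "'b::euclidean_space set" and u :: "'a \<Rightarrow> 'b"
  assumes V: "subspace V" and W: "openin (top_of_set V) W" and P: "subspace P"
    and y: "y \<in> V" and R: "R > 0" "cball y R \<inter> V \<subseteq> W"
    and u: "C_nat_on V s W u" and uP: "u ` W \<subseteq> P"
  shows "\<exists>G :: real \<Rightarrow> 'a \<Rightarrow> 'b. (\<forall>x\<in>W. G 0 x = u x) \<and>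
    (\<forall>z. \<forall>x\<in>W. R / 2 \<le> dist x y \<longrightarrow> G z x = u x) \<and>
    (\<forall>z. \<forall>x\<in>W. G z x \<in> P) \<and>
    C_par V s (UNIV \<times> W) G \<and>
    (\<forall>z k W'. z \<noteq> 0 \<longrightarrow> W' \<subseteq> W \<longrightarrow>
      openin (top_of_set V) W' \<longrightarrow> C_nat_on V k W' u \<longrightarrow>
        C_nat_on V k W' (G z)) \<and>
    (\<forall>z k. z \<noteq> 0 \<longrightarrow> C_nat_on V k (W \<inter> ball y (R / 4)) (G z))"
proof -
  obtain L where L: "bounded_linear L" "\<And>x. L x \<in> V"
    "\<And>x. x \<in> V \<Longrightarrow> L x = x" "\<And>x. norm (L x) \<le> norm x"
    using subspace_projection[OF V] by metis
  obtain L' where L': "bounded_linear L'" "\<And>x. L' x \<in> P"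
    "\<And>x. x \<in> P \<Longrightarrow> L' x = x"
    using subspace_projection[OF P] by metis
  have oU: "openin (top_of_set UNIV) (UNIV :: 'a set)" by simp
  \<comment> \<open>Bumps and convolution live on the ambient space, so \<open>u\<close> is first
    extended to the cylinder over \<open>W\<close>, constantly along the kernel of
    \<open>L\<close>.\<close>
  define \<Omega> where "\<Omega> = {x. L x \<in> W}"
  obtain T where T: "open T" "W = V \<inter> T" using W by (auto simp: openin_open)
  have "\<Omega> = L -` T" using T L by (auto simp: \<Omega>_def)
  then have \<Omega>: "open \<Omega>" using T L(1) by (simp add: open_vimage linear_continuous_on)
  \<comment> \<open>As \<open>L\<close> does not increase norms and fixes \<open>y\<close>, the
    ambient ball of radius R about \<open>y\<close> projects into the ball that \<open>W\<close>
    contains by assumption.\<close>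
  have ball: "L x \<in> W" if "dist x y < R" for x
  proof -
    have "dist (L x) y = norm (L (x - y))" using L(3)[OF y] L(1) by (simp add: dist_norm linear_simps)
    also have "\<dots> \<le> dist x y" using L(4) by (simp add: dist_norm)
    finally show ?thesis using R(2) that L(2) by (auto simp: dist_commute)
  qed
  have u1: "C_nat_on UNIV s \<Omega> (\<lambda>x. u (L x))"
    by (rule C_nat_on_compose[OF subspace_UNIV _ V W _ u])
       (use \<Omega> in \<open>auto simp: \<Omega>_def intro!: C_nat_on_linear[OF subspace_UNIV _
         L(1)] C_nat_on_id[OF subspace_UNIV]\<close>)
  \<comment> \<open>a compactly supported extension of \<open>u\<close> to the whole space, equal to
    \<open>u\<close> where \<open>\<eta>\<close> below does not vanish\<close>
  define \<mu> where "\<mu> = bump y (R / 2) (3 * R / 4)"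
  define h where "h x = (if dist x y < R then \<mu> x *\<^sub>R u (L x) else 0)" for x
  have h: "C_nat_on UNIV s UNIV h"
  proof (rule C_nat_on_local[OF subspace_UNIV oU])
    fix x :: 'a
    show "\<exists>N. openin (top_of_set UNIV) N \<and> x \<in> N \<and> C_nat_on UNIV s N h"
    proof (cases "dist x y < R")
      case True
      have o: "openin (top_of_set UNIV) (ball y R)" by simp
      have "ball y R \<subseteq> \<Omega>" using ball by (auto simp: \<Omega>_def dist_commute)
      then have "C_nat_on UNIV s (ball y R) (\<lambda>x. \<mu> x *\<^sub>R u (L x))"
        unfolding \<mu>_def
        by (intro C_nat_on_bilinear[OF subspace_UNIV o bounded_bilinear_scaleR]
            C_nat_on_UNIV_imp[OF subspace_UNIV o bump_smooth] C_nat_on_UNIV_imp[OF subspace_UNIV o u1]) auto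
      then have "C_nat_on UNIV s (ball y R) h"
        by (rule C_nat_on_cong[OF subspace_UNIV o]) (auto simp: h_def dist_commute)
      then show ?thesis using True by (intro exI[of _ "ball y R"]) (simp add: dist_commute)
    next
      case False
      have o: "openin (top_of_set UNIV) (- cball y (3 * R / 4))" by (simp add: open_Compl)
      have "C_nat_on UNIV s (- cball y (3 * R / 4)) h"
        by (rule C_nat_on_cong[OF subspace_UNIV o C_nat_on_const[OF subspace_UNIV o, of _ 0]])
           (use R in \<open>auto simp: h_def \<mu>_def dist_commute bump_outside\<close>)
      then show ?thesis using False R o
        by (intro exI[of _ "- cball y (3 * R / 4)"]) (simp add: dist_commute)
    qed
  qed
  then have hc: "continuous_on UNIV h" by (rule C_nat_on_imp_continuous_on) simp
  obtain c d where cd: "ball y R \<subseteq> cbox c d"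
    using bounded_subset_cbox_symmetric[OF bounded_ball] by metis
  have supp: "h x = 0" if "x \<notin> cbox c d" for x
    using that cd by (auto simp: h_def dist_commute subset_iff)
  define \<eta> where "\<eta> = bump y (R / 4) (R / 2)"
  \<comment> \<open>\<open>L'\<close> puts the average into \<open>P\<close> without an argument
    about integrals of \<open>P\<close>-valued maps. It fixes the values of \<open>u\<close> on
    \<open>W\<close>, so z = 0 still gives \<open>u\<close>.\<close>
  define G where "G z x = u x + \<eta> x *\<^sub>R (L' (mollify h z x) + - u x)" for z x
  note oW = openin_par[OF W]
  have WV: "W \<subseteq> V" using openin_imp_subset[OF W] .
  have \<eta>: "C_nat_on V k W' \<eta>" if "openin (top_of_set V) W'" for k W'
    unfolding \<eta>_def by (rule C_nat_on_UNIV_imp[OF V that bump_smooth]) simp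
  have hu: "h x = u x" if "x \<in> W" "dist x y < R / 2" for x
    using that WV R L(3)[of x] by (auto simp: h_def \<mu>_def bump_inside)
  have \<eta>0: "\<eta> x = 0" if "R / 2 \<le> dist x y" for x
    unfolding \<eta>_def by (rule bump_outside) (use R that in auto)
  show ?thesis
  proof (intro exI[of _ G] conjI ballI allI impI)
    show "G 0 x = u x" if "x \<in> W" for x
    proof (cases "dist x y < R / 2")
      case True
      then show ?thesis using that hu[OF that True] uP L'(3)[of "u x"] by (auto simp: G_def mollify_0)
    qed (simp add: G_def \<eta>0)
    show "G z x = u x" if "x \<in> W" "R / 2 \<le> dist x y" for z x
      using that by (simp add: G_def \<eta>0)
    show "G z x \<in> P" if "x \<in> W" for z x
    proof -
      have "u x \<in> P" using uP that by auto
      then show ?thesis unfolding G_def using L'(2) P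
        by (intro subspace_add[OF P] subspace_scale[OF P] subspace_neg[OF P])
    qed
    have pu: "C_par V s (UNIV \<times> W) (\<lambda>_::real. u)" by (rule iffD1[OF C_nat_iff[OF V W] u])
    have "C_par V s (UNIV \<times> W) (\<lambda>_::real. \<eta>)"
      by (rule iffD1[OF C_nat_iff[OF V W] \<eta>[OF W]])
    moreover have "C_par V s (UNIV \<times> W) (mollify h)"
      by (rule C_par_UNIV_imp[OF C_par_mollify[OF h]]) simp
    ultimately show "C_par V s (UNIV \<times> W) G"
      unfolding G_def[abs_def]
      by (intro C_par_add[OF V oW] pu C_par_bilinear[OF V oW bounded_bilinear_scaleR]
        C_par_linear[OF V oW L'(1)]
          C_par_linear[OF V oW bounded_linear_minus[OF bounded_linear_ident]])
    fix z :: real and k assume z: "z \<noteq> 0"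
    have ms: "C_nat_on V k W' (\<lambda>x. L' (mollify h z x))" if "openin (top_of_set V) W'" for W'
      by (rule C_nat_on_linear[OF V that L'(1) C_nat_on_UNIV_imp[OF V that mollify_smooth[OF hc supp
        z]]]) auto
    show "C_nat_on V k W' (G z)"
      if W': "W' \<subseteq> W" "openin (top_of_set V) W'" "C_nat_on V k W' u" for W'
      unfolding G_def[abs_def]
      by (intro C_nat_on_add[OF V W'(2)] W'(3) C_nat_on_bilinear[OF V W'(2) bounded_bilinear_scaleR]
        \<eta> ms
          C_nat_on_linear[OF V W'(2) bounded_linear_minus[OF bounded_linear_ident]] W'(2))
    have o: "openin (top_of_set V) (W \<inter> ball y (R / 4))"
      using T by (auto simp: openin_open intro!: exI[of _ "T \<inter> ball y (R/4)"])
    show "C_nat_on V k (W \<inter> ball y (R / 4)) (G z)"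
      by (rule C_nat_on_cong[OF V o ms[OF o]]) (use R in \<open>auto simp: G_def \<eta>_def
        bump_inside dist_commute\<close>)
  qed
qed


section \<open>Continuity of the distance between derivatives\<close>

text \<open>\<open>deriv_along\<close> applies the last direction first, and \<open>C_par\<close>
  and \<open>C_nat_on\<close> unfold at this innermost derivative. Inductions on the order therefore
  split lists at the end.\<close>

lemma deriv_along_snoc: "deriv_along (vs @ [v]) f = deriv_along vs (dir_deriv v f)"
  by (induction vs) auto

lemma openin_dir_deriv_cong:
  assumes "subspace V" "openin (top_of_set V) W" "x \<in> W" "v \<in> V"
    "\<And>y. y \<in> W \<Longrightarrow> f y = g y"
  shows "dir_deriv v f x = dir_deriv v g x"
proof -
  obtain T where T: "open T" "W = V \<inter> T" using assms(2) by (auto simp: openin_open)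
  show ?thesis by (rule dir_deriv_cong[of T x V]) (use T assms in auto)
qed

lemma deriv_along_cong:
  assumes "subspace V" "openin (top_of_set V) W" "set vs \<subseteq> V"
    "\<And>y. y \<in> W \<Longrightarrow> f y = g y" "x \<in> W"
  shows "deriv_along vs f x = deriv_along vs g x"
  using assms(3,5)
proof (induction vs arbitrary: x)
  case (Cons v vs)
  then show ?case
    unfolding deriv_along.simps by (intro openin_dir_deriv_cong[OF assms(1,2)]) auto
qed (use assms in auto)

lemma deriv_dist_cong:
  assumes "subspace V" "openin (top_of_set V) W" "\<And>y. y \<in> W \<Longrightarrow> f y = f' y"
    "x \<in> W"
  shows "deriv_dist V k f g x = deriv_dist V k f' g x"
  unfolding deriv_dist_def
  by (intro SUP_cong refl) (use deriv_along_cong[OF assms(1,2) _ assms(3,4)] in auto)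

lemma deriv_along_sum:
  assumes V: "subspace V" and W: "openin (top_of_set V) W"
    and "\<And>b. b \<in> B \<Longrightarrow> C_nat_on V (length vs) W (f b)" "set vs \<subseteq> V"
      "x \<in> W"
  shows "deriv_along vs (\<lambda>y. \<Sum>b\<in>B. c b *\<^sub>R f b y) x = (\<Sum>b\<in>B. c b
    *\<^sub>R deriv_along vs (f b) x)"
  using assms(3-)
proof (induction vs arbitrary: f rule: rev_induct)
  case (snoc v vs)
  have "dir_deriv v (\<lambda>y. \<Sum>b\<in>B. c b *\<^sub>R f b y) y = (\<Sum>b\<in>B. c b
    *\<^sub>R dir_deriv v (f b) y)" if "y \<in> W" for y
  proof -
    have y: "y \<in> V" using that openin_imp_subset[OF W] by auto
    have "\<exists>f'. (f b has_derivative f') (at y within V) \<and> dir_deriv v (f b) y = f' v"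
      if "b \<in> B" for b
    proof -
      have "f b differentiable (at y within V)"
        using snoc.prems(1)[OF that] \<open>y \<in> W\<close> by simp
      then show ?thesis using differentiable_dir_deriv[OF _ V y] snoc.prems(2)
        by (metis list.set_intros(1) Un_iff set_append subsetD)
    qed
    then obtain f'
      where f': "\<And>b. b \<in> B \<Longrightarrow> (f b has_derivative f' b) (at y within V)"
      "\<And>b. b \<in> B \<Longrightarrow> dir_deriv v (f b) y = f' b v" by metis
    have "((\<lambda>y. \<Sum>b\<in>B. c b *\<^sub>R f b y) has_derivative (\<lambda>h.
      \<Sum>b\<in>B. c b *\<^sub>R f' b h)) (at y within V)"
      by (intro has_derivative_sum has_derivative_scaleR_right f')
    from dir_deriv_eq[OF this V y] show ?thesis using f'(2) snoc.prems(2) by simp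
  qed
  then have "deriv_along vs (dir_deriv v (\<lambda>y. \<Sum>b\<in>B. c b *\<^sub>R f b y)) x
      = deriv_along vs (\<lambda>y. \<Sum>b\<in>B. c b *\<^sub>R dir_deriv v (f b) y) x"
    using snoc.prems by (intro deriv_along_cong[OF V W]) auto
  also have "\<dots> = (\<Sum>b\<in>B. c b *\<^sub>R deriv_along vs (dir_deriv v (f b)) x)"
    using snoc.prems by (intro snoc.IH) auto
  finally show ?case by (simp add: deriv_along_snoc)
qed simp

text \<open>Trades the innermost, arbitrary direction for finitely many basis directions. By
  induction on the order, statements about basis directions become statements that are uniform in
  all lists of directions from the unit ball.\<close>

lemma deriv_along_expansion:
  assumes V: "subspace V" and W: "openin (top_of_set V) W"
    and f: "C_nat_on V (Suc (length vs)) W f" and vs: "set vs \<subseteq> V" and x: "x \<in> W"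
    and B: "finite B" "B \<subseteq> V"
      and v: "(\<Sum>b\<in>B. (v \<bullet> b) *\<^sub>R b) = v" "v \<in> V"
  shows "deriv_along (vs @ [v]) f x = (\<Sum>b\<in>B. (v \<bullet> b) *\<^sub>R deriv_along vs
    (dir_deriv b f) x)"
proof -
  have "deriv_along (vs @ [v]) f x = deriv_along vs (dir_deriv v f) x" by (simp add: deriv_along_snoc)
  also have "\<dots> = deriv_along vs (\<lambda>y. \<Sum>b\<in>B. (v \<bullet> b) *\<^sub>R
    dir_deriv b f y) x"
  proof (rule deriv_along_cong[OF V W vs _ x])
    show "dir_deriv v f y = (\<Sum>b\<in>B. (v \<bullet> b) *\<^sub>R dir_deriv b f y)" if "y \<in> W" for y
      using dir_deriv_expansion[OF _ V _ B v] f that openin_imp_subset[OF W] by auto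
  qed
  also have "\<dots> = (\<Sum>b\<in>B. (v \<bullet> b) *\<^sub>R deriv_along vs (dir_deriv b f) x)"
    by (rule deriv_along_sum[OF V W _ vs x]) (use f B in auto)
  finally show ?thesis .
qed

lemma split_last:
  assumes "length vs = Suc k" "set vs \<subseteq> S"
  obtains ws v where "vs = ws @ [v]" "length ws = k" "set ws \<subseteq> S" "v \<in> S"
  using assms by (cases vs rule: rev_cases) auto

text \<open>Finiteness of the operator norm of the k-th derivative. It is what makes the real
  supremum in \<open>deriv_dist\<close> an upper bound of the values it ranges over.\<close>

lemma deriv_along_bounded:
  fixes V :: "'a::euclidean_space set"
  assumes V: "subspace V" and W: "openin (top_of_set V) W" and "C_nat_on V k W f" "x \<in> W"
  shows "\<exists>C. \<forall>vs. length vs = k \<and>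
    set vs \<subseteq> V \<inter> cball 0 1 \<longrightarrow> norm (deriv_along vs f x) \<le> C"
  using assms(3)
proof (induction k arbitrary: f)
  case (Suc k)
  obtain B where B: "finite B" "B \<subseteq> V" "\<And>b. b \<in> B \<Longrightarrow> norm b = 1"
    "\<And>x. x \<in> V \<Longrightarrow> (\<Sum>b\<in>B. (x \<bullet> b) *\<^sub>R b) = x"
    using orthonormal_expansion[OF V] by metis
  have "\<forall>b\<in>B. \<exists>C. \<forall>vs. length vs = k \<and>
    set vs \<subseteq> V \<inter> cball 0 1 \<longrightarrow>
      norm (deriv_along vs (dir_deriv b f) x) \<le> C"
    using Suc B by auto
  then obtain C
    where C: "\<And>b vs. b \<in> B \<Longrightarrow> length vs = k \<Longrightarrow>
      set vs \<subseteq> V \<inter> cball 0 1 \<Longrightarrow>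
        norm (deriv_along vs (dir_deriv b f) x) \<le> C b"
    by metis
  have "norm (deriv_along vs f x) \<le> (\<Sum>b\<in>B. C b)"
    if vs: "length vs = Suc k" "set vs \<subseteq> V \<inter> cball 0 1" for vs
  proof -
    obtain ws v where w: "vs = ws @ [v]" "length ws = k" "set ws \<subseteq> V \<inter> cball 0 1"
      "v \<in> V \<inter> cball 0 1"
      using split_last[OF vs] by metis
    have "deriv_along vs f x = (\<Sum>b\<in>B. (v \<bullet> b) *\<^sub>R deriv_along ws (dir_deriv b f) x)"
      unfolding w(1)
        by (rule deriv_along_expansion[OF V W _ _ assms(4) B(1,2)]) (use w Suc.prems B(4) in auto)
    also have "norm \<dots> \<le> (\<Sum>b\<in>B. C b)"
    proof (rule sum_norm_le)
      fix b assume b: "b \<in> B"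
      have "\<bar>v \<bullet> b\<bar> \<le> 1" using Cauchy_Schwarz_ineq2[of v b] B(3)[OF b] w(4) by simp
      then have "norm ((v \<bullet> b) *\<^sub>R deriv_along ws (dir_deriv b f) x) \<le> norm
        (deriv_along ws (dir_deriv b f) x)"
        by (simp add: mult_left_le_one_le)
      then show "norm ((v \<bullet> b) *\<^sub>R deriv_along ws (dir_deriv b f) x) \<le> C b"
        using C[OF b w(2,3)] by simp
    qed
    finally show ?thesis .
  qed
  then show ?case by blast
qed auto

text \<open>Continuity of the k-th derivative in operator norm. One neighbourhood serves all
  direction lists because it is a finite intersection, over a basis, of the neighbourhoods supplied
  by the induction hypothesis.\<close>

lemma deriv_along_equicontinuous:
  fixes V :: "'a::euclidean_space set" and A :: "('z::topological_space \<times> 'a) set"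
  assumes V: "subspace V" and A: "openin (top_of_set (UNIV \<times> V)) A" and "C_par V k A G"
    and "(z0, x0) \<in> A" "e > 0"
  shows "\<exists>U. open U \<and> (z0, x0) \<in> U \<and>
    (\<forall>z x vs. (z, x) \<in> U \<inter> A \<and> length vs = k \<and>
      set vs \<subseteq> V \<inter> cball 0 1 \<longrightarrow>
    norm (deriv_along vs (G z) x - deriv_along vs (G z0) x0) < e)"
  using assms(3,5)
proof (induction k arbitrary: G e)
  case 0
  then have "continuous_on A (\<lambda>p. G (fst p) (snd p))" by simp
  moreover have "open (ball (G z0 x0) e)" by simp
  ultimately obtain U
    where U: "open U" "U \<inter> A = (\<lambda>p. G (fst p) (snd p)) -` ball (G z0 x0) e \<inter> A"
    by (meson continuous_on_open_invariant)
  have "norm (G z x - G z0 x0) < e" if "(z, x) \<in> U \<inter> A" for z x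
    using that unfolding U(2) by (simp add: dist_norm norm_minus_commute)
  moreover have "(z0, x0) \<in> (\<lambda>p. G (fst p) (snd p)) -` ball (G z0 x0) e \<inter> A"
    using assms(4) 0 by simp
  then have "(z0, x0) \<in> U" unfolding U(2)[symmetric] by simp
  ultimately show ?case using U(1) by (intro exI[of _ U]) auto
next
  case (Suc k)
  obtain B where B: "finite B" "B \<subseteq> V" "\<And>b. b \<in> B \<Longrightarrow> norm b = 1"
    "\<And>x. x \<in> V \<Longrightarrow> (\<Sum>b\<in>B. (x \<bullet> b) *\<^sub>R b) = x"
    using orthonormal_expansion[OF V] by metis
  \<comment> \<open>The added 1 keeps the sum of \<open>card B\<close> copies of \<open>e'\<close>
    strictly below \<open>e\<close>, also when \<open>B\<close> is empty.\<close>
  define e' where "e' = e / (real (card B) + 1)"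
  have e': "e' > 0" using Suc.prems by (simp add: e'_def)
  let ?N = "\<lambda>b U. open U \<and> (z0, x0) \<in> U \<and>
    (\<forall>z x vs. (z, x) \<in> U \<inter> A \<and> length vs = k \<and>
      set vs \<subseteq> V \<inter> cball 0 1 \<longrightarrow>
      norm (deriv_along vs (dir_deriv b (G z)) x - deriv_along vs (dir_deriv b (G z0)) x0) < e')"
  have "\<forall>b\<in>B. \<exists>U. ?N b U"
  proof
    fix b assume "b \<in> B"
    then have "C_par V k A (\<lambda>z. dir_deriv b (G z))" using Suc.prems(1) B(2) by auto
    from Suc.IH[OF this e'] show "\<exists>U. ?N b U" .
  qed
  from bchoice[OF this] obtain U where U: "\<forall>b\<in>B. ?N b (U b)" ..
  obtain T where T: "open T" "A = (UNIV \<times> V) \<inter> T" using A by (auto simp: openin_open)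
  have exp: "deriv_along (ws @ [v]) (G z) x = (\<Sum>b\<in>B. (v \<bullet> b) *\<^sub>R deriv_along
    ws (dir_deriv b (G z)) x)"
    if "(z, x) \<in> A" "length ws = k" "set ws \<subseteq> V" "v \<in> V" for z x ws v
  proof (rule deriv_along_expansion[OF V _ _ that(3) _ B(1,2) _ that(4)])
    have "open (Pair z -` T)" by (intro open_vimage T continuous_intros)
    then show "openin (top_of_set V) (V \<inter> (Pair z -` T))" by (auto simp: openin_open)
    show "C_nat_on V (Suc (length ws)) (V \<inter> (Pair z -` T)) (G z)"
      unfolding that(2) by (rule C_par_imp_C_nat_on[OF Suc.prems(1)]) (use T in auto)
    show "x \<in> V \<inter> (Pair z -` T)" using that(1) T by auto
  qed (use B(4) that in auto)
  have "norm (deriv_along vs (G z) x - deriv_along vs (G z0) x0) < e"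
    if p: "(z, x) \<in> (\<Inter>b\<in>B. U b) \<inter> A"
      and vs: "length vs = Suc k" "set vs \<subseteq> V \<inter> cball 0 1" for z x vs
  proof -
    obtain ws v where w: "vs = ws @ [v]" "length ws = k" "set ws \<subseteq> V \<inter> cball 0 1"
      "v \<in> V \<inter> cball 0 1"
      using split_last[OF vs] by metis
    have "deriv_along vs (G z) x - deriv_along vs (G z0) x0 = 
      (\<Sum>b\<in>B. (v \<bullet> b) *\<^sub>R (deriv_along ws (dir_deriv b (G z)) x - deriv_along
        ws (dir_deriv b (G z0)) x0))"
      unfolding w(1) using exp[of z x ws v] exp[of z0 x0 ws v] p assms(4) w
      by (simp add: scaleR_diff_right sum_subtractf)
    also have "norm \<dots> \<le> (\<Sum>b\<in>B. e')"
    proof (rule sum_norm_le)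
      fix b assume b: "b \<in> B"
      have 1: "\<bar>v \<bullet> b\<bar> \<le> 1" using Cauchy_Schwarz_ineq2[of v b] B(3)[OF b] w(4) by simp
      have 2: "norm (deriv_along ws (dir_deriv b (G z)) x - deriv_along ws (dir_deriv b (G z0)) x0) < e'"
        using U b p w by blast
      show "norm ((v \<bullet> b) *\<^sub>R (deriv_along ws (dir_deriv b (G z)) x - deriv_along ws
        (dir_deriv b (G z0)) x0)) \<le> e'"
        using mult_left_le_one_le[OF norm_ge_zero abs_ge_zero 1, of
          "deriv_along ws (dir_deriv b (G z)) x - deriv_along ws (dir_deriv b (G z0)) x0"] 2
        by simp
    qed
    also have "\<dots> < e" using Suc.prems(2) by (simp add: e'_def field_simps)
    finally show ?thesis .
  qed
  moreover have "open (\<Inter>b\<in>B. U b)" using U B(1) by (intro open_INT) auto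
  moreover have "(z0, x0) \<in> (\<Inter>b\<in>B. U b)" using U by auto
  ultimately show ?case by (intro exI[of _ "\<Inter>b\<in>B. U b"]) blast
qed

text \<open>A strict bound on the operator norm is an open condition once the derivatives vary
  continuously. Openness in the pair (z, x), rather than in z for fixed x, is what allows
  compactness in x to be used later.\<close>

lemma deriv_dist_less_open:
  fixes V :: "'a::euclidean_space set" and A :: "('z::topological_space \<times> 'a) set"
  assumes V: "subspace V" and A: "openin (top_of_set (UNIV \<times> V)) A"
    and G: "C_par V k A G" and H: "C_par V k A H"
    and p0: "(z0, x0) \<in> A" and less: "deriv_dist V k (G z0) (H z0) x0 < \<epsilon>"
  shows "\<exists>U. open U \<and> (z0, x0) \<in> U \<and>
    (\<forall>z x. (z, x) \<in> U \<inter> A \<longrightarrow> deriv_dist V k (G z) (H z) x < \<epsilon>)"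
proof -
  let ?L = "{vs. length vs = k \<and> set vs \<subseteq> V \<inter> cball 0 1}"
  \<comment> \<open>The gap to \<open>\<epsilon>\<close>. Errors below d/4 for \<open>G\<close> and
    for \<open>H\<close> consume only half of it, so the inequality remains strict after passing to
    the supremum.\<close>
  define d where "d = \<epsilon> - deriv_dist V k (G z0) (H z0) x0"
  have d: "d > 0" using less by (simp add: d_def)
  obtain U1 where U1: "open U1" "(z0, x0) \<in> U1"
    "\<And>z x vs. (z, x) \<in> U1 \<inter> A \<Longrightarrow> vs \<in> ?L \<Longrightarrow>
    norm (deriv_along vs (G z) x - deriv_along vs (G z0) x0) < d / 4"
    using deriv_along_equicontinuous[OF V A G p0, of "d / 4"] d by auto
  obtain U2 where U2: "open U2" "(z0, x0) \<in> U2"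
    "\<And>z x vs. (z, x) \<in> U2 \<inter> A \<Longrightarrow> vs \<in> ?L \<Longrightarrow>
    norm (deriv_along vs (H z) x - deriv_along vs (H z0) x0) < d / 4"
    using deriv_along_equicontinuous[OF V A H p0, of "d / 4"] d by auto
  obtain T where T: "open T" "A = (UNIV \<times> V) \<inter> T" using A by (auto simp: openin_open)
  have "open (Pair z0 -` T)" by (intro open_vimage T continuous_intros)
  then have W: "openin (top_of_set V) (V \<inter> (Pair z0 -` T))" by (auto simp: openin_open)
  have x0: "x0 \<in> V \<inter> (Pair z0 -` T)" using p0 T by auto
  have "C_nat_on V k (V \<inter> (Pair z0 -` T)) (G z0)" "C_nat_on V k (V \<inter> (Pair z0 -` T)) (H z0)"
    by (rule C_par_imp_C_nat_on[OF G] C_par_imp_C_nat_on[OF H]; use T in auto)+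
  from deriv_along_bounded[OF V W this(1) x0] deriv_along_bounded[OF V W this(2) x0]
  obtain C1 C2 where C: "\<And>vs. vs \<in> ?L \<Longrightarrow> norm (deriv_along vs (G z0) x0) \<le> C1"
    "\<And>vs. vs \<in> ?L \<Longrightarrow> norm (deriv_along vs (H z0) x0) \<le> C2" by auto
  have bdd: "bdd_above ((\<lambda>vs. norm (deriv_along vs (G z0) x0 - deriv_along vs (H z0) x0)) ` ?L)"
  proof (rule bdd_aboveI2)
    fix vs assume vs: "vs \<in> ?L"
    show "norm (deriv_along vs (G z0) x0 - deriv_along vs (H z0) x0) \<le> C1 + C2"
      using norm_triangle_ineq4[of "deriv_along vs (G z0) x0" "deriv_along vs (H z0) x0"] C[OF vs]
        by linarith
  qed
  have ne: "?L \<noteq> {}"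
  proof -
    have "replicate k 0 \<in> ?L" using subspace_0[OF V] by (auto simp: set_replicate_conv_if)
    then show ?thesis by blast
  qed
  have "deriv_dist V k (G z) (H z) x < \<epsilon>" if p: "(z, x) \<in> (U1 \<inter> U2) \<inter> A" for z x
  proof -
    have "deriv_dist V k (G z) (H z) x \<le> deriv_dist V k (G z0) (H z0) x0 + d / 2"
      unfolding deriv_dist_def[of V k "G z" "H z" x]
    proof (rule cSUP_least[OF ne])
      fix vs assume vs: "vs \<in> ?L"
      have "norm (deriv_along vs (G z0) x0 - deriv_along vs (H z0) x0) \<le> deriv_dist V k (G z0)
        (H z0) x0"
        unfolding deriv_dist_def by (rule cSUP_upper[OF vs bdd])
      moreover have "deriv_along vs (G z) x - deriv_along vs (H z) x =
        (deriv_along vs (G z0) x0 - deriv_along vs (H z0) x0) + ((deriv_along vs (G z) x -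
          deriv_along vs (G z0) x0)
          - (deriv_along vs (H z) x - deriv_along vs (H z0) x0))" by simp
      ultimately show
        "norm (deriv_along vs (G z) x - deriv_along vs (H z) x) \<le> deriv_dist V k (G z0) (H z0)
          x0 + d / 2"
        using U1(3)[OF _ vs, of z x] U2(3)[OF _ vs, of z x] p
          norm_triangle_ineq[of "deriv_along vs (G z0) x0 - deriv_along vs (H z0) x0"
            "(deriv_along vs (G z) x - deriv_along vs (G z0) x0)
          - (deriv_along vs (H z) x - deriv_along vs (H z0) x0)"]
          norm_triangle_ineq4[of "deriv_along vs (G z) x - deriv_along vs (G z0) x0"
            "deriv_along vs (H z) x - deriv_along vs (H z0) x0"]
        by simp
    qed
    also have "\<dots> < deriv_dist V k (G z0) (H z0) x0 + d" using d by simp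
    also have "\<dots> = \<epsilon>" by (simp add: d_def)
    finally show ?thesis .
  qed
  then show ?thesis using U1 U2 by (intro exI[of _ "U1 \<inter> U2"]) auto
qed


section \<open>Charts\<close>

lemma openin_Int_subset:
  "openin (top_of_set V) N \<Longrightarrow> W \<subseteq> V \<Longrightarrow>
    openin (top_of_set W) (N \<inter> W)"
  by (auto simp: openin_open)

locale foliated =
  fixes F :: "('m::{t2_space, second_countable_topology}, 'q::euclidean_space, 'p::euclidean_space) fol"
    and r :: enat and p q :: nat
  assumes foliation: "foliation r p q F"
begin

lemma subspace_transv: "subspace (transv F)"
  and subspace_tang: "subspace (tang F)"
  and charts_foliated: "\<forall>c\<in>charts F. foliated_chart (transv F) (tang F) c"
  and charts_Union: "(\<Union>c\<in>charts F. fst c) = UNIV"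
  and charts_compatible: "\<forall>c\<in>charts F. \<forall>d\<in>charts F. compatible (model F) r c d"
  and charts_maximal: "\<forall>c. foliated_chart (transv F) (tang F) c \<and>
         (\<forall>d\<in>charts F. compatible (model F) r c d \<and>
           compatible (model F) r d c) \<longrightarrow> c \<in> charts F"
proof -
  note f = foliation[unfolded foliation_def]
  show "subspace (transv F)" using f by (elim conjE)
  show "subspace (tang F)" using f by (elim conjE)
  show "\<forall>c\<in>charts F. foliated_chart (transv F) (tang F) c" using f by (elim conjE)
  show "(\<Union>c\<in>charts F. fst c) = UNIV" using f by (elim conjE)
  show "\<forall>c\<in>charts F. \<forall>d\<in>charts F. compatible (model F) r c d" using f
    by (elim conjE)
  show "\<forall>c. foliated_chart (transv F) (tang F) c \<and>
         (\<forall>d\<in>charts F. compatible (model F) r c d \<and>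
           compatible (model F) r d c) \<longrightarrow> c \<in> charts F"
    using f by (elim conjE)
qed

lemma subspace_model: "subspace (model F)"
  unfolding model_def by (rule subspace_Times[OF subspace_transv subspace_tang])

lemma charts_cover: "\<exists>c\<in>charts F. x \<in> fst c"
  using charts_Union by blast

text \<open>Replaces the inverse hidden in \<open>foliated_chart\<close> by \<open>inv_into\<close>,
  the one that occurs in \<open>local_expr\<close>.\<close>

lemma chart_homeomorphism:
  assumes "c \<in> charts F"
  obtains T B where "openin (top_of_set (transv F)) T" "openin (top_of_set (tang F)) B" "convex B"
    "homeomorphism (fst c) (T \<times> B) (snd c) (inv_into (fst c) (snd c))"
proof -
  have "foliated_chart (transv F) (tang F) c" using assms charts_foliated by blast
  then obtain T B g where TB: "openin (top_of_set (transv F)) T" "openin (top_of_set (tang F)) B" "convex B"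
    and h: "homeomorphism (fst c) (T \<times> B) (snd c) g" unfolding foliated_chart_def by blast
  have "inj_on (snd c) (fst c)" using homeomorphism_apply1[OF h] by (intro inj_on_inverseI)
  then have "g y = inv_into (fst c) (snd c) y" if "y \<in> T \<times> B" for y
    using h that by (metis homeomorphism_apply2 homeomorphism_image2 imageI inv_into_f_f)
  then have "homeomorphism (fst c) (T \<times> B) (snd c) (inv_into (fst c) (snd c))"
    by (intro homeomorphism_cong[OF h refl refl refl]) simp
  with TB that show thesis by blast
qed

lemma open_chart_domain: "c \<in> charts F \<Longrightarrow> open (fst c)"
  using charts_foliated unfolding foliated_chart_def by blast

lemma chart_inj: assumes "c \<in> charts F" shows "inj_on (snd c) (fst c)"
proof -
  obtain T B where h: "homeomorphism (fst c) (T \<times> B) (snd c) (inv_into (fst c) (snd c))"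
    using chart_homeomorphism[OF assms] by metis
  show ?thesis using homeomorphism_apply1[OF h] by (intro inj_on_inverseI)
qed

lemma chart_inverse:
  "c \<in> charts F \<Longrightarrow> x \<in> fst c \<Longrightarrow>
    inv_into (fst c) (snd c) (snd c x) = x"
  using chart_inj by (simp add: inv_into_f_f)

lemma local_expr_chart:
  "c \<in> charts F \<Longrightarrow> x \<in> fst c \<Longrightarrow>
    local_expr c c' \<phi> (snd c x) = snd c' (\<phi> x)"
  by (simp add: local_expr_def chart_inverse)

lemma chart_continuous:
  assumes "c \<in> charts F"
  shows "continuous_on (fst c) (snd c)" "continuous_on (snd c ` fst c) (inv_into (fst c) (snd c))"
proof -
  obtain T B where h: "homeomorphism (fst c) (T \<times> B) (snd c) (inv_into (fst c) (snd c))"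
    using chart_homeomorphism[OF assms] by metis
  then show "continuous_on (fst c) (snd c)" "continuous_on (snd c ` fst c) (inv_into (fst c) (snd c))"
    by (simp_all add: homeomorphism_cont1 homeomorphism_cont2 homeomorphism_image1[OF h])
qed

lemma chart_image_openin:
  assumes "c \<in> charts F" "open U" "U \<subseteq> fst c"
  shows "openin (top_of_set (model F)) (snd c ` U)"
proof -
  obtain T B where TB: "openin (top_of_set (transv F)) T" "openin (top_of_set (tang F)) B"
    and h: "homeomorphism (fst c) (T \<times> B) (snd c) (inv_into (fst c) (snd c))"
    using chart_homeomorphism[OF assms(1)] by metis
  have "openin (top_of_set (fst c)) U" using assms by (auto simp: openin_open)
  then have "openin (top_of_set (T \<times> B)) (snd c ` U)" by (rule homeomorphism_imp_open_map[OF h])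
  moreover have "openin (top_of_set (model F)) (T \<times> B)" unfolding model_def
    by (rule openin_Times[OF TB])
  ultimately show ?thesis by (rule openin_trans)
qed

lemma chart_image_subset:
  "c \<in> charts F \<Longrightarrow> x \<in> fst c \<Longrightarrow> snd c x \<in> model F"
  using openin_imp_subset[OF chart_image_openin[OF _ open_chart_domain subset_refl], of c] by blast

lemma chart_image_sub:
  "c \<in> charts F \<Longrightarrow> S \<subseteq> fst c \<Longrightarrow> snd c ` S \<subseteq> model F"
  using chart_image_subset by blast

lemma chart_preimage_open:
  assumes "c \<in> charts F" "openin (top_of_set (model F)) S"
  shows "open {x \<in> fst c. snd c x \<in> S}"
proof -
  obtain T where T: "open T" "S = model F \<inter> T" using assms(2) by (auto simp: openin_open)
  have "open (fst c \<inter> snd c -` T)"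
    using chart_continuous(1) open_chart_domain assms(1) T(1) continuous_open_preimage by blast
  moreover have "{x \<in> fst c. snd c x \<in> S} = fst c \<inter> snd c -` T"
    using T chart_image_subset[OF assms(1)] by auto
  ultimately show ?thesis by simp
qed

lemma chart_compatible:
  "c \<in> charts F \<Longrightarrow> d \<in> charts F \<Longrightarrow> compatible (model F) r c d"
  using charts_compatible by blast

lemma transition_smooth:
  assumes "c \<in> charts F" "d \<in> charts F" "enat k \<le> r"
  shows "C_nat_on (model F) k (snd c ` (fst c \<inter> fst d)) (local_expr c d id)"
  using chart_compatible[OF assms(1,2)] assms(3) by (simp add: compatible_def C_on_def Let_def)

lemma transition_plaques:
  assumes "c \<in> charts F" "d \<in> charts F" "x \<in> fst c" "x \<in> fst d"
  shows "\<exists>N. openin (top_of_set (model F)) N \<and> snd c x \<in> N \<and>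
    N \<subseteq> snd c ` (fst c \<inter> fst d) \<and>
    (\<forall>a\<in>N. \<forall>b\<in>N. fst a = fst b \<longrightarrow>
      fst (local_expr c d id a) = fst (local_expr c d id b))"
proof -
  let ?W = "snd c ` (fst c \<inter> fst d)"
  obtain N where N: "openin (top_of_set ?W) N" "snd c x \<in> N"
    "\<forall>a\<in>N. \<forall>b\<in>N. fst a = fst b \<longrightarrow>
      fst (local_expr c d id a) = fst (local_expr c d id b)"
    using chart_compatible[OF assms(1,2)] assms(3,4) unfolding compatible_def Let_def by blast
  have "openin (top_of_set (model F)) ?W"
    by (rule chart_image_openin) (use assms in \<open>simp_all add: open_Int open_chart_domain\<close>)
  from openin_trans[OF N(1) this] N(2,3) openin_imp_subset[OF N(1)] show ?thesis by blast
qed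

text \<open>Small restrictions of a chart are charts again by maximality of the atlas. The image
  must remain an open set times a convex open set, so a product neighbourhood is cut out of the
  model. This places a source chart inside the preimage of a target chart, the only situation of
  which the definition of \<open>C2_fol\<close> speaks.\<close>

lemma chart_shrink:
  assumes "c \<in> charts F" "x \<in> fst c" "open U" "x \<in> U"
  obtains U' where "(U', snd c) \<in> charts F" "x \<in> U'" "U' \<subseteq> fst c \<inter> U"
proof -
  have "openin (top_of_set (model F)) (snd c ` (fst c \<inter> U))"
    by (rule chart_image_openin) (use assms in \<open>simp_all add: open_Int open_chart_domain\<close>)
  then obtain S where S: "open S" "snd c ` (fst c \<inter> U) = model F \<inter> S"
    by (auto simp: openin_open)
  obtain a b where ab: "snd c x = (a, b)" by fastforce
  have "snd c x \<in> model F \<inter> S" unfolding S(2)[symmetric] using assms by blast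
  then have "(a, b) \<in> S" by (simp add: ab)
  then obtain A B where AB: "open A" "open B" "(a, b) \<in> A \<times> B" "A \<times> B \<subseteq> S"
    using S(1) by (metis open_prod_elim)
  \<comment> \<open>Only the plaque factor has to be convex, so \<open>B\<close> is replaced by a
    ball and \<open>A\<close> is kept.\<close>
  obtain e where e: "e > 0" "ball b e \<subseteq> B" using AB open_contains_ball by (metis mem_Sigma_iff)
  define T1 where "T1 = transv F \<inter> A"
  define B1 where "B1 = tang F \<inter> ball b e"
  define U' where "U' = {y \<in> fst c. snd c y \<in> T1 \<times> B1}"
  have o1: "openin (top_of_set (transv F)) T1" "openin (top_of_set (tang F)) B1"
    using AB unfolding T1_def B1_def by (auto simp: openin_open)
  have sub: "T1 \<times> B1 \<subseteq> snd c ` (fst c \<inter> U)"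
    unfolding S(2) using AB(4) e by (auto simp: T1_def B1_def model_def)
  have oU': "open U'" unfolding U'_def
    by (rule chart_preimage_open[OF assms(1)]) (auto simp: model_def intro: openin_Times o1)
  have U'U: "U' \<subseteq> fst c \<inter> U"
  proof
    fix y assume y: "y \<in> U'"
    then have yc: "y \<in> fst c" and "snd c y \<in> T1 \<times> B1" by (simp_all add: U'_def)
    from subsetD[OF sub this(2)] obtain w where w: "snd c y = snd c w" "w \<in> fst c \<inter> U"
      by (rule imageE)
    then show "y \<in> fst c \<inter> U" using inj_onD[OF chart_inj[OF assms(1)] w(1) yc] by simp
  qed
  have img: "snd c ` U' = T1 \<times> B1"
  proof
    show "snd c ` U' \<subseteq> T1 \<times> B1" by (rule image_subsetI) (simp add: U'_def)
    show "T1 \<times> B1 \<subseteq> snd c ` U'"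
    proof
      fix y assume y: "y \<in> T1 \<times> B1"
      from subsetD[OF sub this] obtain w where w: "y = snd c w" "w \<in> fst c \<inter> U" by (rule imageE)
      then show "y \<in> snd c ` U'" using y by (auto simp: U'_def simp del: mem_Sigma_iff)
    qed
  qed
  \<comment> \<open>\<open>inv_into\<close> depends on the chosen domain, so the restricted chart a
    priori has different local expressions; by injectivity they agree on the smaller image.\<close>
  have inv: "inv_into U' (snd c) y = inv_into (fst c) (snd c) y" if y: "y \<in> snd c ` U'" for y
  proof -
    obtain w where w: "w \<in> U'" "y = snd c w" using y by blast
    have "inj_on (snd c) U'" by (rule inj_on_subset[OF chart_inj[OF assms(1)]]) (use U'U in blast)
    moreover have "w \<in> fst c" using w(1) U'U by blast
    ultimately show ?thesis using w by (simp add: inv_into_f_f chart_inverse[OF assms(1)])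
  qed
  have "convex B1" unfolding B1_def by (intro convex_Int subspace_imp_convex[OF subspace_tang] convex_ball)
  moreover have "homeomorphism U' (T1 \<times> B1) (snd c) (inv_into U' (snd c))"
  proof -
    obtain T B where h: "homeomorphism (fst c) (T \<times> B) (snd c) (inv_into (fst c) (snd c))"
      using chart_homeomorphism[OF assms(1)] by metis
    have "homeomorphism U' (T1 \<times> B1) (snd c) (inv_into (fst c) (snd c))"
      by (rule homeomorphism_of_subsets[OF h _ subset_refl img]) (use U'U in blast)
    then show ?thesis by (rule homeomorphism_cong) (use img inv in auto)
  qed
  ultimately have fc: "foliated_chart (transv F) (tang F) (U', snd c)"
    unfolding foliated_chart_def fst_conv snd_conv using oU' o1 by blast
  have comp: "compatible (model F) r (U', snd c) d \<and> compatible (model F) r d (U', snd c)"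
    if d: "d \<in> charts F" for d
  proof
    have o: "openin (top_of_set (model F)) (snd c ` (U' \<inter> fst d))"
      by (rule chart_image_openin) (use assms(1) d oU' U'U in \<open>simp_all add: open_Int
        open_chart_domain le_infI1\<close>)
    have eq: "local_expr (U', snd c) d id y = local_expr c d id y"
      if "y \<in> snd c ` (U' \<inter> fst d)" for y
    proof -
      have "y \<in> snd c ` U'" using that by blast
      then show ?thesis by (simp add: local_expr_def inv)
    qed
    have le: "C_nat_on (model F) k (snd c ` (U' \<inter> fst d)) (local_expr (U', snd c) d id)"
      if "enat k \<le> r" for k
    proof (rule C_nat_on_cong[OF subspace_model o])
      show "C_nat_on (model F) k (snd c ` (U' \<inter> fst d)) (local_expr c d id)"
        by (rule C_nat_on_mono[OF transition_smooth[OF assms(1) d that] chart_image_sub[OF assms(1)]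
          image_mono order_refl])
           (use U'U in blast)+
    qed (use eq in auto)
    have "\<exists>N. openin (top_of_set (snd c ` (U' \<inter> fst d))) N \<and> z \<in> N \<and>
         (\<forall>a\<in>N. \<forall>b\<in>N. fst a = fst b \<longrightarrow>
           fst (local_expr (U', snd c) d id a) = fst (local_expr (U', snd c) d id b))"
      if z: "z \<in> snd c ` (U' \<inter> fst d)" for z
    proof -
      obtain w where w: "w \<in> U'" "w \<in> fst d" "z = snd c w" using z by blast
      obtain N where N: "openin (top_of_set (model F)) N" "snd c w \<in> N"
        "\<And>a b. a \<in> N \<Longrightarrow> b \<in> N \<Longrightarrow>
          fst a = fst b \<Longrightarrow> fst (local_expr c d id a) = fst (local_expr c d id b)"
        using transition_plaques[OF assms(1) d, of w] w subsetD[OF U'U w(1)] by auto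
      have "openin (top_of_set (snd c ` (U' \<inter> fst d))) (N \<inter> snd c ` (U' \<inter> fst d))"
        by (rule openin_Int_subset[OF N(1) openin_imp_subset[OF o]])
      then show ?thesis using N(2,3) w(3) eq z
        by (intro exI[of _ "N \<inter> snd c ` (U' \<inter> fst d)"]) auto
    qed
    then show "compatible (model F) r (U', snd c) d"
      using le unfolding compatible_def Let_def C_on_def by simp
    have oW: "openin (top_of_set (model F)) (snd d ` (fst d \<inter> U'))"
      by (rule chart_image_openin) (use d oU' in \<open>simp_all add: open_Int open_chart_domain\<close>)
    have eq': "local_expr d (U', snd c) id = local_expr d c id" by (simp add: local_expr_def)
    have le': "C_nat_on (model F) k (snd d ` (fst d \<inter> U')) (local_expr d c id)"
      if "enat k \<le> r" for k
      by (rule C_nat_on_mono[OF transition_smooth[OF d assms(1) that] chart_image_sub[OF d]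
        image_mono order_refl])
         (use U'U in blast)+
    have "\<exists>N. openin (top_of_set (snd d ` (fst d \<inter> U'))) N \<and> z \<in> N \<and>
         (\<forall>a\<in>N. \<forall>b\<in>N. fst a = fst b \<longrightarrow>
           fst (local_expr d c id a) = fst (local_expr d c id b))"
      if z: "z \<in> snd d ` (fst d \<inter> U')" for z
    proof -
      obtain w where w: "w \<in> U'" "w \<in> fst d" "z = snd d w" using z by blast
      obtain N where N: "openin (top_of_set (model F)) N" "snd d w \<in> N"
        "\<And>a b. a \<in> N \<Longrightarrow> b \<in> N \<Longrightarrow>
          fst a = fst b \<Longrightarrow> fst (local_expr d c id a) = fst (local_expr d c id b)"
        using transition_plaques[OF d assms(1), of w] w subsetD[OF U'U w(1)] by auto
      have "openin (top_of_set (snd d ` (fst d \<inter> U'))) (N \<inter> snd d ` (fst d \<inter> U'))"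
        by (rule openin_Int_subset[OF N(1) openin_imp_subset[OF oW]])
      then show ?thesis using N(2,3) w(3) z
        by (intro exI[of _ "N \<inter> snd d ` (fst d \<inter> U')"]) auto
    qed
    then show "compatible (model F) r d (U', snd c)"
      using le' unfolding compatible_def Let_def C_on_def by (simp add: eq')
  qed
  have "(U', snd c) \<in> charts F" using charts_maximal fc comp by blast
  moreover have "x \<in> U'"
    using assms(2) AB(3) e(1) chart_image_subset[OF assms(1,2)]
      by (simp add: U'_def T1_def B1_def model_def ab)
  ultimately show thesis by (rule that) (rule U'U)
qed

end

text \<open>These notions are germs at a point. The suffix \<open>_in\<close> fixes a pair of charts
  and \<open>_at\<close> asks for some pair; \<open>fam_in_change\<close> and
  \<open>trans_in_change\<close> make the choice immaterial for orders up to r (for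
  \<open>trans_in\<close>, of a continuous map). The projection clause of \<open>fam_in\<close>
  compares with \<open>\<Phi> z0 x\<close> at the same point \<open>x\<close>: a family may move
  each value only within its plaque.\<close>

definition fam_in where
  "fam_in F F' c c' k \<Phi> z0 x0 \<longleftrightarrow> (\<exists>Z N. open Z \<and> open N \<and>
    z0 \<in> Z \<and> x0 \<in> N \<and> N \<subseteq> fst c \<and>
     (\<forall>z\<in>Z. \<forall>x\<in>N. \<Phi> z x \<in> fst c' \<and>
       local_proj c' (\<Phi> z x) = local_proj c' (\<Phi> z0 x)) \<and>
     C_par (model F) k (Z \<times> snd c ` N) (\<lambda>z. local_expr c c' (\<Phi> z)))"

definition fam_at where
  "fam_at F F' k \<Phi> z0 x0 \<longleftrightarrow>
    (\<exists>c\<in>charts F. \<exists>c'\<in>charts F'. fam_in F F' c c' k \<Phi> z0 x0)"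

definition C_in where
  "C_in F F' c c' k \<phi> x \<longleftrightarrow> (\<exists>N. open N \<and> x \<in> N \<and>
    N \<subseteq> fst c \<and> \<phi> ` N \<subseteq> fst c' \<and>
     C_nat_on (model F) k (snd c ` N) (local_expr c c' \<phi>))"

definition C_at where
  "C_at F F' k \<phi> x \<longleftrightarrow>
    (\<exists>c\<in>charts F. \<exists>c'\<in>charts F'. C_in F F' c c' k \<phi> x)"

definition trans_in where
  "trans_in F F' c c' k \<phi> x \<longleftrightarrow> (\<exists>N. open N \<and> x \<in> N \<and>
    N \<subseteq> fst c \<and> \<phi> ` N \<subseteq> fst c' \<and>
     C_nat_on (model F) k (snd c ` N) (local_proj c' \<circ> \<phi> \<circ> inv_into (fst c) (snd c)))"

definition trans_at where
  "trans_at F F' k \<phi> x \<longleftrightarrow>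
    (\<exists>c\<in>charts F. \<exists>c'\<in>charts F'. trans_in F F' c c' k \<phi> x)"


section \<open>Differentiability in charts\<close>

context foliated begin

lemma chart_overlap:
  assumes "c \<in> charts F" "w \<in> fst c" "snd c w \<in> snd c ` (fst c \<inter> U)"
  shows "w \<in> U"
proof -
  obtain v where v: "snd c w = snd c v" "v \<in> fst c \<inter> U" using assms(3) by (rule imageE)
  then show ?thesis using inj_onD[OF chart_inj[OF assms(1)] v(1) assms(2)] by simp
qed

lemma transition_chart:
  "c \<in> charts F \<Longrightarrow> w \<in> fst c \<Longrightarrow> local_expr c d id (snd c w) = snd d w"
  by (simp add: local_expr_chart)

lemma transition_smooth_sub:
  assumes "c \<in> charts F" "d \<in> charts F" "enat k \<le> r" "N \<subseteq> fst c" "N \<subseteq> fst d"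
  shows "C_nat_on (model F) k (snd c ` N) (local_expr c d id)"
  by (rule C_nat_on_mono[OF transition_smooth[OF assms(1-3)] chart_image_sub[OF assms(1)] image_mono
    order_refl])
     (use assms in blast)+

end

locale foliated_pair = dom: foliated F r p q + cod: foliated F' r p' q'
  for F :: "('m::{t2_space, second_countable_topology}, 'q::euclidean_space, 'p::euclidean_space) fol"
    and F' :: "('n::{t2_space, second_countable_topology}, 'u::euclidean_space, 'v::euclidean_space) fol"
    and r :: enat and p q p' q' :: nat
begin

lemma fam_continuous:
  assumes "c \<in> charts F" "N \<subseteq> fst c"
    and "C_par (model F) k (Z \<times> snd c ` N) (\<lambda>z. local_expr c c' (\<Phi> z))"
  shows "continuous_on (Z \<times> N) (\<lambda>p. snd c' (\<Phi> (fst p) (snd p)))"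
proof -
  have 1: "continuous_on (Z \<times> snd c ` N) (\<lambda>p. local_expr c c' (\<Phi> (fst p)) (snd p))"
    using C_par_cont[OF assms(3)] .
  have 2: "continuous_on (Z \<times> N) (\<lambda>p. (fst p, snd c (snd p)))"
    by (intro continuous_intros continuous_on_compose2[OF continuous_on_subset[OF
      dom.chart_continuous(1)[OF assms(1)] assms(2)]]) auto
  have "continuous_on (Z \<times> N) (\<lambda>p. local_expr c c' (\<Phi> (fst p)) (snd c (snd p)))"
    using continuous_on_compose2[OF 1 2] by fastforce
  moreover have "local_expr c c' (\<Phi> (fst p)) (snd c (snd p)) = snd c' (\<Phi> (fst p) (snd p))"
    if "p \<in> Z \<times> N" for p
    using that assms by (intro dom.local_expr_chart) auto
  ultimately show ?thesis by (simp cong: continuous_on_cong)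
qed

text \<open>In new charts the family is composed with a change of charts on either side, so
  \<open>C_par_compose\<close> applies. The projection clause survives because the change of target
  charts respects first coordinates on a small set \<open>N'\<close>; \<open>compatible\<close> does
  not assert this on the whole overlap, so the neighbourhoods have to shrink.\<close>

lemma fam_in_change:
  assumes c: "c \<in> charts F" "c' \<in> charts F'" and d: "d \<in> charts F" "d' \<in> charts F'"
    and k: "enat k \<le> r"
    and fam: "fam_in F F' c c' k \<Phi> z0 x0" and x0: "x0 \<in> fst d" "\<Phi> z0 x0 \<in> fst d'"
  shows "fam_in F F' d d' k \<Phi> z0 x0"
proof -
  obtain Z N where ZN: "open Z" "open N" "z0 \<in> Z" "x0 \<in> N" "N \<subseteq> fst c"
    and inc': "\<And>z x. z \<in> Z \<Longrightarrow> x \<in> N \<Longrightarrow> \<Phi> z x \<in> fst c'"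
    and proj: "\<And>z x. z \<in> Z \<Longrightarrow> x \<in> N \<Longrightarrow>
      local_proj c' (\<Phi> z x) = local_proj c' (\<Phi> z0 x)"
    and C: "C_par (model F) k (Z \<times> snd c ` N) (\<lambda>z. local_expr c c' (\<Phi> z))"
    using fam unfolding fam_in_def by blast
  obtain N' where N': "openin (top_of_set (model F')) N'" "snd c' (\<Phi> z0 x0) \<in> N'"
    "N' \<subseteq> snd c' ` (fst c' \<inter> fst d')"
    "\<And>a b. a \<in> N' \<Longrightarrow> b \<in> N' \<Longrightarrow>
      fst a = fst b \<Longrightarrow> fst (local_expr c' d' id a) = fst (local_expr c' d' id b)"
    using cod.transition_plaques[OF c(2) d(2) inc'[OF ZN(3,4)] x0(2)] by blast
  obtain T' where T': "open T'" "N' = model F' \<inter> T'" using N'(1) by (auto simp: openin_open)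
  have cont: "continuous_on (Z \<times> N) (\<lambda>p. snd c' (\<Phi> (fst p) (snd p)))"
    by (rule fam_continuous[OF c(1) ZN(5) C])
  \<comment> \<open>Joint continuity in (z, x) yields one product neighbourhood on which every
    member of the family lands in \<open>N'\<close>.\<close>
  have "open ((Z \<times> N) \<inter> (\<lambda>p. snd c' (\<Phi> (fst p) (snd p))) -` T')"
    by (rule continuous_open_preimage[OF cont open_Times[OF ZN(1,2)] T'(1)])
  moreover have
    "(z0, x0) \<in> (Z \<times> N) \<inter> (\<lambda>p. snd c' (\<Phi> (fst p) (snd p))) -` T'"
      using ZN N'(2) T'(2) by simp
  ultimately obtain Z1 N1 where Z1: "open Z1" "open N1" "(z0, x0) \<in> Z1 \<times> N1"
    "Z1 \<times> N1 \<subseteq> (Z \<times> N) \<inter> (\<lambda>p. snd c' (\<Phi> (fst p) (snd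
      p))) -` T'" by (rule open_prod_elim)
  define N2 where "N2 = N1 \<inter> fst d"
  have sub: "z \<in> Z" "x \<in> N" "snd c' (\<Phi> z x) \<in> T'" if "z \<in> Z1" "x \<in> N2" for z x
    using subsetD[OF Z1(4), of "(z, x)"] that by (simp_all add: N2_def)
  have N2: "open N2" "x0 \<in> N2" "N2 \<subseteq> fst d" "N2 \<subseteq> fst c"
    using Z1 ZN(5) x0(1) sub(2)[OF _ , of z0] dom.open_chart_domain[OF d(1)] by (auto simp: N2_def)
  have inN': "snd c' (\<Phi> z x) \<in> N'" if "z \<in> Z1" "x \<in> N2" for z x
    using sub[OF that] cod.chart_image_subset[OF c(2) inc'] T'(2) by simp
  have ind': "\<Phi> z x \<in> fst d'" if "z \<in> Z1" "x \<in> N2" for z x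
    by (rule cod.chart_overlap[OF c(2) inc'[OF sub(1,2)[OF that]] subsetD[OF N'(3) inN'[OF that]]])
  have trd': "local_expr c' d' id (snd c' (\<Phi> z x)) = snd d' (\<Phi> z x)"
    if "z \<in> Z1" "x \<in> N2" for z x
    by (rule cod.transition_chart[OF c(2) inc'[OF sub(1,2)[OF that]]])
  have z0: "z0 \<in> Z1" using Z1(3) by simp
  have projd: "local_proj d' (\<Phi> z x) = local_proj d' (\<Phi> z0 x)"
    if zx: "z \<in> Z1" "x \<in> N2" for z x
  proof -
    have "fst (snd c' (\<Phi> z x)) = fst (snd c' (\<Phi> z0 x))"
      using proj[OF sub(1,2)[OF zx]] by (simp add: local_proj_def)
    from N'(4)[OF inN'[OF zx] inN'[OF z0 zx(2)] this] show ?thesis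
      by (simp add: trd'[OF zx] trd'[OF z0 zx(2)] local_proj_def)
  qed
  have Cd: "C_par (model F) k (Z1 \<times> snd d ` N2) (\<lambda>z. local_expr d d' (\<Phi> z))"
  proof -
    have op: "openin (top_of_set (UNIV \<times> model F)) (Z1 \<times> snd d ` N2)" 
      by (intro openin_Times dom.chart_image_openin[OF d(1) N2(1,3)]) (use Z1(1) in simp)
    have opc: "openin (top_of_set (UNIV \<times> model F)) (Z1 \<times> snd c ` N2)" 
      by (intro openin_Times dom.chart_image_openin[OF c(1) N2(1,4)]) (use Z1(1) in simp)
    have op': "openin (top_of_set (UNIV \<times> model F')) (UNIV \<times> N')"
      by (rule openin_par[OF N'(1)])
    have 1: "C_par (model F) k (Z1 \<times> snd d ` N2) (\<lambda>_. local_expr d c id)"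
      by (rule C_nat_on_imp_C_par[OF dom.transition_smooth_sub[OF d(1) c(1) k N2(3,4)]
        dom.chart_image_sub[OF d(1) N2(3)]]) auto
    have 2: "C_par (model F) k (Z1 \<times> snd c ` N2) (\<lambda>z. local_expr c c' (\<Phi> z))"
      by (rule C_par_mono[OF C _ order_refl]) (use sub z0 N2(2) Z1 in blast)
    have 3: "C_par (model F') k (UNIV \<times> N') (\<lambda>_. local_expr c' d' id)"
      by (rule C_nat_on_imp_C_par[OF C_nat_on_mono[OF cod.transition_smooth[OF c(2) d(2) k]
        cod.chart_image_sub[OF c(2)] N'(3) order_refl]
            openin_imp_subset[OF N'(1)]]) auto
    have 12: "C_par (model F) k (Z1 \<times> snd d ` N2) (\<lambda>z y. local_expr c c' (\<Phi> z)
      (local_expr d c id y))"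
      by (rule C_par_compose[OF dom.subspace_model op dom.subspace_model opc 1 2])
         (use N2(3) in \<open>auto simp: dom.transition_chart[OF d(1)] subset_iff\<close>)
    have into: "local_expr c c' (\<Phi> z) (local_expr d c id y) = snd c' (\<Phi> z x)"
      if "x \<in> N2" "y = snd d x" for z x y
    proof -
      have "x \<in> fst c" "x \<in> fst d" using that(1) N2(3,4) by blast+
      then show ?thesis by (simp only: that(2) dom.transition_chart[OF d(1)] dom.local_expr_chart[OF c(1)])
    qed
    have 123: "C_par (model F) k (Z1 \<times> snd d ` N2) (\<lambda>z y. local_expr c' d' id
      (local_expr c c' (\<Phi> z) (local_expr d c id y)))"
    proof (rule C_par_compose[OF dom.subspace_model op cod.subspace_model op' 12 3])
      fix z y assume "(z, y) \<in> Z1 \<times> snd d ` N2"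
      then obtain x where x: "z \<in> Z1" "x \<in> N2" "y = snd d x" by blast
      show "(z, local_expr c c' (\<Phi> z) (local_expr d c id y)) \<in> UNIV \<times> N'"
        using inN'[OF x(1,2)] by (simp only: into[OF x(2,3)]) simp
    qed
    show ?thesis
    proof (rule C_par_cong[OF 123 op dom.subspace_model])
      fix z y assume "(z, y) \<in> Z1 \<times> snd d ` N2"
      then obtain x where x: "z \<in> Z1" "x \<in> N2" "y = snd d x" by blast
      then have xd: "x \<in> fst d" using N2(3) by blast
      show "local_expr c' d' id (local_expr c c' (\<Phi> z) (local_expr d c id y)) = local_expr d d'
        (\<Phi> z) y"
        by (simp only: into[OF x(2,3)] trd'[OF x(1,2)]) (simp only: x(3) dom.local_expr_chart[OF d(1) xd])
    qed
  qed
  show ?thesis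
    unfolding fam_in_def
    by (intro exI[of _ Z1] exI[of _ N2] conjI ballI Z1(1) N2(1-3) z0 ind' projd Cd) assumption+
qed

text \<open>A map is a family that does not move, so the independence of charts for
  \<open>C_in\<close> is a case of \<open>fam_in_change\<close>.\<close>

lemma fam_in_static:
  assumes "c \<in> charts F"
  shows "fam_in F F' c c' k (\<lambda>_::real. \<phi>) z x \<longleftrightarrow> C_in F F' c c' k \<phi> x"
proof
  assume "fam_in F F' c c' k (\<lambda>_::real. \<phi>) z x"
  then obtain Z N
    where ZN: "open N" "z \<in> Z" "x \<in> N" "N \<subseteq> fst c"
      "\<And>x. x \<in> N \<Longrightarrow> \<phi> x \<in> fst c'"
    and C: "C_par (model F) k (Z \<times> snd c ` N) (\<lambda>_::real. local_expr c c' \<phi>)"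
    unfolding fam_in_def by blast
  have "C_nat_on (model F) k (snd c ` N) (local_expr c c' \<phi>)"
    by (rule C_par_imp_C_nat_on[OF C]) (use ZN in auto)
  then show "C_in F F' c c' k \<phi> x" unfolding C_in_def using ZN by blast
next
  assume "C_in F F' c c' k \<phi> x"
  then obtain N where N: "open N" "x \<in> N" "N \<subseteq> fst c" "\<phi> ` N \<subseteq> fst c'"
    and C: "C_nat_on (model F) k (snd c ` N) (local_expr c c' \<phi>)" unfolding C_in_def by blast
  have "C_par (model F) k (UNIV \<times> snd c ` N) (\<lambda>_::real. local_expr c c' \<phi>)"
    by (rule C_nat_on_imp_C_par[OF C dom.chart_image_sub[OF assms N(3)]]) auto
  then show "fam_in F F' c c' k (\<lambda>_::real. \<phi>) z x"
    unfolding fam_in_def by (intro exI[of _ UNIV] exI[of _ N]) (use N in auto)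
qed

lemma C_at_chart:
  assumes "C_at F F' k \<phi> x" "enat k \<le> r" "c \<in> charts F" "c' \<in> charts F'"
    "x \<in> fst c" "\<phi> x \<in> fst c'"
  shows "C_in F F' c c' k \<phi> x"
proof -
  obtain d d' where d: "d \<in> charts F" "d' \<in> charts F'" "C_in F F' d d' k \<phi> x"
    using assms(1) unfolding C_at_def by blast
  then have "fam_in F F' d d' k (\<lambda>_::real. \<phi>) 0 x" by (simp add: fam_in_static)
  then have "fam_in F F' c c' k (\<lambda>_::real. \<phi>) 0 x"
    by (rule fam_in_change[OF d(1,2) assms(3,4,2)]) (use assms in auto)
  then show ?thesis by (simp add: fam_in_static[OF assms(3)])
qed

lemma trans_in_change:
  assumes c: "c \<in> charts F" "c' \<in> charts F'" and d: "d \<in> charts F" "d' \<in> charts F'"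
    and k: "enat k \<le> r"
    and cont: "continuous_on UNIV \<phi>"
    and tr: "trans_in F F' c c' k \<phi> x0" and x0: "x0 \<in> fst d" "\<phi> x0 \<in> fst d'"
  shows "trans_in F F' d d' k \<phi> x0"
proof -
  let ?a = "local_proj c' \<circ> \<phi> \<circ> inv_into (fst c) (snd c)"
  obtain N where N: "open N" "x0 \<in> N" "N \<subseteq> fst c"
    "\<And>x. x \<in> N \<Longrightarrow> \<phi> x \<in> fst c'"
    and C: "C_nat_on (model F) k (snd c ` N) ?a"
    using tr unfolding trans_in_def by blast
  have a: "?a (snd c x) = fst (snd c' (\<phi> x))" if "x \<in> fst c" for x
    using that by (simp add: local_proj_def dom.chart_inverse[OF c(1)])
  obtain N' where N': "openin (top_of_set (model F')) N'" "snd c' (\<phi> x0) \<in> N'"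
    "N' \<subseteq> snd c' ` (fst c' \<inter> fst d')"
    "\<And>a b. a \<in> N' \<Longrightarrow> b \<in> N' \<Longrightarrow>
      fst a = fst b \<Longrightarrow> fst (local_expr c' d' id a) = fst (local_expr c' d' id b)"
    using cod.transition_plaques[OF c(2) d(2) N(4)[OF N(2)] x0(2)] by blast
  obtain T' where T': "open T'" "N' = model F' \<inter> T'" using N'(1) by (auto simp: openin_open)
  \<comment> \<open>near \<open>\<phi> x0\<close>, the transverse coordinate in \<open>d'\<close>
    does not change if the plaque coordinate in
    \<open>c'\<close> is frozen, so the plaque component of \<open>\<phi>\<close>, which need not be
      $C^k$, drops out\<close>
  define b0 where "b0 = snd (snd c' (\<phi> x0))"
  have cont1: "continuous_on N (\<lambda>x. snd c' (\<phi> x))"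
    by (rule continuous_on_compose2[OF cod.chart_continuous(1)[OF c(2)] continuous_on_subset[OF
      cont]]) (use N(4) in auto)
  then have cont2: "continuous_on N (\<lambda>x. (fst (snd c' (\<phi> x)), b0))"
    by (intro continuous_intros)
  define N2 where
    "N2 = (N \<inter> (\<lambda>x. snd c' (\<phi> x)) -` T') \<inter> (N \<inter> (\<lambda>x. (fst
      (snd c' (\<phi> x)), b0)) -` T') \<inter> fst d"
  have oN2: "open N2" unfolding N2_def
    by (intro open_Int continuous_open_preimage[OF cont1 N(1) T'(1)] continuous_open_preimage[OF
      cont2 N(1) T'(1)]
        dom.open_chart_domain[OF d(1)])
  have x0N2: "x0 \<in> N2" using N(2) x0(1) N'(2) T'(2) by (simp add: N2_def b0_def)
  have N2: "x \<in> N" "x \<in> fst c" "x \<in> fst d" "snd c' (\<phi> x) \<in> N'"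
    "(fst (snd c' (\<phi> x)), b0) \<in> N'" if "x \<in> N2" for x
  proof -
    show x: "x \<in> N" "x \<in> fst c" "x \<in> fst d" using that N(3) by (auto simp: N2_def)
    have "snd c' (\<phi> x) \<in> model F'" "snd c' (\<phi> x0) \<in> model F'"
      using cod.chart_image_subset[OF c(2)] N(4) x(1) N(2) by blast+
    then show "snd c' (\<phi> x) \<in> N'" "(fst (snd c' (\<phi> x)), b0) \<in> N'"
      using that T'(2) by (auto simp: N2_def b0_def model_def mem_Times_iff)
  qed
  have ind': "\<phi> x \<in> fst d'" if "x \<in> N2" for x
    by (rule cod.chart_overlap[OF c(2) N(4)[OF N2(1)[OF that]] subsetD[OF N'(3) N2(4)[OF that]]])
  have sub: "N2 \<subseteq> fst c" "N2 \<subseteq> fst d" "N2 \<subseteq> N" using N2 by blast+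
  have op: "openin (top_of_set (model F)) (snd d ` N2)" "openin (top_of_set (model F)) (snd c ` N2)"
    using dom.chart_image_openin oN2 sub c(1) d(1) by blast+
  have 2: "C_nat_on (model F) k (snd c ` N2) (\<lambda>y. (?a y, b0))"
    by (intro C_nat_on_Pair[OF dom.subspace_model op(2)] C_nat_on_const[OF dom.subspace_model op(2)]
        C_nat_on_mono[OF C dom.chart_image_sub[OF c(1) N(3)] image_mono[OF sub(3)] order_refl])
  have 3: "C_nat_on (model F') k N' (local_expr c' d' id)"
    by (rule C_nat_on_mono[OF cod.transition_smooth[OF c(2) d(2) k] cod.chart_image_sub[OF c(2)]
      N'(3) order_refl]) auto
  have 12: "C_nat_on (model F) k (snd d ` N2) (\<lambda>y. (?a (local_expr d c id y), b0))"
    by (rule C_nat_on_compose[OF dom.subspace_model op(1) dom.subspace_model op(2)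
      dom.transition_smooth_sub[OF d(1) c(1) k sub(2,1)] 2])
       (use N2(3) in \<open>auto simp: dom.transition_chart[OF d(1)]\<close>)
  have into: "(?a (local_expr d c id y), b0) = (fst (snd c' (\<phi> x)), b0)"
    if "x \<in> N2" "y = snd d x" for x y
    using that N2(2,3)[OF that(1)] by (simp only: dom.transition_chart[OF d(1)] a)
  have 123: "C_nat_on (model F) k (snd d ` N2) (\<lambda>y. local_expr c' d' id (?a (local_expr d c
    id y), b0))"
  proof (rule C_nat_on_compose[OF dom.subspace_model op(1) cod.subspace_model N'(1) 12 3])
    fix y assume "y \<in> snd d ` N2"
    then obtain x where x: "y = snd d x" "x \<in> N2" by (rule imageE)
    show "(?a (local_expr d c id y), b0) \<in> N'" by (simp only: into[OF x(2,1)] N2(5)[OF x(2)])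
  qed
  have "C_nat_on (model F) k (snd d ` N2) (local_proj d' \<circ> \<phi> \<circ> inv_into (fst d) (snd d))"
  proof (rule C_nat_on_cong[OF dom.subspace_model op(1) C_nat_on_linear[OF dom.subspace_model op(1)
    bounded_linear_fst 123]])
    fix y assume "y \<in> snd d ` N2"
    then obtain x where x: "y = snd d x" "x \<in> N2" by (rule imageE)
    have "fst (local_expr c' d' id (?a (local_expr d c id y), b0)) = fst (local_expr c' d' id (fst
      (snd c' (\<phi> x)), b0))"
      by (simp only: into[OF x(2,1)])
    also have "\<dots> = fst (local_expr c' d' id (snd c' (\<phi> x)))"
      by (rule N'(4)[OF N2(5,4)[OF x(2)]]) simp
    also have "\<dots> = (local_proj d' \<circ> \<phi> \<circ> inv_into (fst d) (snd d)) y"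
      using N2(3)[OF x(2)]
      by (simp add: x(1) local_proj_def dom.chart_inverse[OF d(1)] cod.transition_chart[OF c(2)
        N(4)[OF N2(1)[OF x(2)]]])
    finally show "fst (local_expr c' d' id (?a (local_expr d c id y), b0)) = (local_proj d' \<circ>
      \<phi> \<circ> inv_into (fst d) (snd d)) y" .
  qed
  then show ?thesis unfolding trans_in_def using oN2 x0N2 sub(2) ind' by blast
qed

lemma trans_at_chart:
  assumes "trans_at F F' k \<phi> x" "enat k \<le> r" "continuous_on UNIV \<phi>"
    "c \<in> charts F" "c' \<in> charts F'" "x \<in> fst c" "\<phi> x \<in> fst c'"
  shows "trans_in F F' c c' k \<phi> x"
proof -
  obtain d d' where "d \<in> charts F" "d' \<in> charts F'" "trans_in F F' d d' k \<phi> x"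
    using assms(1) unfolding trans_at_def by blast
  then show ?thesis by (rule trans_in_change[OF _ _ assms(4,5,2,3) _ assms(6,7)])
qed

lemma C_at_imp_isCont:
  assumes "C_at F F' k \<phi> x"
  shows "isCont \<phi> x"
proof -
  obtain c c' where c: "c \<in> charts F" "c' \<in> charts F'" and "C_in F F' c c' k \<phi> x"
    using assms unfolding C_at_def by blast
  then obtain N
    where N: "open N" "x \<in> N" "N \<subseteq> fst c"
      "\<And>x. x \<in> N \<Longrightarrow> \<phi> x \<in> fst c'"
    and C: "C_nat_on (model F) k (snd c ` N) (local_expr c c' \<phi>)" unfolding C_in_def by blast
  have 1: "continuous_on (snd c ` N) (local_expr c c' \<phi>)"
    by (rule C_nat_on_imp_continuous_on[OF C dom.chart_image_sub[OF c(1) N(3)]])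
  have 2: "continuous_on N (\<lambda>x. local_expr c c' \<phi> (snd c x))"
    by (rule continuous_on_compose2[OF 1 continuous_on_subset[OF dom.chart_continuous(1)[OF c(1)]
      N(3)]]) simp
  have eq: "local_expr c c' \<phi> (snd c x) = snd c' (\<phi> x)" if "x \<in> N" for x
    using dom.local_expr_chart[OF c(1)] N(3) that by blast
  have "continuous_on N (\<lambda>x. inv_into (fst c') (snd c') (local_expr c c' \<phi> (snd c x)))"
    by (rule continuous_on_compose2[OF cod.chart_continuous(2)[OF c(2)] 2]) (use eq N(4) in auto)
  then have "continuous_on N \<phi>"
    by (rule iffD1[OF continuous_on_cong[OF refl], rotated]) (simp add: eq cod.chart_inverse[OF c(2)] N(4))
  then show ?thesis using N(1,2) by (simp add: continuous_on_eq_continuous_at)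
qed

lemma C_at_imp_continuous: assumes "\<And>x. C_at F F' k \<phi> x" shows "continuous_on UNIV \<phi>"
  by (rule continuous_at_imp_continuous_on) (rule ballI, rule C_at_imp_isCont, rule assms)

lemma C_at_cong:
  assumes "C_at F F' k \<phi> x" "open U" "x \<in> U"
    "\<And>y. y \<in> U \<Longrightarrow> \<phi> y = \<psi> y"
  shows "C_at F F' k \<psi> x"
proof -
  obtain c c' where c: "c \<in> charts F" "c' \<in> charts F'" and "C_in F F' c c' k \<phi> x"
    using assms(1) unfolding C_at_def by blast
  then obtain N
    where N: "open N" "x \<in> N" "N \<subseteq> fst c"
      "\<And>x. x \<in> N \<Longrightarrow> \<phi> x \<in> fst c'"
    and C: "C_nat_on (model F) k (snd c ` N) (local_expr c c' \<phi>)" unfolding C_in_def by blast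
  have NU: "open (N \<inter> U)" "N \<inter> U \<subseteq> fst c" using N assms(2) by auto
  have "C_nat_on (model F) k (snd c ` (N \<inter> U)) (local_expr c c' \<psi>)"
  proof (rule C_nat_on_cong[OF dom.subspace_model dom.chart_image_openin[OF c(1) NU]
        C_nat_on_mono[OF C dom.chart_image_sub[OF c(1) N(3)] image_mono[OF Int_lower1] order_refl]])
    fix y assume "y \<in> snd c ` (N \<inter> U)"
    then obtain w where w: "y = snd c w" "w \<in> N \<inter> U" by (rule imageE)
    then have "w \<in> fst c" using NU(2) by blast
    then show "local_expr c c' \<phi> y = local_expr c c' \<psi> y"
      using w assms(4) by (simp add: dom.local_expr_chart[OF c(1)])
  qed
  moreover have "\<psi> ` (N \<inter> U) \<subseteq> fst c'"
    using N(4) by (intro image_subsetI) (simp flip: assms(4))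
  ultimately have "C_in F F' c c' k \<psi> x" unfolding C_in_def using NU N(2) assms(3) by blast
  then show ?thesis using c unfolding C_at_def by blast
qed

lemma trans_at_cong:
  assumes "trans_at F F' k \<phi> x" "open U" "x \<in> U"
    "\<And>y. y \<in> U \<Longrightarrow> \<phi> y = \<psi> y"
  shows "trans_at F F' k \<psi> x"
proof -
  obtain c c' where c: "c \<in> charts F" "c' \<in> charts F'" and "trans_in F F' c c' k \<phi> x"
    using assms(1) unfolding trans_at_def by blast
  then obtain N
    where N: "open N" "x \<in> N" "N \<subseteq> fst c"
      "\<And>x. x \<in> N \<Longrightarrow> \<phi> x \<in> fst c'"
    and C: "C_nat_on (model F) k (snd c ` N) (local_proj c' \<circ> \<phi> \<circ> inv_into (fst c)
      (snd c))" unfolding trans_in_def by blast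
  have NU: "open (N \<inter> U)" "N \<inter> U \<subseteq> fst c" using N assms(2) by auto
  have "C_nat_on (model F) k (snd c ` (N \<inter> U)) (local_proj c' \<circ> \<psi> \<circ> inv_into
    (fst c) (snd c))"
  proof (rule C_nat_on_cong[OF dom.subspace_model dom.chart_image_openin[OF c(1) NU]
        C_nat_on_mono[OF C dom.chart_image_sub[OF c(1) N(3)] image_mono[OF Int_lower1] order_refl]])
    fix y assume "y \<in> snd c ` (N \<inter> U)"
    then obtain w where w: "y = snd c w" "w \<in> N \<inter> U" by (rule imageE)
    then have "w \<in> fst c" using NU(2) by blast
    then show "(local_proj c' \<circ> \<phi> \<circ> inv_into (fst c) (snd c)) y = (local_proj c'
      \<circ> \<psi> \<circ> inv_into (fst c) (snd c)) y"
      using w assms(4) by (simp add: dom.chart_inverse[OF c(1)])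
  qed
  moreover have "\<psi> ` (N \<inter> U) \<subseteq> fst c'"
    using N(4) by (intro image_subsetI) (simp flip: assms(4))
  ultimately have "trans_in F F' c c' k \<psi> x" unfolding trans_in_def using NU N(2) assms(3) by blast
  then show ?thesis using c unfolding trans_at_def by blast
qed

lemma C_at_mono:
  assumes "C_at F F' k \<phi> x" "j \<le> k" shows "C_at F F' j \<phi> x"
proof -
  obtain c c' where c: "c \<in> charts F" "c' \<in> charts F'" and "C_in F F' c c' k \<phi> x"
    using assms(1) unfolding C_at_def by blast
  then obtain N where N: "open N" "x \<in> N" "N \<subseteq> fst c" "\<phi> ` N \<subseteq> fst c'"
    and C: "C_nat_on (model F) k (snd c ` N) (local_expr c c' \<phi>)" unfolding C_in_def by blast
  have "C_nat_on (model F) j (snd c ` N) (local_expr c c' \<phi>)"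
    by (rule C_nat_on_mono[OF C dom.chart_image_sub[OF c(1) N(3)] subset_refl assms(2)])
  then show ?thesis using c N unfolding C_at_def C_in_def by blast
qed

lemma C_at_imp_trans_at:
  assumes "C_at F F' k \<phi> x" shows "trans_at F F' k \<phi> x"
proof -
  obtain c c' where c: "c \<in> charts F" "c' \<in> charts F'" and "C_in F F' c c' k \<phi> x"
    using assms(1) unfolding C_at_def by blast
  then obtain N where N: "open N" "x \<in> N" "N \<subseteq> fst c" "\<phi> ` N \<subseteq> fst c'"
    and C: "C_nat_on (model F) k (snd c ` N) (local_expr c c' \<phi>)" unfolding C_in_def by blast
  have "(\<lambda>y. fst (local_expr c c' \<phi> y)) = local_proj c' \<circ> \<phi> \<circ> inv_into
    (fst c) (snd c)"
    by (rule ext) (simp add: local_expr_def local_proj_def)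
  then have "C_nat_on (model F) k (snd c ` N) (local_proj c' \<circ> \<phi> \<circ> inv_into (fst c)
    (snd c))"
    using C_nat_on_linear[OF dom.subspace_model dom.chart_image_openin[OF c(1) N(1,3)]
      bounded_linear_fst C] by simp
  then show ?thesis using c N unfolding trans_at_def trans_in_def by blast
qed

text \<open>The definition speaks of all pairs of charts; the pointwise form asks for one suitable
  pair near each point and can be checked for maps glued from pieces. \<open>C_at_chart\<close>
  carries the information back to an arbitrary pair.\<close>

lemma C_map_on_iff:
  assumes N: "open N" and k: "k \<le> r"
  shows "C_map_on k N F F' \<phi> \<longleftrightarrow>
    (\<forall>x\<in>N. \<forall>j. enat j \<le> k \<longrightarrow> C_at F F' j \<phi> x)"
proof
  assume L: "C_map_on k N F F' \<phi>"
  show "\<forall>x\<in>N. \<forall>j. enat j \<le> k \<longrightarrow> C_at F F' j \<phi> x"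
  proof (intro ballI allI impI)
    fix x j assume x: "x \<in> N" and j: "enat j \<le> k"
    obtain c where c: "c \<in> charts F" "x \<in> fst c" using dom.charts_cover by blast
    obtain c' where c': "c' \<in> charts F'" "\<phi> x \<in> fst c'" using cod.charts_cover by blast
    let ?N = "fst c \<inter> N \<inter> \<phi> -` fst c'"
    have "open (N \<inter> \<phi> -` fst c')"
      using L unfolding C_map_on_def
        by (intro continuous_open_preimage[OF _ N cod.open_chart_domain[OF c'(1)]]) blast
    then have "open ?N" using dom.open_chart_domain[OF c(1)] by (simp add: open_Int Int_assoc)
    moreover have "C_nat_on (model F) j (snd c ` ?N) (local_expr c c' \<phi>)"
      using L c(1) c'(1) j unfolding C_map_on_def C_on_def by blast
    ultimately have "C_in F F' c c' j \<phi> x"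
      unfolding C_in_def using x c c' by (intro exI[of _ ?N]) auto
    then show "C_at F F' j \<phi> x" unfolding C_at_def using c c' by blast
  qed
next
  assume R: "\<forall>x\<in>N. \<forall>j. enat j \<le> k \<longrightarrow> C_at F F' j \<phi> x"
  then have "C_at F F' 0 \<phi> x" if "x \<in> N" for x using that by (simp add: zero_enat_def[symmetric])
  then have "\<forall>x\<in>N. isCont \<phi> x" using C_at_imp_isCont by blast
  then have cont: "continuous_on N \<phi>" using N by (simp add: continuous_on_eq_continuous_at)
  have "C_nat_on (model F) j (snd c ` (fst c \<inter> N \<inter> \<phi> -` fst c')) (local_expr c c'
    \<phi>)"
    if c: "c \<in> charts F" "c' \<in> charts F'" and j: "enat j \<le> k" for c c' j
  proof -
    let ?N = "fst c \<inter> N \<inter> \<phi> -` fst c'"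
    have "open (N \<inter> \<phi> -` fst c')"
      by (intro continuous_open_preimage[OF cont N cod.open_chart_domain[OF c(2)]])
    then have oN: "open ?N" "?N \<subseteq> fst c" using dom.open_chart_domain[OF c(1)]
      by (simp_all add: open_Int Int_assoc)
    note op = dom.chart_image_openin[OF c(1) oN]
    show ?thesis
    proof (rule C_nat_on_local[OF dom.subspace_model op])
      fix y assume "y \<in> snd c ` ?N"
      then obtain x where x: "y = snd c x" "x \<in> ?N" by (rule imageE)
      have "C_in F F' c c' j \<phi> x"
        by (rule C_at_chart[OF _ order_trans[OF j k] c]) (use x R j in auto)
      then obtain M
        where M: "open M" "x \<in> M" "M \<subseteq> fst c"
          "C_nat_on (model F) j (snd c ` M) (local_expr c c' \<phi>)"
        unfolding C_in_def by blast
      have MN: "open (M \<inter> ?N)" "M \<inter> ?N \<subseteq> fst c" using M oN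
        by (simp_all add: open_Int le_infI1)
      have "openin (top_of_set (snd c ` ?N)) (snd c ` (M \<inter> ?N) \<inter> snd c ` ?N)"
        by (rule openin_Int_subset[OF dom.chart_image_openin[OF c(1) MN] openin_imp_subset[OF op]])
      moreover have "snd c ` (M \<inter> ?N) \<inter> snd c ` ?N = snd c ` (M \<inter> ?N)" by blast
      ultimately have "openin (top_of_set (snd c ` ?N)) (snd c ` (M \<inter> ?N))" by simp
      moreover have "C_nat_on (model F) j (snd c ` (M \<inter> ?N)) (local_expr c c' \<phi>)"
        by (rule C_nat_on_mono[OF M(4) dom.chart_image_sub[OF c(1) M(3)] image_mono[OF Int_lower1]
          order_refl])
      ultimately show
        "\<exists>N. openin (top_of_set (snd c ` ?N)) N \<and> y \<in> N \<and>
          C_nat_on (model F) j N (local_expr c c' \<phi>)"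
        using x M(2) by blast
    qed
  qed
  then show "C_map_on k N F F' \<phi>" unfolding C_map_on_def C_on_def using cont by blast
qed

lemma C_fol_iff:
  assumes "k \<le> r"
  shows "\<phi> \<in> C_fol k F F' \<longleftrightarrow> foliation_map F F' \<phi> \<and>
    (\<forall>x j. enat j \<le> k \<longrightarrow> C_at F F' j \<phi> x)"
  using C_map_on_iff[OF open_UNIV assms] by (simp add: C_fol_def)

lemma C_fol_enat_iff:
  assumes "enat s \<le> r"
  shows "\<phi> \<in> C_fol (enat s) F F' \<longleftrightarrow> foliation_map F F' \<phi> \<and>
    (\<forall>x. C_at F F' s \<phi> x)"
proof -
  have "(\<forall>x j. enat j \<le> enat s \<longrightarrow>
    C_at F F' j \<phi> x) \<longleftrightarrow> (\<forall>x. C_at F F' s \<phi> x)"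
    unfolding enat_ord_simps using C_at_mono by blast
  then show ?thesis by (simp only: C_fol_iff[OF assms])
qed

text \<open>The transverse condition is imposed only on charts that are mapped entirely into a
  target chart. By continuity and \<open>chart_shrink\<close> every point lies in such a chart, so
  the condition is visible as a germ everywhere; conversely \<open>trans_at_chart\<close> moves the
  germs into any given pair of charts.\<close>

lemma C2_fol_iff:
  assumes s: "enat s \<le> r"
  shows "\<phi> \<in> C2_fol r (enat s) F F' \<longleftrightarrow>
    foliation_map F F' \<phi> \<and> (\<forall>x. C_at F F' s \<phi> x) \<and>
      (\<forall>x k. enat k \<le> r \<longrightarrow> trans_at F F' k \<phi> x)"
proof -
  have "(\<forall>c\<in>charts F. \<forall>c'\<in>charts F'. \<phi> ` fst c \<subseteq> fst c'
    \<longrightarrow>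
      C_on (model F) r (snd c ` fst c) (local_proj c' \<circ> \<phi> \<circ> inv_into (fst c) (snd
        c))) \<longleftrightarrow>
      (\<forall>x k. enat k \<le> r \<longrightarrow>
        trans_at F F' k \<phi> x)" (is "?L = ?R") if C: "\<forall>x. C_at F F' s \<phi> x"
  proof
    have cont: "continuous_on UNIV \<phi>" by (rule C_at_imp_continuous) (rule C[rule_format])
    assume ?L
    show ?R
    proof (intro allI impI)
      fix x k assume k: "enat k \<le> r"
      obtain c where c: "c \<in> charts F" "x \<in> fst c" using dom.charts_cover by blast
      obtain c' where c': "c' \<in> charts F'" "\<phi> x \<in> fst c'" using cod.charts_cover by blast
      have "open (\<phi> -` fst c')" using cod.open_chart_domain[OF c'(1)] cont
        by (simp add: continuous_on_open_vimage open_vimage)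
      moreover have "x \<in> \<phi> -` fst c'" using c'(2) by simp
      ultimately obtain U
        where U: "(U, snd c) \<in> charts F" "x \<in> U" "U \<subseteq> fst c \<inter> \<phi> -` fst c'"
        by (rule dom.chart_shrink[OF c])
      have "\<phi> ` U \<subseteq> fst c'" using U(3) by blast
      then have "C_on (model F) r (snd c ` U) (local_proj c' \<circ> \<phi> \<circ> inv_into U (snd c))"
        using \<open>?L\<close>[rule_format, OF U(1) c'(1)] by simp
      then have "C_nat_on (model F) k (snd c ` U) (local_proj c' \<circ> \<phi> \<circ> inv_into U (snd c))"
        using k by (simp add: C_on_def)
      then have "trans_in F F' (U, snd c) c' k \<phi> x"
        unfolding trans_in_def
          using U(2) dom.open_chart_domain[OF U(1)] \<open>\<phi> ` U \<subseteq> fst c'\<close> by auto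
      then show "trans_at F F' k \<phi> x" unfolding trans_at_def using U(1) c'(1) by blast
    qed
  next
    have cont: "continuous_on UNIV \<phi>" by (rule C_at_imp_continuous) (rule C[rule_format])
    assume ?R
    have "C_nat_on (model F) k (snd c ` fst c) (local_proj c' \<circ> \<phi> \<circ> inv_into (fst
      c) (snd c))"
      if c: "c \<in> charts F" "c' \<in> charts F'" "\<phi> ` fst c \<subseteq> fst c'"
        and k: "enat k \<le> r" for c c' k
    proof -
      note op = dom.chart_image_openin[OF c(1) dom.open_chart_domain[OF c(1)] subset_refl]
      show ?thesis
      proof (rule C_nat_on_local[OF dom.subspace_model op])
        fix y assume "y \<in> snd c ` fst c"
        then obtain x where x: "y = snd c x" "x \<in> fst c" by (rule imageE)
        have "trans_in F F' c c' k \<phi> x"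
          by (rule trans_at_chart[OF _ k cont c(1,2)]) (use x \<open>?R\<close> k c(3) in blast)+
        then obtain M where M: "open M" "x \<in> M" "M \<subseteq> fst c"
          "C_nat_on (model F) k (snd c ` M) (local_proj c' \<circ> \<phi> \<circ> inv_into (fst c) (snd c))"
          unfolding trans_in_def by blast
        have "openin (top_of_set (snd c ` fst c)) (snd c ` M \<inter> snd c ` fst c)"
          by (rule openin_Int_subset[OF dom.chart_image_openin[OF c(1) M(1,3)] openin_imp_subset[OF op]])
        moreover have "snd c ` M \<inter> snd c ` fst c = snd c ` M" using M(3) by blast
        ultimately have "openin (top_of_set (snd c ` fst c)) (snd c ` M)" by simp
        moreover have "y \<in> snd c ` M" using x(1) M(2) by simp
        ultimately show "\<exists>N. openin (top_of_set (snd c ` fst c)) N \<and> y \<in> N \<and>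
            C_nat_on (model F) k N (local_proj c' \<circ> \<phi> \<circ> inv_into (fst c) (snd c))"
          using M(4) by blast
      qed
    qed
    then show ?L by (simp add: C_on_def)
  qed
  then show ?thesis unfolding C2_fol_def mem_Collect_eq C_fol_enat_iff[OF s] by blast
qed

lemma C_fol_subset_C2_fol:
  assumes "enat s \<le> r"
  shows "C_fol r F F' \<subseteq> C2_fol r (enat s) F F'"
proof
  fix \<phi> assume "\<phi> \<in> C_fol r F F'"
  then have "foliation_map F F' \<phi>"
    "\<And>x j. enat j \<le> r \<Longrightarrow> C_at F F' j \<phi> x"
      using C_fol_iff[OF order_refl] by blast+
  then show "\<phi> \<in> C2_fol r (enat s) F F'" using C2_fol_iff[OF assms] assms C_at_imp_trans_at
    by blast
qed

end


section \<open>Smoothing in a coordinate ball\<close>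

context foliated begin

definition coord_ball ::
  "('m, 'q, 'p) chart \<Rightarrow> 'q \<times> 'p \<Rightarrow> real \<Rightarrow> 'm set"
  where "coord_ball c y R = {x \<in> fst c. dist (snd c x) y \<le> R}"

lemma compact_coord_ball:
  assumes "c \<in> charts F" "cball y R \<inter> model F \<subseteq> snd c ` fst c"
  shows "compact (coord_ball c y R)"
proof -
  have "compact (cball y R \<inter> model F)"
    by (rule compact_Int_closed[OF compact_cball closed_subspace[OF subspace_model]])
  then have "compact (inv_into (fst c) (snd c) ` (cball y R \<inter> model F))"
    by (rule compact_continuous_image[OF continuous_on_subset[OF chart_continuous(2)[OF assms(1)]
      assms(2)]])
  moreover have "inv_into (fst c) (snd c) ` (cball y R \<inter> model F) = coord_ball c y R"
  proof
    show "inv_into (fst c) (snd c) ` (cball y R \<inter> model F) \<subseteq> coord_ball c y R"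
    proof (rule image_subsetI)
      fix w assume w: "w \<in> cball y R \<inter> model F"
      from subsetD[OF assms(2) this] obtain x where x: "w = snd c x" "x \<in> fst c" by (rule imageE)
      then show "inv_into (fst c) (snd c) w \<in> coord_ball c y R"
        using w by (simp add: coord_ball_def chart_inverse[OF assms(1)] dist_commute)
    qed
    show "coord_ball c y R \<subseteq> inv_into (fst c) (snd c) ` (cball y R \<inter> model F)"
    proof
      fix x assume x: "x \<in> coord_ball c y R"
      then have "x \<in> fst c" by (simp add: coord_ball_def)
      then show "x \<in> inv_into (fst c) (snd c) ` (cball y R \<inter> model F)"
        using x chart_image_subset[OF assms(1)] chart_inverse[OF assms(1)]
        by (intro image_eqI[of _ _ "snd c x"]) (simp_all add: coord_ball_def dist_commute)
    qed
  qed
  ultimately show ?thesis by simp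
qed

lemma open_coord_ball:
  assumes "c \<in> charts F"
  shows "open {x \<in> fst c. dist (snd c x) y < R}"
proof -
  have "open {x \<in> fst c. snd c x \<in> model F \<inter> ball y R}"
    by (rule chart_preimage_open[OF assms]) (auto simp: openin_open)
  moreover have
    "{x \<in> fst c. snd c x \<in> model F \<inter> ball y R} = {x \<in> fst c. dist (snd c x) y < R}"
    using chart_image_subset[OF assms] by (auto simp: dist_commute)
  ultimately show ?thesis by simp
qed

text \<open>The second conclusion says that the ball is not cut off by the edge of the chart, which
  is what makes \<open>coord_ball\<close> compact.\<close>

lemma small_coord_ball:
  assumes "c \<in> charts F" "x \<in> fst c" "open U" "x \<in> U"
  obtains R where "R > 0" "cball (snd c x) R \<inter> model F \<subseteq> snd c ` fst c"
    "coord_ball c (snd c x) R \<subseteq> U"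
proof -
  have "openin (top_of_set (model F)) (snd c ` (fst c \<inter> U))"
    by (rule chart_image_openin) (use assms in \<open>simp_all add: open_Int open_chart_domain\<close>)
  then obtain T where T: "open T" "snd c ` (fst c \<inter> U) = model F \<inter> T"
    by (auto simp: openin_open)
  have "snd c x \<in> model F \<inter> T" unfolding T(2)[symmetric] using assms by blast
  then obtain R where R: "R > 0" "cball (snd c x) R \<subseteq> T" using T(1) open_contains_cball by blast
  show thesis
  proof (rule that[OF R(1)])
    show "cball (snd c x) R \<inter> model F \<subseteq> snd c ` fst c" using R(2) T(2) by blast
    show "coord_ball c (snd c x) R \<subseteq> U"
    proof
      fix w assume "w \<in> coord_ball c (snd c x) R"
      then have w: "w \<in> fst c" "dist (snd c w) (snd c x) \<le> R" by (simp_all add: coord_ball_def)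
      then have "snd c w \<in> model F \<inter> T" using R(2) chart_image_subset[OF assms(1) w(1)]
        by (auto simp: dist_commute)
      then show "w \<in> U" unfolding T(2)[symmetric] by (rule chart_overlap[OF assms(1) w(1)])
    qed
  qed
qed

end

context foliated_pair begin

lemma fam_at_const:
  assumes "C_at F F' k \<phi> x" "open U" "x \<in> U"
    "\<And>z y. y \<in> U \<Longrightarrow> \<Phi> z y = \<phi> y"
  shows "fam_at F F' k \<Phi> (0::real) x"
proof -
  obtain c c' where c: "c \<in> charts F" "c' \<in> charts F'" and "C_in F F' c c' k \<phi> x"
    using assms(1) unfolding C_at_def by blast
  then obtain N
    where N: "open N" "x \<in> N" "N \<subseteq> fst c"
      "\<And>x. x \<in> N \<Longrightarrow> \<phi> x \<in> fst c'"
    and C: "C_nat_on (model F) k (snd c ` N) (local_expr c c' \<phi>)" unfolding C_in_def by blast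
  have NU: "open (N \<inter> U)" "N \<inter> U \<subseteq> fst c" using N assms(2) by auto
  have op: "openin (top_of_set (UNIV \<times> model F)) (UNIV \<times> snd c ` (N \<inter> U) ::
    (real \<times> _) set)"
    by (rule openin_par[OF dom.chart_image_openin[OF c(1) NU]])
  have "C_par (model F) k (UNIV \<times> snd c ` (N \<inter> U)) (\<lambda>_::real. local_expr c c' \<phi>)"
    by (rule C_nat_on_imp_C_par[OF C dom.chart_image_sub[OF c(1) N(3)]]) auto
  then have Cz:
    "C_par (model F) k (UNIV \<times> snd c ` (N \<inter> U)) (\<lambda>z::real. local_expr c c'
      (\<Phi> z))"
  proof (rule C_par_cong[OF _ op dom.subspace_model])
    fix z :: real and y assume "(z, y) \<in> UNIV \<times> snd c ` (N \<inter> U)"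
    then obtain w where w: "y = snd c w" "w \<in> N \<inter> U" by blast
    then have "w \<in> fst c" using NU(2) by blast
    then show "local_expr c c' \<phi> y = local_expr c c' (\<Phi> z) y"
      using w assms(4) by (simp add: dom.local_expr_chart[OF c(1)])
  qed
  have "fam_in F F' c c' k \<Phi> 0 x"
    unfolding fam_in_def
    by (intro exI[of _ UNIV] exI[of _ "N \<inter> U"] conjI ballI NU Cz) (use N(2,4) assms(3,4) in simp_all)
  then show ?thesis using c unfolding fam_at_def by blast
qed

lemma C_inI:
  assumes "c \<in> charts F" "open N" "x \<in> N" "N \<subseteq> fst c"
    "\<And>x. x \<in> N \<Longrightarrow> \<phi> x \<in> fst c'"
    "C_nat_on (model F) k (snd c ` N) g"
      "\<And>x. x \<in> N \<Longrightarrow> g (snd c x) = snd c' (\<phi> x)"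
  shows "C_in F F' c c' k \<phi> x"
proof -
  have "C_nat_on (model F) k (snd c ` N) (local_expr c c' \<phi>)"
  proof (rule C_nat_on_cong[OF dom.subspace_model dom.chart_image_openin[OF assms(1,2,4)] assms(6)])
    fix y assume "y \<in> snd c ` N"
    then obtain w where w: "y = snd c w" "w \<in> N" by (rule imageE)
    then have "w \<in> fst c" using assms(4) by blast
    then show "g y = local_expr c c' \<phi> y"
      using w assms(7) by (simp add: dom.local_expr_chart[OF assms(1)])
  qed
  then show ?thesis unfolding C_in_def using assms by blast
qed

text \<open>\<open>local_smoothing\<close> transplanted to the manifolds: the plaque coordinate is
  deformed, the transverse one is kept, and the result is glued to \<open>\<phi>\<close> outside the
  coordinate ball. Gluing is harmless because \<open>G z = u\<close> from distance R/2 on. The bound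
  \<open>\<delta>\<close> marks how long the deformed coordinates are sure to stay in the image of
  the target chart.\<close>

lemma step_family:
  assumes s: "enat s \<le> r"
    and \<phi>': "\<forall>x. C_at F F' s \<phi> x"
      "\<forall>x k. enat k \<le> r \<longrightarrow> trans_at F F' k \<phi> x"
    and c: "c \<in> charts F" "c' \<in> charts F'" and y: "y \<in> model F"
      and R: "R > 0" "cball y R \<inter> model F \<subseteq> snd c ` fst c"
    and K: "\<phi> ` dom.coord_ball c y R \<subseteq> fst c'"
  shows "\<exists>(\<Phi> :: real \<Rightarrow> 'm \<Rightarrow> 'n) \<delta>. \<delta> > 0 \<and>
    (\<forall>x. \<Phi> 0 x = \<phi> x) \<and>
    (\<forall>z x. x \<notin> dom.coord_ball c y R \<longrightarrow> \<Phi> z x = \<phi> x) \<and>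
    (\<forall>x. fam_at F F' s \<Phi> 0 x) \<and>
    (\<forall>z x. (\<phi> x, \<Phi> z x) \<in> (plaque_rel F')\<^sup>*) \<and>
    (\<forall>z. 0 < z \<longrightarrow> z < \<delta> \<longrightarrow>
      (\<forall>k x. enat k \<le> r \<longrightarrow>
      (C_at F F' k \<phi> x \<longrightarrow> C_at F F' k (\<Phi> z) x) \<and>
      (x \<in> fst c \<longrightarrow> dist (snd c x) y < R / 4 \<longrightarrow>
        C_at F F' k (\<Phi> z) x) \<and>
      trans_at F F' k (\<Phi> z) x))"
proof -
  let ?K = "dom.coord_ball c y R"
  let ?V = "model F"
  note \<phi> = \<phi>'[rule_format]
  let ?g = "local_expr c c' \<phi>"
  note Vs = dom.subspace_model
  have cont: "continuous_on UNIV \<phi>" by (rule C_at_imp_continuous[OF \<phi>(1)])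
  define U where "U = fst c \<inter> \<phi> -` fst c'"
  have "open (\<phi> -` fst c')" using cod.open_chart_domain[OF c(2)] cont by (simp add: open_vimage)
  then have U: "open U" "U \<subseteq> fst c" "\<And>x. x \<in> U \<Longrightarrow> \<phi> x \<in> fst c'"
    using dom.open_chart_domain[OF c(1)] by (auto simp: U_def)
  have KU: "?K \<subseteq> U" using K by (auto simp: U_def dom.coord_ball_def)
  have "compact ?K" by (rule dom.compact_coord_ball[OF c(1) R(2)])
  then have oK: "open (- ?K)" by (simp add: compact_imp_closed open_Compl)
  define W where "W = snd c ` U"
  have W: "openin (top_of_set ?V) W" unfolding W_def by (rule dom.chart_image_openin[OF c(1) U(1,2)])
  have WV: "W \<subseteq> ?V" using openin_imp_subset[OF W] .
  have ballW: "cball y R \<inter> ?V \<subseteq> W"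
  proof
    fix w assume w: "w \<in> cball y R \<inter> ?V"
    from subsetD[OF R(2) this] obtain x where x: "w = snd c x" "x \<in> fst c" by (rule imageE)
    then have "x \<in> ?K" using w by (simp add: dom.coord_ball_def dist_commute)
    then show "w \<in> W" using KU x(1) unfolding W_def by blast
  qed
  have g: "?g (snd c x) = snd c' (\<phi> x)" if "x \<in> U" for x
    using that U(2) by (intro dom.local_expr_chart[OF c(1)]) blast
  have "C_map_on (enat s) UNIV F F' \<phi>"
    unfolding C_map_on_iff[OF open_UNIV s] enat_ord_simps using \<phi>(1) C_at_mono by blast
  then have gC: "C_nat_on ?V s W ?g"
    using c unfolding C_map_on_def C_on_def W_def U_def by auto
  define u where "u w = snd (?g w)" for w
  have u_of: "C_nat_on ?V k W' u" if "openin (top_of_set ?V) W'" "C_nat_on ?V k W' ?g" for k W'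
    unfolding u_def by (rule C_nat_on_linear[OF Vs that(1) bounded_linear_snd that(2)])
  have f_of: "C_nat_on ?V k W' (\<lambda>w. fst (?g w))"
    if "openin (top_of_set ?V) W'" "C_nat_on ?V k W' ?g" for k W'
    by (rule C_nat_on_linear[OF Vs that(1) bounded_linear_fst that(2)])
  have gV': "?g w \<in> model F'" if "w \<in> W" for w
    using that g cod.chart_image_subset[OF c(2) U(3)] unfolding W_def by auto
  have uP: "u ` W \<subseteq> tang F'" using gV' by (auto simp: u_def model_def mem_Times_iff)
  obtain G :: "real \<Rightarrow> 'q \<times> 'p \<Rightarrow> 'v" where G: "\<forall>x\<in>W. G 0 x = u x"
    "\<forall>z. \<forall>x\<in>W. R / 2 \<le> dist x y \<longrightarrow> G z x = u x"
    "\<forall>z. \<forall>x\<in>W. G z x \<in> tang F'"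
    "C_par ?V s (UNIV \<times> W) G"
    "\<forall>z k W'. z \<noteq> 0 \<longrightarrow> W' \<subseteq> W \<longrightarrow>
      openin (top_of_set ?V) W' \<longrightarrow> C_nat_on ?V k W' u \<longrightarrow>
        C_nat_on ?V k W' (G z)"
    "\<forall>z k. z \<noteq> 0 \<longrightarrow> C_nat_on ?V k (W \<inter> ball y (R / 4)) (G z)"
    using local_smoothing[OF Vs W cod.subspace_tang y R(1) ballW u_of[OF W gC] uP]
    by (elim exE conjE) (rule that; assumption)
  note G = G[rule_format]
  define \<Gamma> where "\<Gamma> z w = (fst (?g w), G z w)" for z w
  note oW = openin_par[OF W]
  have \<Gamma>C: "C_par ?V s (UNIV \<times> W) \<Gamma>"
    unfolding \<Gamma>_def[abs_def]
    by (rule C_par_Pair[OF Vs oW _ G(4)]) (rule C_nat_on_imp_C_par[OF f_of[OF W gC] WV], simp)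
  have \<Gamma>g: "\<Gamma> z w = ?g w" if "w \<in> W" "z = 0 \<or> R / 2 \<le> dist w y" for z w
  proof -
    have "G z w = u w" using that G(1,2) by blast
    then show ?thesis by (simp add: \<Gamma>_def u_def)
  qed
  have \<Gamma>V': "\<Gamma> z w \<in> model F'" if "w \<in> W" for z w
    using gV'[OF that] G(3)[OF that, of z] by (simp add: \<Gamma>_def model_def mem_Times_iff)
  let ?I = "snd c' ` fst c'"
  obtain T' where T': "open T'" "?I = model F' \<inter> T'"
    using cod.chart_image_openin[OF c(2) cod.open_chart_domain[OF c(2)] subset_refl]
      by (auto simp: openin_open)
  \<comment> \<open>for small \<open>z\<close> the second condition holds on all of
    \<open>?K\<close>\<close>
  define \<Phi>
    where "\<Phi> z x = (if x \<in> ?K \<and>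
      \<Gamma> z (snd c x) \<in> ?I then inv_into (fst c') (snd c') (\<Gamma> z (snd c x)) else
        \<phi> x)" for z x
  have \<Phi>in: "\<Phi> z x \<in> fst c'" "snd c' (\<Phi> z x) = \<Gamma> z (snd c x)"
    if "x \<in> ?K" "\<Gamma> z (snd c x) \<in> ?I" for z x
    using that by (simp_all add: \<Phi>_def inv_into_into f_inv_into_f)
  have \<Phi>out: "\<Phi> z x = \<phi> x" if "x \<notin> ?K" for z x using that by (simp add: \<Phi>_def)
  have \<Phi>0: "\<Phi> 0 x = \<phi> x" for x
  proof (cases "x \<in> ?K")
    case True
    then have x: "x \<in> U" "snd c x \<in> W" using KU by (auto simp: W_def)
    have "\<Gamma> 0 (snd c x) = snd c' (\<phi> x)" using \<Gamma>g[OF x(2)] g[OF x(1)] by simp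
    then show ?thesis using True U(3)[OF x(1)] by (simp add: \<Phi>_def cod.chart_inverse[OF c(2)])
  qed (rule \<Phi>out)
  have proj_\<Gamma>: "fst (\<Gamma> z (snd c x)) = local_proj c' (\<phi> x)" if "x \<in> U" for z x
    using g[OF that] by (simp add: \<Gamma>_def local_proj_def)
  have plaque: "(\<phi> x, \<Phi> z x) \<in> (plaque_rel F')\<^sup>*" for z x
  proof (cases "x \<in> ?K \<and> \<Gamma> z (snd c x) \<in> ?I")
    case True
    then have x: "x \<in> U" using KU by blast
    have "local_proj c' (\<phi> x) = local_proj c' (\<Phi> z x)"
      using proj_\<Gamma>[OF x, of z] \<Phi>in(2)[of x z] True by (simp add: local_proj_def)
    then have "(\<phi> x, \<Phi> z x) \<in> plaque_rel F'"
      using c(2) U(3)[OF x] \<Phi>in(1)[of x z] True unfolding plaque_rel_def by blast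
    then show ?thesis by blast
  qed (auto simp: \<Phi>_def)
  \<comment> \<open>At z = 0 the coordinates are those of \<open>\<phi>\<close> and lie in the open
    image of the chart. The tube lemma over the compact ball extends this to all small z at
    once.\<close>
  have "\<exists>\<delta>>0. \<forall>z. \<bar>z\<bar> < \<delta> \<longrightarrow>
    (\<forall>x\<in>?K. \<Gamma> z (snd c x) \<in> ?I)"
  proof -
    have "openin (top_of_set (UNIV \<times> W)) ((UNIV \<times> W) \<inter> (\<lambda>p. \<Gamma>
      (fst p) (snd p)) -` T')"
      by (rule continuous_openin_preimage_gen[OF C_par_cont[OF \<Gamma>C] T'(1)])
    then have "openin (top_of_set (UNIV \<times> ?V)) ((UNIV \<times> W) \<inter> (\<lambda>p.
      \<Gamma> (fst p) (snd p)) -` T')"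
      using oW openin_trans by blast
    then obtain T
      where T: "open T"
        "(UNIV \<times> W) \<inter> (\<lambda>p. \<Gamma> (fst p) (snd p)) -` T' = (UNIV \<times>
          ?V) \<inter> T"
      unfolding openin_open by blast
    have \<Gamma>T': "\<Gamma> 0 w \<in> T'" if "w \<in> W" for w
    proof -
      from that obtain x where x: "w = snd c x" "x \<in> U" unfolding W_def by (rule imageE)
      then have "\<Gamma> 0 w = snd c' (\<phi> x)" using \<Gamma>g[OF that] g by simp
      then have "\<Gamma> 0 w \<in> ?I" using U(3)[OF x(2)] by simp
      then show ?thesis unfolding T'(2) by simp
    qed
    have "{0} \<times> (cball y R \<inter> ?V) \<subseteq> (UNIV \<times> W) \<inter> (\<lambda>p.
      \<Gamma> (fst p) (snd p)) -` T'"
    proof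
      fix p :: "real \<times> 'q \<times> 'p" assume "p \<in> {0} \<times> (cball y R \<inter> ?V)"
      then have "fst p = 0" "snd p \<in> cball y R \<inter> ?V" by (simp_all add: mem_Times_iff)
      moreover from subsetD[OF ballW this(2)] have "snd p \<in> W" .
      ultimately show "p \<in> (UNIV \<times> W) \<inter> (\<lambda>p. \<Gamma> (fst p) (snd p)) -` T'"
        using \<Gamma>T'[of "snd p"] by (simp add: mem_Times_iff)
    qed
    then have "{0} \<times> (cball y R \<inter> ?V) \<subseteq> T" unfolding T(2) by blast
    moreover have "compact (cball y R \<inter> ?V)"
      by (rule compact_Int_closed[OF compact_cball closed_subspace[OF Vs]])
    ultimately obtain X where X: "0 \<in> X" "open X" "X \<times> (cball y R \<inter> ?V) \<subseteq> T"
      using Elementary_Topology.tube_lemma[of "cball y R \<inter> ?V" T 0] T(1) by blast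
    obtain \<delta> where \<delta>: "\<delta> > 0" "ball 0 \<delta> \<subseteq> X"
      using X open_contains_ball by blast
    have "\<Gamma> z (snd c x) \<in> ?I" if z: "\<bar>z\<bar> < \<delta>" and x: "x \<in> ?K" for z x
    proof -
      have xW: "snd c x \<in> W" using x KU by (auto simp: W_def)
      have "snd c x \<in> cball y R \<inter> ?V" using x xW WV
        by (auto simp: dom.coord_ball_def dist_commute)
      moreover have "z \<in> X" using z \<delta>(2) by (auto simp: dist_norm)
      ultimately have "(z, snd c x) \<in> (UNIV \<times> ?V) \<inter> T" using X(3) by blast
      then have "\<Gamma> z (snd c x) \<in> T'" unfolding T(2)[symmetric] by simp
      then show ?thesis unfolding T'(2) using \<Gamma>V'[OF xW] by simp
    qed
    then show ?thesis using \<delta>(1) by blast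
  qed
  then obtain \<delta>
    where \<delta>: "\<delta> > 0"
      "\<And>z x. \<bar>z\<bar> < \<delta> \<Longrightarrow> x \<in> ?K \<Longrightarrow>
        \<Gamma> z (snd c x) \<in> ?I" by blast
  \<comment> \<open>This holds on all of \<open>U\<close>, not only on \<open>?K\<close>: off
    \<open>?K\<close> the distance exceeds R, so \<open>\<Gamma> z\<close> is the local expression
    of \<open>\<phi>\<close>. Both branches of \<open>\<Phi>\<close> thus share one formula on an
    open set, and no seam has to be examined.\<close>
  have main: "\<Phi> z x \<in> fst c'" "\<Gamma> z (snd c x) = snd c' (\<Phi> z x)"
    if z: "\<bar>z\<bar> < \<delta>" and x: "x \<in> U" for z x
  proof -
    have "\<Phi> z x \<in> fst c' \<and> \<Gamma> z (snd c x) = snd c' (\<Phi> z x)"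
    proof (cases "x \<in> ?K")
      case True
      then show ?thesis using \<Phi>in[OF True \<delta>(2)[OF z True]] by simp
    next
      case False
      have xW: "snd c x \<in> W" using x by (simp add: W_def)
      have "R < dist (snd c x) y" using False x U(2) by (auto simp: dom.coord_ball_def)
      then have "\<Gamma> z (snd c x) = ?g (snd c x)" using R(1) by (intro \<Gamma>g[OF xW]) simp
      then show ?thesis using \<Phi>out[OF False] U(3)[OF x] g[OF x] by simp
    qed
    then show "\<Phi> z x \<in> fst c'" "\<Gamma> z (snd c x) = snd c' (\<Phi> z x)" by blast+
  qed
  have proj: "local_proj c' (\<Phi> z x) = local_proj c' (\<phi> x)"
    if z: "\<bar>z\<bar> < \<delta>" and x: "x \<in> U" for z x
    using main(2)[OF z x] proj_\<Gamma>[OF x, of z] by (simp add: local_proj_def)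
  have fam: "fam_at F F' s \<Phi> 0 x" for x
  proof (cases "x \<in> U")
    case True
    have op: "openin (top_of_set (UNIV \<times> ?V)) (ball (0::real) \<delta> \<times> W)"
      by (intro openin_Times W) simp
    have "C_par ?V s (ball (0::real) \<delta> \<times> W) (\<lambda>z. local_expr c c' (\<Phi> z))"
    proof (rule C_par_cong[OF C_par_mono[OF \<Gamma>C _ order_refl] op Vs])
      fix z w assume "(z, w) \<in> ball (0::real) \<delta> \<times> W"
      then obtain v where v: "\<bar>z\<bar> < \<delta>" "w = snd c v" "v \<in> U"
        by (auto simp: W_def dist_norm)
      then show "\<Gamma> z w = local_expr c c' (\<Phi> z) w"
        using main(2)[OF v(1,3)] U(2) by (simp add: dom.local_expr_chart[OF c(1)] subset_iff)
    qed auto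
    then have "fam_in F F' c c' s \<Phi> 0 x"
      unfolding fam_in_def W_def
      by (intro exI[of _ "ball (0::real) \<delta>"] exI[of _ U] conjI ballI U(1,2) True)
         (use \<delta>(1) main(1) proj in \<open>simp_all add: dist_norm\<close>)
    then show ?thesis using c unfolding fam_at_def by blast
  next
    case False
    then have "x \<in> - ?K" using KU by blast
    from fam_at_const[OF \<phi>(1) oK this] show ?thesis using \<Phi>out by blast
  qed
  \<comment> \<open>The two coordinates may owe their regularity to different sources. In
    \<open>keep\<close> both inherit it from \<open>\<phi>\<close>; in \<open>new\<close> the first
    has it from the transverse regularity of \<open>\<phi>\<close> and the second from the
    mollifier.\<close>
  have smooth: "C_in F F' c c' k (\<Phi> z) x"
    if z: "\<bar>z\<bar> < \<delta>" and N: "open N" "N \<subseteq> U" "x \<in> N"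
      and "C_nat_on ?V k (snd c ` N) (\<lambda>w. fst (?g w))" "C_nat_on ?V k (snd c ` N) (G z)"
    for z k x N
  proof (rule C_inI[OF c(1) N(1,3)])
    have Nc: "N \<subseteq> fst c" using N(2) U(2) by blast
    then show "N \<subseteq> fst c" .
    show "C_nat_on ?V k (snd c ` N) (\<Gamma> z)"
      unfolding \<Gamma>_def[abs_def]
        by (rule C_nat_on_Pair[OF Vs dom.chart_image_openin[OF c(1) N(1) Nc] that(5,6)])
    show "\<Phi> z x \<in> fst c'" "\<Gamma> z (snd c x) = snd c' (\<Phi> z x)" if "x \<in> N" for x
      using main[OF z] that N(2) by blast+
  qed
  have keep: "C_at F F' k (\<Phi> z) x" if z: "0 < z" "z < \<delta>" and k: "enat k \<le> r"
    and C: "C_at F F' k \<phi> x" for z x k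
  proof (cases "x \<in> U")
    case True
    have "C_in F F' c c' k \<phi> x" by (rule C_at_chart[OF C k c]) (use True U in auto)
    then obtain N where N: "open N" "x \<in> N" "N \<subseteq> fst c" "C_nat_on ?V k (snd c ` N) ?g"
      unfolding C_in_def by blast
    have NU: "open (N \<inter> U)" "N \<inter> U \<subseteq> fst c" "x \<in> N \<inter> U"
      using N U True by auto
    note op = dom.chart_image_openin[OF c(1) NU(1,2)]
    have gk: "C_nat_on ?V k (snd c ` (N \<inter> U)) ?g"
      by (rule C_nat_on_mono[OF N(4) dom.chart_image_sub[OF c(1) N(3)] image_mono[OF Int_lower1]
        order_refl])
    have "C_in F F' c c' k (\<Phi> z) x"
    proof (rule smooth[OF _ NU(1) Int_lower2 NU(3) f_of[OF op gk]])
      show "C_nat_on ?V k (snd c ` (N \<inter> U)) (G z)"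
        by (rule G(5)[OF _ _ op u_of[OF op gk]]) (use z in \<open>auto simp: W_def\<close>)
    qed (use z in simp)
    then show ?thesis using c unfolding C_at_def by blast
  next
    case False
    then have "x \<in> - ?K" using KU by blast
    from C_at_cong[OF C oK this] show ?thesis using \<Phi>out by simp
  qed
  have new: "C_at F F' k (\<Phi> z) x"
    if z: "0 < z" "z < \<delta>" and k: "enat k \<le> r"
      and x: "x \<in> fst c" "dist (snd c x) y < R / 4" for z x k
  proof -
    have "x \<in> ?K" using x R(1) by (simp add: dom.coord_ball_def)
    then have xU: "x \<in> U" using KU by blast
    have "trans_in F F' c c' k \<phi> x"
      by (rule trans_at_chart[OF \<phi>(2)[OF k] k cont c x(1) U(3)[OF xU]])
    then obtain N where N: "open N" "x \<in> N" "N \<subseteq> fst c"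
      "C_nat_on ?V k (snd c ` N) (local_proj c' \<circ> \<phi> \<circ> inv_into (fst c) (snd c))"
        unfolding trans_in_def by blast
    let ?B = "{x \<in> fst c. dist (snd c x) y < R / 4}"
    let ?N = "N \<inter> U \<inter> ?B"
    have NU: "open ?N" "?N \<subseteq> U" "?N \<subseteq> fst c" "x \<in> ?N"
      using N U xU x dom.open_coord_ball[OF c(1), of y "R/4"] by (auto simp: open_Int)
    note op = dom.chart_image_openin[OF c(1) NU(1,3)]
    have "C_in F F' c c' k (\<Phi> z) x"
    proof (rule smooth[OF _ NU(1,2,4)])
      have "C_nat_on ?V k (snd c ` ?N) (local_proj c' \<circ> \<phi> \<circ> inv_into (fst c) (snd c))"
        by (rule C_nat_on_mono[OF N(4) dom.chart_image_sub[OF c(1) N(3)] image_mono order_refl]) blast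
      then show "C_nat_on ?V k (snd c ` ?N) (\<lambda>w. fst (?g w))"
        by (simp add: local_proj_def local_expr_def o_def)
      have "openin (top_of_set ?V) (W \<inter> ball y (R / 4))"
        using openin_Int_open[OF W] by blast
      show "C_nat_on ?V k (snd c ` ?N) (G z)"
      proof (rule C_nat_on_mono[OF G(6) _ _ order_refl])
        show "snd c ` ?N \<subseteq> W \<inter> ball y (R / 4)" by (auto simp: W_def dist_commute)
        show "W \<inter> ball y (R / 4) \<subseteq> ?V" using WV by blast
      qed (use z in simp)
    qed (use z in simp)
    then show ?thesis using c unfolding C_at_def by blast
  qed
  \<comment> \<open>The local projection of \<open>\<Phi> z\<close> is that of
    \<open>\<phi>\<close>, so the transverse regularity on which the next correction relies is
    inherited unchanged.\<close>
  have trans: "trans_at F F' k (\<Phi> z) x" if z: "0 < z" "z < \<delta>" and k: "enat k \<le> r" for z x k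
  proof (cases "x \<in> U")
    case True
    have "x \<in> fst c" using True U(2) by blast
    then have "trans_in F F' c c' k \<phi> x"
      by (rule trans_at_chart[OF \<phi>(2)[OF k] k cont c _ U(3)[OF True]])
    then obtain N where N: "open N" "x \<in> N" "N \<subseteq> fst c"
      "C_nat_on ?V k (snd c ` N) (local_proj c' \<circ> \<phi> \<circ> inv_into (fst c) (snd c))"
        unfolding trans_in_def by blast
    have NU: "open (N \<inter> U)" "N \<inter> U \<subseteq> fst c" "x \<in> N \<inter> U"
      using N U True by auto
    have "C_nat_on ?V k (snd c ` (N \<inter> U)) (local_proj c' \<circ> \<Phi> z \<circ> inv_into
      (fst c) (snd c))"
    proof (rule C_nat_on_cong[OF Vs dom.chart_image_openin[OF c(1) NU(1,2)]
          C_nat_on_mono[OF N(4) dom.chart_image_sub[OF c(1) N(3)] image_mono[OF Int_lower1] order_refl]])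
      fix w assume "w \<in> snd c ` (N \<inter> U)"
      then obtain v where v: "w = snd c v" "v \<in> N \<inter> U" by (rule imageE)
      then have "v \<in> fst c" using NU(2) by blast
      then show "(local_proj c' \<circ> \<phi> \<circ> inv_into (fst c) (snd c)) w = (local_proj c'
        \<circ> \<Phi> z \<circ> inv_into (fst c) (snd c)) w"
        using v proj[of z v] z by (simp add: dom.chart_inverse[OF c(1)])
    qed
    moreover have "\<Phi> z ` (N \<inter> U) \<subseteq> fst c'" using main(1)[of z] z by auto
    ultimately have "trans_in F F' c c' k (\<Phi> z) x" unfolding trans_in_def using NU by blast
    then show ?thesis using c unfolding trans_at_def by blast
  next
    case False
    then have "x \<in> - ?K" using KU by blast
    from trans_at_cong[OF \<phi>(2)[OF k] oK this] show ?thesis using \<Phi>out by simp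
  qed
  show ?thesis
    by (intro exI[of _ \<Phi>] exI[of _ \<delta>] conjI allI impI \<delta>(1) \<Phi>0 \<Phi>out fam
      plaque keep new trans) assumption+
qed

end


section \<open>Conditions stable under small plaquewise deformations\<close>

text \<open>The tube lemma, applied to the union of all open sets on which \<open>Q\<close> holds
  over \<open>K\<close>, turns openness at each point of {0} x \<open>K\<close> into a single bound
  on z.\<close>

lemma compact_parameter_nhd:
  fixes K :: "'m::topological_space set" and Q :: "real \<Rightarrow> 'm \<Rightarrow> bool"
  assumes "compact K"
    and "\<And>x0. x0 \<in> K \<Longrightarrow> \<exists>U. open U \<and> (0, x0) \<in> U \<and>
      (\<forall>z x. (z, x) \<in> U \<and> x \<in> K \<longrightarrow> Q z x)"
  shows "\<exists>\<delta>>0. \<forall>z. \<bar>z\<bar> < \<delta> \<longrightarrow>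
    (\<forall>x\<in>K. Q z x)"
proof -
  let ?\<U> = "{U. open U \<and> (\<forall>z x. (z, x) \<in> U \<and> x \<in> K \<longrightarrow> Q z x)}"
  have op: "open (\<Union>?\<U>)" by blast
  have "{0} \<times> K \<subseteq> \<Union>?\<U>"
  proof
    fix p assume "p \<in> {0::real} \<times> K"
    then obtain x0 where x0: "p = (0, x0)" "x0 \<in> K" by blast
    from assms(2)[OF x0(2)] show "p \<in> \<Union>?\<U>" unfolding x0(1) by blast
  qed
  from Elementary_Topology.tube_lemma[OF assms(1) op this]
  obtain X where X: "0 \<in> X" "open X" "X \<times> K \<subseteq> \<Union>?\<U>" by blast
  obtain \<delta> where \<delta>: "\<delta> > 0" "ball 0 \<delta> \<subseteq> X"
    using X open_contains_ball by blast
  have "Q z x" if "\<bar>z\<bar> < \<delta>" "x \<in> K" for z x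
  proof -
    have "z \<in> X" using \<delta>(2) that(1) by (auto simp: dist_norm)
    then have "(z, x) \<in> \<Union>?\<U>" using X(3) that(2) by blast
    then show ?thesis using that(2) by blast
  qed
  then show ?thesis using \<delta>(1) by blast
qed

context foliated_pair begin

text \<open>Besides being stable along plaquewise deformations, a condition on a map may only depend on
  the germ of the map along \<open>K\<close>: it then survives all modifications away from
    \<open>K\<close>.\<close>

definition stable ::
  "nat \<Rightarrow> 'm set \<Rightarrow> (('m \<Rightarrow> 'n) \<Rightarrow> bool) \<Rightarrow> bool"
  where "stable s K P \<longleftrightarrow>
    (\<forall>\<psi> \<psi>' U. open U \<longrightarrow> K \<subseteq> U \<longrightarrow>
      (\<forall>x\<in>U. \<psi> x = \<psi>' x) \<longrightarrow> P \<psi> \<longrightarrow>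
        P \<psi>') \<and>
    (\<forall>\<Phi>. (\<forall>x. fam_at F F' s \<Phi> (0::real) x) \<longrightarrow>
      P (\<Phi> 0) \<longrightarrow>
        (\<exists>\<delta>>0. \<forall>z. \<bar>z\<bar> < \<delta> \<longrightarrow> P (\<Phi> z)))"

lemma fam_at_chart:
  assumes "fam_at F F' k \<Phi> z0 x0" "enat k \<le> r" "d \<in> charts F" "d' \<in> charts F'"
    "x0 \<in> fst d" "\<Phi> z0 x0 \<in> fst d'"
  shows "fam_in F F' d d' k \<Phi> z0 x0"
proof -
  obtain c c' where c: "c \<in> charts F" "c' \<in> charts F'" "fam_in F F' c c' k \<Phi> z0 x0"
    using assms(1) unfolding fam_at_def by blast
  show ?thesis by (rule fam_in_change[OF c(1,2) assms(3,4,2) c(3) assms(5,6)])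
qed

text \<open>A correction over a coordinate ball presupposes that the ball is mapped into a target
  chart. Stability lets this be carried along as one more condition while other balls are being
  corrected.\<close>

lemma stable_maps_into:
  assumes "enat s \<le> r" "compact K" "c' \<in> charts F'"
  shows "stable s K (\<lambda>\<psi>. \<psi> ` K \<subseteq> fst c')"
  unfolding stable_def
proof (intro conjI allI impI)
  fix \<psi> \<psi>' :: "'m \<Rightarrow> 'n"
    and U assume "K \<subseteq> U" "\<forall>x\<in>U. \<psi> x = \<psi>' x" "\<psi> ` K \<subseteq> fst c'"
  then show "\<psi>' ` K \<subseteq> fst c'" by (metis image_cong subset_iff)
next
  fix \<Phi> :: "real \<Rightarrow> 'm \<Rightarrow> 'n" assume \<Phi>:
    "\<forall>x. fam_at F F' s \<Phi> 0 x" "\<Phi> 0 ` K \<subseteq> fst c'"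
  have "\<exists>\<delta>>0. \<forall>z. \<bar>z\<bar> < \<delta> \<longrightarrow>
    (\<forall>x\<in>K. \<Phi> z x \<in> fst c')"
  proof (rule compact_parameter_nhd[OF assms(2)])
    fix x0 assume "x0 \<in> K"
    obtain c where c: "c \<in> charts F" "x0 \<in> fst c" using dom.charts_cover by blast
    have "fam_in F F' c c' s \<Phi> 0 x0"
      by (rule fam_at_chart[OF _ assms(1) c(1) assms(3) c(2)]) (use \<Phi> \<open>x0 \<in> K\<close>
        in auto)
    then obtain Z N
      where "open Z" "open N" "0 \<in> Z" "x0 \<in> N"
        "\<forall>z\<in>Z. \<forall>x\<in>N. \<Phi> z x \<in> fst c'"
      unfolding fam_in_def by blast
    then show "\<exists>U. open U \<and> (0, x0) \<in> U \<and> (\<forall>z x. (z, x) \<in> U \<and>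
      x \<in> K \<longrightarrow> \<Phi> z x \<in> fst c')"
      by (intro exI[of _ "Z \<times> N"]) (simp add: open_Times)
  qed
  then show "\<exists>\<delta>>0. \<forall>z. \<bar>z\<bar> < \<delta> \<longrightarrow>
    \<Phi> z ` K \<subseteq> fst c'" by blast
qed

text \<open>The demand made by a single index of \<open>sp_nbhd\<close>.\<close>

definition sp_condition where
  "sp_condition s \<phi>0 c c' K \<epsilon> \<psi> \<longleftrightarrow>
    \<psi> ` K \<subseteq> fst c' \<and>
     (\<forall>x\<in>K. local_proj c' (\<psi> x) = local_proj c' (\<phi>0 x) \<and>
       (\<forall>k\<le>s. deriv_dist (model F) k (local_expr c c' \<psi>) (local_expr c c' \<phi>0)
         (snd c x) < \<epsilon>))"

text \<open>Along a family the projections stay exactly equal, because \<open>fam_in\<close> is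
  plaquewise in the charts at hand, while the derivative bounds are open conditions of finitely many
  orders. Both therefore hold near each point of \<open>K\<close> for small z, and compactness gives
  a common range of z.\<close>

lemma stable_sp_condition:
  assumes s: "enat s \<le> r" and \<phi>0: "\<And>x. C_at F F' s \<phi>0 x"
    and c: "c \<in> charts F" "c' \<in> charts F'"
      and K: "compact K" "K \<subseteq> fst c" "\<phi>0 ` K \<subseteq> fst c'"
  shows "stable s K (sp_condition s \<phi>0 c c' K \<epsilon>)"
  unfolding stable_def
proof (intro conjI allI impI)
  fix \<psi> \<psi>' :: "'m \<Rightarrow> 'n"
    and U assume U: "open U" "K \<subseteq> U" "\<forall>x\<in>U. \<psi> x = \<psi>' x"
      and P: "sp_condition s \<phi>0 c c' K \<epsilon> \<psi>"
  have KU: "\<psi> x = \<psi>' x" if "x \<in> K" for x using U that by blast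
  have oU: "open (fst c \<inter> U)" "fst c \<inter> U \<subseteq> fst c"
    using U(1) dom.open_chart_domain[OF c(1)] by auto
  have "deriv_dist (model F) k (local_expr c c' \<psi>) (local_expr c c' \<phi>0) (snd c x)
      = deriv_dist (model F) k (local_expr c c' \<psi>') (local_expr c c' \<phi>0) (snd c x)" if "x
        \<in> K" for k x
  proof (rule deriv_dist_cong[OF dom.subspace_model dom.chart_image_openin[OF c(1) oU]])
    fix y assume "y \<in> snd c ` (fst c \<inter> U)"
    then obtain w where w: "y = snd c w" "w \<in> fst c \<inter> U" by (rule imageE)
    then show "local_expr c c' \<psi> y = local_expr c c' \<psi>' y"
      using U(3) by (simp add: dom.local_expr_chart[OF c(1)])
  next
    show "snd c x \<in> snd c ` (fst c \<inter> U)" using that K(2) U(2) by blast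
  qed
  then show "sp_condition s \<phi>0 c c' K \<epsilon> \<psi>'"
    using P KU unfolding sp_condition_def by (simp add: image_subset_iff)
next
  fix \<Phi> :: "real \<Rightarrow> 'm \<Rightarrow> 'n" assume \<Phi>:
    "\<forall>x. fam_at F F' s \<Phi> 0 x" and P: "sp_condition s \<phi>0 c c' K \<epsilon> (\<Phi> 0)"
  let ?Q = "\<lambda>z x. \<Phi> z x \<in> fst c' \<and>
    local_proj c' (\<Phi> z x) = local_proj c' (\<phi>0 x) \<and>
     (\<forall>k\<le>s. deriv_dist (model F) k (local_expr c c' (\<Phi> z)) (local_expr c c'
       \<phi>0) (snd c x) < \<epsilon>)"
  have "\<exists>\<delta>>0. \<forall>z. \<bar>z\<bar> < \<delta> \<longrightarrow>
    (\<forall>x\<in>K. ?Q z x)"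
  proof (rule compact_parameter_nhd[OF K(1)])
    fix x0 assume x0: "x0 \<in> K"
    have "fam_in F F' c c' s \<Phi> 0 x0"
      by (rule fam_at_chart[OF _ s c]) (use \<Phi> P x0 K(2) in \<open>auto simp: sp_condition_def\<close>)
    then obtain Z N where Z: "open Z" "0 \<in> Z" and N: "open N" "x0 \<in> N" "N \<subseteq> fst c"
      and \<Phi>c':
        "\<forall>z\<in>Z. \<forall>x\<in>N. \<Phi> z x \<in> fst c' \<and>
          local_proj c' (\<Phi> z x) = local_proj c' (\<Phi> 0 x)"
      and C: "C_par (model F) s (Z \<times> snd c ` N) (\<lambda>z. local_expr c c' (\<Phi> z))"
      unfolding fam_in_def by blast
    have "C_in F F' c c' s \<phi>0 x0"
      by (rule C_at_chart[OF \<phi>0 s c]) (use x0 K in auto)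
    then obtain N1 where N1: "open N1" "x0 \<in> N1" "N1 \<subseteq> fst c"
      and C1: "C_nat_on (model F) s (snd c ` N1) (local_expr c c' \<phi>0)" unfolding C_in_def by blast
    define M where "M = N \<inter> N1"
    have M: "open M" "x0 \<in> M" "M \<subseteq> fst c" "M \<subseteq> N" using N N1 by (auto simp: M_def)
    have op: "openin (top_of_set (UNIV \<times> model F)) (Z \<times> snd c ` M)"
      by (intro openin_Times dom.chart_image_openin[OF c(1) M(1,3)]) (use Z(1) in simp)
    have CM: "C_par (model F) k (Z \<times> snd c ` M) (\<lambda>z. local_expr c c' (\<Phi> z))"
      if "k \<le> s" for k
      by (rule C_par_mono[OF C _ that]) (use M(4) in blast)
    have CM1: "C_par (model F) k (Z \<times> snd c ` M) (\<lambda>_. local_expr c c' \<phi>0)"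
      if "k \<le> s" for k
    proof (rule C_nat_on_imp_C_par)
      show "C_nat_on (model F) k (snd c ` N1) (local_expr c c' \<phi>0)"
        by (rule C_nat_on_mono[OF C1 dom.chart_image_sub[OF c(1) N1(3)] subset_refl that])
      show "snd c ` N1 \<subseteq> model F" by (rule dom.chart_image_sub[OF c(1) N1(3)])
    qed (auto simp: M_def)
    have p0: "(0, snd c x0) \<in> Z \<times> snd c ` M" using Z(2) M(2) by blast
    let ?N = "\<lambda>k U. open U \<and> (0, snd c x0) \<in> U \<and>
      (\<forall>z y. (z, y) \<in> U \<inter> (Z \<times> snd c ` M) \<longrightarrow>
        deriv_dist (model F) k (local_expr c c' (\<Phi> z)) (local_expr c c' \<phi>0) y < \<epsilon>)"
    have "\<forall>k\<in>{..s}. \<exists>U. ?N k U"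
    proof
      fix k assume k: "k \<in> {..s}"
      then have "deriv_dist (model F) k (local_expr c c' (\<Phi> 0)) (local_expr c c' \<phi>0) (snd
        c x0) < \<epsilon>"
        using P x0 unfolding sp_condition_def by simp
      with k show "\<exists>U. ?N k U"
        by (intro deriv_dist_less_open[OF dom.subspace_model op CM CM1 p0]) simp_all
    qed
    from bchoice[OF this] obtain U where U: "\<forall>k\<in>{..s}. ?N k (U k)" ..
    define T where "T = (\<Inter>k\<in>{..s}. U k)"
    have T: "open T" "(0, snd c x0) \<in> T" using U by (auto simp: T_def intro!: open_INT)
    have "continuous_on (Z \<times> M) (\<lambda>p. (fst p, snd c (snd p)))"
      by (intro continuous_intros continuous_on_compose2[OF continuous_on_subset[OF
        dom.chart_continuous(1)[OF c(1)] M(3)]]) auto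
    then have oT: "open ((Z \<times> M) \<inter> (\<lambda>p. (fst p, snd c (snd p))) -` T)"
      by (rule continuous_open_preimage[OF _ open_Times[OF Z(1) M(1)] T(1)])
    moreover have "(0, x0) \<in> (Z \<times> M) \<inter> (\<lambda>p. (fst p, snd c (snd p))) -` T"
      using T(2) Z(2) M(2) by simp
    moreover have "?Q z x"
      if zx: "(z, x) \<in> (Z \<times> M) \<inter> (\<lambda>p. (fst p, snd c (snd p))) -` T"
        "x \<in> K" for z x
    proof -
      have 1: "z \<in> Z" "x \<in> M" "(z, snd c x) \<in> T" using zx(1) by simp_all
      have 2: "\<Phi> z x \<in> fst c'" "local_proj c' (\<Phi> z x) = local_proj c' (\<Phi> 0 x)"
        using \<Phi>c' 1(1) subsetD[OF M(4) 1(2)] by blast+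
      have 3: "local_proj c' (\<Phi> 0 x) = local_proj c' (\<phi>0 x)" using P zx(2)
        unfolding sp_condition_def by blast
      have 4: "(z, snd c x) \<in> Z \<times> snd c ` M" using 1(1,2) by blast
      have "deriv_dist (model F) k (local_expr c c' (\<Phi> z)) (local_expr c c' \<phi>0) (snd c x)
        < \<epsilon>" if "k \<le> s" for k
      proof -
        have k: "k \<in> {..s}" using that by simp
        then have "(z, snd c x) \<in> U k" using 1(3) unfolding T_def by blast
        with 4 bspec[OF U k] show ?thesis by blast
      qed
      then show ?thesis using 2 3 by simp
    qed
    ultimately show
      "\<exists>U. open U \<and> (0, x0) \<in> U \<and> (\<forall>z x. (z, x) \<in> U \<and>
        x \<in> K \<longrightarrow> ?Q z x)" by blast
  qed
  then obtain \<delta>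
    where "\<delta> > 0"
      "\<And>z x. \<bar>z\<bar> < \<delta> \<Longrightarrow> x \<in> K \<Longrightarrow> ?Q z x" by blast
  then show "\<exists>\<delta>>0. \<forall>z. \<bar>z\<bar> < \<delta> \<longrightarrow>
    sp_condition s \<phi>0 c c' K \<epsilon> (\<Phi> z)"
    unfolding sp_condition_def image_subset_iff by blast
qed

text \<open>Abstracts the indexed data behind \<open>sp_nbhd\<close>. Local finiteness of the
  compact sets ensures that a correction supported in a compact set can disturb only finitely many
  conditions.\<close>

definition admissible ::
  "nat \<Rightarrow> ('m set \<times> (('m \<Rightarrow> 'n) \<Rightarrow> bool)) set \<Rightarrow> bool"
  where "admissible s \<P> \<longleftrightarrow> (\<forall>(K, P)\<in>\<P>. compact K \<and>
    stable s K P) \<and>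
    (\<forall>x. \<exists>N. open N \<and> x \<in> N \<and>
      finite {\<kappa> \<in> \<P>. fst \<kappa> \<inter> N \<noteq> {}})"

text \<open>The invariant of all corrections. Being a foliation map is left out: it is recovered at
  the end from the fact that values move only along leaves of the target.\<close>

definition tame ::
  "nat \<Rightarrow> ('m set \<times> (('m \<Rightarrow> 'n) \<Rightarrow> bool)) set \<Rightarrow>
    ('m \<Rightarrow> 'n) \<Rightarrow> bool"
  where "tame s \<P> \<phi> \<longleftrightarrow> (\<forall>x. C_at F F' s \<phi> x) \<and>
    (\<forall>x k. enat k \<le> r \<longrightarrow> trans_at F F' k \<phi> x) \<and>
      (\<forall>(K, P)\<in>\<P>. P \<phi>)"

text \<open>One finite order at a time, each with its own neighbourhood; this covers infinite r as
  well.\<close>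

definition smooth_at :: "('m \<Rightarrow> 'n) \<Rightarrow> 'm \<Rightarrow> bool"
  where "smooth_at \<phi> x \<longleftrightarrow> (\<forall>k. enat k \<le> r \<longrightarrow>
    C_at F F' k \<phi> x)"

lemma admissible_finite_meet:
  assumes "admissible s \<P>" "compact K"
  shows "finite {\<kappa> \<in> \<P>. fst \<kappa> \<inter> K \<noteq> {}}"
proof -
  have "\<forall>x. \<exists>N. open N \<and> x \<in> N \<and>
    finite {\<kappa> \<in> \<P>. fst \<kappa> \<inter> N \<noteq> {}}" using assms(1) unfolding
      admissible_def by blast
  from choice[OF this] obtain N
    where "\<forall>x. open (N x) \<and> x \<in> N x \<and>
      finite {\<kappa> \<in> \<P>. fst \<kappa> \<inter> N x \<noteq> {}}" ..
  then have N: "open (N x)" "x \<in> N x"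
    "finite {\<kappa> \<in> \<P>. fst \<kappa> \<inter> N x \<noteq> {}}" for x by simp_all
  have "K \<subseteq> (\<Union>x\<in>K. N x)" using N(2) by blast
  from compactE_image[OF assms(2) N(1) this] obtain X
    where X: "X \<subseteq> K" "finite X" "K \<subseteq> (\<Union>x\<in>X. N x)" .
  have "{\<kappa> \<in> \<P>. fst \<kappa> \<inter> K \<noteq> {}} \<subseteq> (\<Union>x\<in>X.
    {\<kappa> \<in> \<P>. fst \<kappa> \<inter> N x \<noteq> {}})" using X(3) by blast
  moreover have
    "finite (\<Union>x\<in>X. {\<kappa> \<in> \<P>. fst \<kappa> \<inter> N x \<noteq> {}})"
      using X(2) N(3) by blast
  ultimately show ?thesis by (rule finite_subset)
qed

lemma admissible_Un:
  assumes "admissible s \<P>" "admissible s \<P>'"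
  shows "admissible s (\<P> \<union> \<P>')"
  unfolding admissible_def
proof
  show "\<forall>(K, P)\<in>\<P> \<union> \<P>'. compact K \<and> stable s K P" using assms
    unfolding admissible_def by blast
  show "\<forall>x. \<exists>N. open N \<and> x \<in> N \<and>
    finite {\<kappa> \<in> \<P> \<union> \<P>'. fst \<kappa> \<inter> N \<noteq> {}}"
  proof
    fix x
    obtain N where N: "open N" "x \<in> N"
      "finite {\<kappa> \<in> \<P>. fst \<kappa> \<inter> N \<noteq> {}}" using assms(1)
        unfolding admissible_def by blast
    obtain N' where N': "open N'" "x \<in> N'"
      "finite {\<kappa> \<in> \<P>'. fst \<kappa> \<inter> N' \<noteq> {}}" using assms(2)
        unfolding admissible_def by blast
    have "{\<kappa> \<in> \<P> \<union> \<P>'. fst \<kappa> \<inter> (N \<inter> N') \<noteq> {}}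
      \<subseteq> {\<kappa> \<in> \<P>. fst \<kappa> \<inter> N \<noteq> {}} \<union> {\<kappa>
        \<in> \<P>'. fst \<kappa> \<inter> N' \<noteq> {}}" by blast
    then have "finite {\<kappa> \<in> \<P> \<union> \<P>'. fst \<kappa> \<inter> (N \<inter> N')
      \<noteq> {}}" using N(3) N'(3) by (meson finite_Un finite_subset)
    then show "\<exists>N. open N \<and> x \<in> N \<and>
      finite {\<kappa> \<in> \<P> \<union> \<P>'. fst \<kappa> \<inter> N \<noteq> {}}" using N N' by blast
  qed
qed

lemma admissible_finite:
  assumes "finite \<P>" "\<And>K P. (K, P) \<in> \<P> \<Longrightarrow> compact K \<and> stable s K P"
  shows "admissible s \<P>"
  unfolding admissible_def
proof
  show "\<forall>(K, P)\<in>\<P>. compact K \<and> stable s K P" using assms(2) by blast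
  have "finite {\<kappa> \<in> \<P>. fst \<kappa> \<inter> N \<noteq> {}}" for N using assms(1) by simp
  then show "\<forall>x. \<exists>N. open N \<and> x \<in> N \<and>
    finite {\<kappa> \<in> \<P>. fst \<kappa> \<inter> N \<noteq> {}}"
    by (intro allI exI[of _ UNIV] conjI open_UNIV UNIV_I)
qed

text \<open>Conditions whose compact set misses the ball see an unchanged germ. Each of the finitely
  many others tolerates a range of z, and a single z below all these bounds gives the new
  map.\<close>

lemma smoothing_step:
  assumes s: "enat s \<le> r" and adm: "admissible s \<P>" and tame: "tame s \<P> \<phi>"
    and c: "c \<in> charts F" "c' \<in> charts F'" and y: "y \<in> model F"
      and R: "R > 0" "cball y R \<inter> model F \<subseteq> snd c ` fst c"
    and K: "\<phi> ` dom.coord_ball c y R \<subseteq> fst c'"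
  shows "\<exists>\<psi>. tame s \<P> \<psi> \<and>
    (\<forall>x. x \<notin> dom.coord_ball c y R \<longrightarrow> \<psi> x = \<phi> x) \<and>
    (\<forall>x. (\<phi> x, \<psi> x) \<in> (plaque_rel F')\<^sup>*) \<and>
      (\<forall>x. smooth_at \<phi> x \<longrightarrow> smooth_at \<psi> x) \<and>
    (\<forall>x\<in>fst c. dist (snd c x) y < R / 4 \<longrightarrow> smooth_at \<psi> x)"
proof -
  let ?K = "dom.coord_ball c y R"
  have \<phi>: "\<forall>x. C_at F F' s \<phi> x"
    "\<forall>x k. enat k \<le> r \<longrightarrow> trans_at F F' k \<phi> x"
    using tame unfolding tame_def by blast+
  obtain \<Phi> :: "real \<Rightarrow> 'm \<Rightarrow> 'n" and \<delta>
    where \<delta>: "\<delta> > 0" and \<Phi>0: "\<forall>x. \<Phi> 0 x = \<phi> x"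
    and out: "\<forall>z x. x \<notin> ?K \<longrightarrow> \<Phi> z x = \<phi> x"
      and fam: "\<forall>x. fam_at F F' s \<Phi> 0 x"
    and plaque: "\<forall>z x. (\<phi> x, \<Phi> z x) \<in> (plaque_rel F')\<^sup>*"
    and smooth: "\<forall>z. 0 < z \<longrightarrow> z < \<delta> \<longrightarrow>
      (\<forall>k x. enat k \<le> r \<longrightarrow>
      (C_at F F' k \<phi> x \<longrightarrow> C_at F F' k (\<Phi> z) x) \<and>
      (x \<in> fst c \<longrightarrow> dist (snd c x) y < R / 4 \<longrightarrow>
        C_at F F' k (\<Phi> z) x) \<and> trans_at F F' k (\<Phi> z) x)"
    using step_family[OF s \<phi> c y R K] by (elim exE conjE) (rule that; assumption)
  have cK: "compact ?K" by (rule dom.compact_coord_ball[OF c(1) R(2)])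
  then have oK: "open (- ?K)" by (simp add: compact_imp_closed open_Compl)
  have "\<Phi> 0 = \<phi>" using \<Phi>0 by (intro ext) simp
  define \<S> where "\<S> = {\<kappa> \<in> \<P>. fst \<kappa> \<inter> ?K \<noteq> {}}"
  have fin: "finite \<S>" unfolding \<S>_def by (rule admissible_finite_meet[OF adm cK])
  have "\<forall>\<kappa>\<in>\<S>. \<exists>\<epsilon>>0. \<forall>z. \<bar>z\<bar> < \<epsilon>
    \<longrightarrow> snd \<kappa> (\<Phi> z)"
  proof
    fix \<kappa> assume "\<kappa> \<in> \<S>"
    then have "\<kappa> \<in> \<P>" by (simp add: \<S>_def)
    then have "stable s (fst \<kappa>) (snd \<kappa>)" "snd \<kappa> \<phi>"
      using adm tame unfolding admissible_def tame_def case_prod_beta by blast+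
    then show "\<exists>\<epsilon>>0. \<forall>z. \<bar>z\<bar> < \<epsilon> \<longrightarrow>
      snd \<kappa> (\<Phi> z)"
      using fam \<open>\<Phi> 0 = \<phi>\<close> unfolding stable_def by blast
  qed
  from bchoice[OF this] obtain \<epsilon>
    where \<epsilon>:
      "\<forall>\<kappa>\<in>\<S>. \<epsilon> \<kappa> > 0 \<and>
        (\<forall>z. \<bar>z\<bar> < \<epsilon> \<kappa> \<longrightarrow> snd \<kappa> (\<Phi> z))" ..
  \<comment> \<open>Inserting \<open>\<delta>\<close> keeps the minimum defined when no condition
    meets the ball. Half of \<open>m\<close> is then strictly below every bound.\<close>
  define m where "m = Min (insert \<delta> (\<epsilon> ` \<S>))"
  have m: "m > 0" "m \<le> \<delta>"
    "\<kappa> \<in> \<S> \<Longrightarrow> m \<le> \<epsilon> \<kappa>" for \<kappa>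
    unfolding m_def using fin \<delta> \<epsilon> by simp_all
  define z where "z = m / 2"
  have z: "0 < z" "z < \<delta>" using m(1,2) by (simp_all add: z_def)
  have zS: "\<bar>z\<bar> < \<epsilon> \<kappa>" if "\<kappa> \<in> \<S>" for \<kappa>
    using m(1) m(3)[OF that] by (simp add: z_def)
  note sm = smooth[rule_format, OF z(1,2)]
  have "snd \<kappa> (\<Phi> z)" if \<kappa>: "\<kappa> \<in> \<P>" for \<kappa>
  proof (cases "\<kappa> \<in> \<S>")
    case True then show ?thesis using \<epsilon> zS by blast
  next
    case False
    then have "fst \<kappa> \<subseteq> - ?K" using \<kappa> by (auto simp: \<S>_def)
    moreover have "stable s (fst \<kappa>) (snd \<kappa>)" "snd \<kappa> \<phi>"
      using adm tame \<kappa> unfolding admissible_def tame_def case_prod_beta by blast+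
    moreover have "\<forall>x\<in>- ?K. \<phi> x = \<Phi> z x" using out by simp
    ultimately show ?thesis using oK unfolding stable_def by blast
  qed
  then have "tame s \<P> (\<Phi> z)" unfolding tame_def case_prod_beta using sm s \<phi>(1) by blast
  moreover have "smooth_at \<phi> x \<longrightarrow> smooth_at (\<Phi> z) x" for x using sm
    unfolding smooth_at_def by blast
  moreover have "smooth_at (\<Phi> z) x" if "x \<in> fst c" "dist (snd c x) y < R / 4" for x
    using sm that unfolding smooth_at_def by blast
  ultimately show ?thesis using out plaque by (intro exI[of _ "\<Phi> z"]) simp
qed

end


section \<open>Globalisation\<close>

context foliated begin

text \<open>Coordinate balls provide compact neighbourhoods, and second countability reduces them to
  a sequence \<open>K (a n)\<close>. Each new set absorbs its predecessor together with the next
  ball. The normalisation \<open>X 0 = {}\<close> means that the first stage of the later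
  construction has nothing to preserve but \<open>E\<close>.\<close>

lemma compact_exhaustion:
  "\<exists>X :: nat \<Rightarrow> 'm set. (\<forall>n. compact (X n) \<and>
    X n \<subseteq> interior (X (Suc n))) \<and> X 0 = {} \<and> (\<Union>n. interior (X n)) = UNIV"
proof -
  have "\<forall>x::'m. \<exists>LK. open (fst LK) \<and> x \<in> fst LK \<and>
    fst LK \<subseteq> snd LK \<and> compact (snd LK)"
  proof
    fix x :: 'm
    obtain c where c: "c \<in> charts F" "x \<in> fst c" using charts_cover by blast
    obtain R where R: "R > 0" "cball (snd c x) R \<inter> model F \<subseteq> snd c ` fst c"
      by (rule small_coord_ball[OF c open_UNIV UNIV_I])
    have "compact (coord_ball c (snd c x) R)" by (rule compact_coord_ball[OF c(1) R(2)])
    moreover have "open {w \<in> fst c. dist (snd c w) (snd c x) < R}" by (rule open_coord_ball[OF c(1)])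
    moreover have "{w \<in> fst c. dist (snd c w) (snd c x) < R} \<subseteq> coord_ball c (snd c x) R"
      unfolding coord_ball_def by (rule Collect_mono) simp
    moreover have "x \<in> {w \<in> fst c. dist (snd c w) (snd c x) < R}" using c(2) R(1) by simp
    ultimately show
      "\<exists>LK. open (fst LK) \<and> x \<in> fst LK \<and> fst LK \<subseteq> snd LK \<and>
        compact (snd LK)"
      by (intro exI[of _ "({w \<in> fst c. dist (snd c w) (snd c x) < R}, coord_ball c (snd c x) R)"]) simp
  qed
  from choice[OF this] obtain LK
    where LK: "\<forall>x::'m. open (fst (LK x)) \<and> x \<in> fst (LK x) \<and>
      fst (LK x) \<subseteq> snd (LK x) \<and> compact (snd (LK x))" ..
  define L where "L x = fst (LK x)" for x
  define K where "K x = snd (LK x)" for x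
  have L: "open (L x)" "x \<in> L x" "L x \<subseteq> K x" "compact (K x)" for x using LK
    by (simp_all add: L_def K_def)
  obtain \<F> where \<F>: "\<F> \<subseteq> range L" "countable \<F>" "\<Union>\<F> = \<Union>(range L)"
    using Lindelof[of "range L"] L(1) by blast
  have ne: "\<F> \<noteq> {}" using \<F>(3) L(2) by blast
  have "\<forall>n. \<exists>x. from_nat_into \<F> n = L x"
    using from_nat_into[OF ne] \<F>(1) by blast
  from choice[OF this] obtain a where a: "\<forall>n. from_nat_into \<F> n = L (a n)" ..
  have cover: "\<exists>n. x \<in> K (a n)" for x
  proof -
    have "x \<in> \<Union>\<F>" unfolding \<F>(3) using L(2) by blast
    then obtain S where S: "S \<in> \<F>" "x \<in> S" by blast
    then obtain n where "S = from_nat_into \<F> n" using from_nat_into_surj[OF \<F>(2)] by metis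
    then show ?thesis using a S(2) L(3) by blast
  qed
  have "\<exists>X. \<forall>n. (compact (X n) \<and> (n = 0 \<longrightarrow> X n = {})) \<and>
    X n \<union> K (a n) \<subseteq> interior (X (Suc n))"
  proof (rule dependent_nat_choice)
    show "\<exists>X :: 'm set. compact X \<and> (0 = 0 \<longrightarrow> X = {})" by blast
    fix X :: "'m set" and n :: nat assume "compact X \<and> (n = 0 \<longrightarrow> X = {})"
    then have cA: "compact (X \<union> K (a n))" using L(4) by blast
    have "X \<union> K (a n) \<subseteq> (\<Union>x\<in>UNIV. L x)" using L(2) by blast
    from compactE_image[OF cA L(1) this] obtain T
      where T: "finite T" "X \<union> K (a n) \<subseteq> (\<Union>x\<in>T. L x)" .
    have "compact (\<Union>x\<in>T. K x)" using T(1) L(4) by blast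
    moreover have "X \<union> K (a n) \<subseteq> interior (\<Union>x\<in>T. K x)"
    proof -
      have "(\<Union>x\<in>T. L x) \<subseteq> interior (\<Union>x\<in>T. K x)"
        by (rule interior_maximal) (use L(1,3) in blast)+
      then show ?thesis using T(2) by blast
    qed
    ultimately show
      "\<exists>Y. (compact Y \<and> (Suc n = 0 \<longrightarrow> Y = {})) \<and>
        X \<union> K (a n) \<subseteq> interior Y" by blast
  qed
  then obtain X
    where X: "\<forall>n. (compact (X n) \<and> (n = 0 \<longrightarrow> X n = {})) \<and>
      X n \<union> K (a n) \<subseteq> interior (X (Suc n))" ..
  have "x \<in> (\<Union>n. interior (X n))" for x
  proof -
    obtain n where "x \<in> K (a n)" using cover by blast
    then have "x \<in> interior (X (Suc n))" using X[rule_format, of n] by blast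
    then show ?thesis by blast
  qed
  then have "(\<Union>n. interior (X n)) = UNIV" by blast
  then show ?thesis using X by (intro exI[of _ X]) simp
qed

end

context foliated_pair begin

text \<open>\<open>C\<close> is covered by finitely many balls of a quarter of the chosen radii,
  because this is where a correction gains regularity; the modification itself spreads over the full
  ball, and \<open>D\<close> collects these balls. They are treated one after another, each
  correction preserving the earlier gains.\<close>

lemma compact_stage:
  assumes s: "enat s \<le> r" and adm: "admissible s \<P>" and tame: "tame s \<P> \<phi>"
    and C: "compact C" "open U" "C \<subseteq> U"
  shows "\<exists>\<psi> D. tame s \<P> \<psi> \<and> closed D \<and> D \<subseteq> U \<and>
    (\<forall>x. x \<notin> D \<longrightarrow> \<psi> x = \<phi> x) \<and>
    (\<forall>x. (\<phi> x, \<psi> x) \<in> (plaque_rel F')\<^sup>*) \<and>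
      (\<forall>x. smooth_at \<phi> x \<longrightarrow> smooth_at \<psi> x) \<and>
        (\<forall>x\<in>C. smooth_at \<psi> x)"
proof -
  have cont: "continuous_on UNIV \<phi>"
    by (rule C_at_imp_continuous[where k=s]) (use tame in \<open>simp add: tame_def\<close>)
  let ?G = "\<lambda>x (c, c', R). c \<in> charts F \<and> c' \<in> charts F' \<and>
    x \<in> fst c \<and> R > 0 \<and>
    cball (snd c x) R \<inter> model F \<subseteq> snd c ` fst c \<and>
      dom.coord_ball c (snd c x) R \<subseteq> U \<inter> \<phi> -` fst c'"
  have "\<forall>x\<in>C. \<exists>t. ?G x t"
  proof
    fix x assume "x \<in> C"
    obtain c where c: "c \<in> charts F" "x \<in> fst c" using dom.charts_cover by blast
    obtain c' where c': "c' \<in> charts F'" "\<phi> x \<in> fst c'" using cod.charts_cover by blast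
    have "open (\<phi> -` fst c')" using cod.open_chart_domain[OF c'(1)] cont by (simp add: open_vimage)
    then have o: "open (U \<inter> \<phi> -` fst c')" using C(2) by (simp add: open_Int)
    have x: "x \<in> U \<inter> \<phi> -` fst c'" using \<open>x \<in> C\<close> C(3) c'(2) by blast
    obtain R where "R > 0" "cball (snd c x) R \<inter> model F \<subseteq> snd c ` fst c"
      "dom.coord_ball c (snd c x) R \<subseteq> U \<inter> \<phi> -` fst c'"
      by (rule dom.small_coord_ball[OF c o x])
    then have "?G x (c, c', R)" using c c'(1) by simp
    then show "\<exists>t. ?G x t" by (rule exI)
  qed
  from bchoice[OF this] obtain t where t: "\<forall>x\<in>C. ?G x (t x)" ..
  define c where "c x = fst (t x)" for x
  define c' where "c' x = fst (snd (t x))" for x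
  define R where "R x = snd (snd (t x))" for x
  have G: "c x \<in> charts F" "c' x \<in> charts F'" "x \<in> fst (c x)" "R x > 0"
    "cball (snd (c x) x) (R x) \<inter> model F \<subseteq> snd (c x) ` fst (c x)"
    "dom.coord_ball (c x) (snd (c x) x) (R x) \<subseteq> U"
      "dom.coord_ball (c x) (snd (c x) x) (R x) \<subseteq> \<phi> -` fst (c' x)"
    if "x \<in> C" for x
    using bspec[OF t that] unfolding c_def c'_def R_def by (simp_all add: case_prod_beta)
  define K where "K x = dom.coord_ball (c x) (snd (c x) x) (R x)" for x
  define L where "L x = {w \<in> fst (c x). dist (snd (c x) w) (snd (c x) x) < R x / 4}" for x
  have L: "open (L x)" "x \<in> L x" if "x \<in> C" for x
  proof -
    show "open (L x)" unfolding L_def by (rule dom.open_coord_ball[OF G(1)[OF that]])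
    show "x \<in> L x" unfolding L_def using G(3,4)[OF that] by simp
  qed
  have cK: "compact (K x)" if "x \<in> C" for x
    unfolding K_def by (rule dom.compact_coord_ball[OF G(1,5)[OF that]])
  have "C \<subseteq> (\<Union>x\<in>C. L x)" using L(2) by blast
  from compactE_image[OF C(1) L(1) this] obtain X
    where X: "X \<subseteq> C" "finite X" "C \<subseteq> (\<Union>x\<in>X. L x)" .
  \<comment> \<open>All balls and target charts are chosen for the initial \<open>\<phi>\<close>.
    Adding the inclusions to the conditions guarantees that each ball is still mapped into its chart
    when its turn comes.\<close>
  define \<P>' where
    "\<P>' = \<P> \<union> (\<lambda>x. (K x, \<lambda>\<psi>. \<psi> ` K x \<subseteq> fst (c' x))) ` X"
  have "admissible s ((\<lambda>x. (K x, \<lambda>\<psi>. \<psi> ` K x \<subseteq> fst (c' x))) ` X)"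
  proof (rule admissible_finite)
    show "finite ((\<lambda>x. (K x, \<lambda>\<psi>. \<psi> ` K x \<subseteq> fst (c' x))) ` X)"
      using X(2) by simp
    fix K' P assume
      "(K', P) \<in> (\<lambda>x. (K x, \<lambda>\<psi>. \<psi> ` K x \<subseteq> fst (c' x))) ` X"
    then obtain x
      where x: "(K', P) = (K x, \<lambda>\<psi>. \<psi> ` K x \<subseteq> fst (c' x))" "x \<in> X"
        by (rule imageE)
    then have xC: "x \<in> C" using X(1) by blast
    show "compact K' \<and> stable s K' P"
      using x(1) cK[OF xC] stable_maps_into[OF s cK[OF xC] G(2)[OF xC]] by simp
  qed
  then have adm': "admissible s \<P>'" unfolding \<P>'_def by (rule admissible_Un[OF adm])
  have tame_iff:
    "tame s \<P>' \<psi> \<longleftrightarrow> tame s \<P> \<psi> \<and>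
      (\<forall>x\<in>X. \<psi> ` K x \<subseteq> fst (c' x))" for \<psi>
    unfolding tame_def \<P>'_def by (simp add: ball_Un conj_assoc)
  have "\<phi> ` K x \<subseteq> fst (c' x)" if "x \<in> X" for x using G(7)[of x] X(1) that
    unfolding K_def by blast
  then have tame': "tame s \<P>' \<phi>" using tame tame_iff by blast
  have "\<exists>\<psi> D. tame s \<P>' \<psi> \<and> closed D \<and> D \<subseteq> U \<and>
    (\<forall>x. x \<notin> D \<longrightarrow> \<psi> x = \<phi> x) \<and>
    (\<forall>x. (\<phi> x, \<psi> x) \<in> (plaque_rel F')\<^sup>*) \<and>
      (\<forall>x. smooth_at \<phi> x \<longrightarrow> smooth_at \<psi> x) \<and>
        (\<forall>x\<in>Y. \<forall>w\<in>L x. smooth_at \<psi> w)"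
    if "Y \<subseteq> X" for Y
  proof -
    have "finite Y" using that X(2) by (rule finite_subset)
    then show ?thesis using that
    proof (induction Y rule: finite_induct)
      case empty
      show ?case by (intro exI[of _ \<phi>] exI[of _ "{}"]) (simp add: tame')
    next
      case (insert x Y)
      then have "Y \<subseteq> X" by simp
      from insert.IH[OF this] obtain \<psi> D
        where \<psi>: "tame s \<P>' \<psi>" "closed D" "D \<subseteq> U"
          "\<forall>x. x \<notin> D \<longrightarrow> \<psi> x = \<phi> x"
        "\<forall>x. (\<phi> x, \<psi> x) \<in> (plaque_rel F')\<^sup>*"
          "\<forall>x. smooth_at \<phi> x \<longrightarrow> smooth_at \<psi> x"
            "\<forall>x\<in>Y. \<forall>w\<in>L x. smooth_at \<psi> w"
        by (elim exE conjE) (rule that; assumption)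
      have xX: "x \<in> X" and xC: "x \<in> C" using insert.prems X(1) by auto
      have \<psi>K: "\<psi> ` dom.coord_ball (c x) (snd (c x) x) (R x) \<subseteq> fst (c' x)"
        using \<psi>(1) xX unfolding tame_iff K_def by blast
      obtain \<psi>'
        where \<psi>': "tame s \<P>' \<psi>'"
          "\<forall>w. w \<notin> dom.coord_ball (c x) (snd (c x) x) (R x) \<longrightarrow>
            \<psi>' w = \<psi> w"
        "\<forall>x. (\<psi> x, \<psi>' x) \<in> (plaque_rel F')\<^sup>*"
          "\<forall>x. smooth_at \<psi> x \<longrightarrow> smooth_at \<psi>' x"
        "\<forall>w\<in>fst (c x). dist (snd (c x) w) (snd (c x) x) < R x / 4 \<longrightarrow>
          smooth_at \<psi>' w"
        using smoothing_step[OF s adm' \<psi>(1) G(1,2)[OF xC] dom.chart_image_subset[OF G(1,3)[OF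
          xC]] G(4,5)[OF xC] \<psi>K]
        by (elim exE conjE) (rule that; assumption)
      show ?case
      proof (intro exI[of _ \<psi>'] exI[of _ "D \<union> K x"] conjI)
        show "tame s \<P>' \<psi>'" by (rule \<psi>'(1))
        show "closed (D \<union> K x)" using \<psi>(2) compact_imp_closed[OF cK[OF xC]] by blast
        show "D \<union> K x \<subseteq> U" using \<psi>(3) G(6)[OF xC] unfolding K_def by blast
        show "\<forall>w. w \<notin> D \<union> K x \<longrightarrow> \<psi>' w = \<phi> w"
          using \<psi>(4) \<psi>'(2) unfolding K_def by simp
        show "\<forall>x. (\<phi> x, \<psi>' x) \<in> (plaque_rel F')\<^sup>*"
          by (intro allI) (rule rtrancl_trans[OF \<psi>(5)[rule_format] \<psi>'(3)[rule_format]])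
        show "\<forall>x. smooth_at \<phi> x \<longrightarrow> smooth_at \<psi>' x"
          using \<psi>(6) \<psi>'(4) by blast
        show "\<forall>y\<in>insert x Y. \<forall>w\<in>L y. smooth_at \<psi>' w"
        proof (intro ballI)
          fix y w assume y: "y \<in> insert x Y" and w: "w \<in> L y"
          show "smooth_at \<psi>' w"
          proof (cases "y \<in> Y")
            case True then show ?thesis using w \<psi>(7) \<psi>'(4) by blast
          next
            case False
            then have "y = x" using y by blast
            then show ?thesis using w \<psi>'(5) unfolding L_def by blast
          qed
        qed
      qed
    qed
  qed
  from this[OF subset_refl] obtain \<psi> D
    where \<psi>: "tame s \<P>' \<psi>" "closed D" "D \<subseteq> U"
      "\<forall>x. x \<notin> D \<longrightarrow> \<psi> x = \<phi> x"
    "\<forall>x. (\<phi> x, \<psi> x) \<in> (plaque_rel F')\<^sup>*"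
      "\<forall>x. smooth_at \<phi> x \<longrightarrow> smooth_at \<psi> x"
        "\<forall>x\<in>X. \<forall>w\<in>L x. smooth_at \<psi> w"
    by (elim exE conjE) (rule that; assumption)
  have "\<forall>x\<in>C. smooth_at \<psi> x" using \<psi>(7) X(3) by blast
  then show ?thesis using \<psi> tame_iff by blast
qed

lemma smooth_at_cong:
  assumes "smooth_at \<phi> x" "open U" "x \<in> U"
    "\<And>y. y \<in> U \<Longrightarrow> \<phi> y = \<psi> y"
  shows "smooth_at \<psi> x"
  unfolding smooth_at_def
proof (intro allI impI)
  fix k assume "enat k \<le> r"
  then have "C_at F F' k \<phi> x" using assms(1) unfolding smooth_at_def by blast
  then show "C_at F F' k \<psi> x" by (rule C_at_cong[OF _ assms(2-4)])
qed

text \<open>Stage n treats the compact shell between \<open>X n\<close> and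
  \<open>X (Suc n)\<close>, except in \<open>N\<close>, and changes nothing on
  \<open>X (n - 1)\<close> or on \<open>E\<close>. The stages are thus locally constant from some
  index on, and the limit inherits whatever is determined by germs along compact sets.\<close>

lemma global_smoothing:
  assumes s: "enat s \<le> r" and adm: "admissible s \<P>" and tame: "tame s \<P> \<phi>"
    and E: "closed E" "open N" "E \<subseteq> N" "\<forall>x\<in>N. smooth_at \<phi> x"
  shows "\<exists>\<psi>. tame s \<P> \<psi> \<and> (\<forall>x. smooth_at \<psi> x) \<and>
    (\<forall>x. (\<phi> x, \<psi> x) \<in> (plaque_rel F')\<^sup>*) \<and>
    (\<exists>N'. open N' \<and> E \<subseteq> N' \<and> (\<forall>x\<in>N'. \<psi> x = \<phi> x))"
proof -
  obtain X :: "nat \<Rightarrow> 'm set"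
    where X: "\<forall>n. compact (X n) \<and> X n \<subseteq> interior (X (Suc n))" "X 0 = {}"
      "(\<Union>n. interior (X n)) = UNIV"
    using dom.compact_exhaustion by (elim exE conjE) (rule that; assumption)
  have cX: "compact (X n)" and XS: "X n \<subseteq> interior (X (Suc n))" for n using X(1) by blast+
  have mono: "X k \<subseteq> X m" if "k \<le> m" for k m
    by (rule lift_Suc_mono_le[of X, OF _ that]) (use XS interior_subset in blast)
  let ?P = "\<lambda>n (f :: ('m \<Rightarrow> 'n) \<times> 'm set). tame s \<P> (fst f) \<and>
    (\<forall>x. (\<phi> x, fst f x) \<in> (plaque_rel F')\<^sup>*) \<and>
    (\<forall>x. smooth_at \<phi> x \<longrightarrow> smooth_at (fst f) x) \<and>
      (n = 0 \<longrightarrow> fst f = \<phi>)"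
  \<comment> \<open>stage \<open>n\<close> leaves \<open>X (n - 1)\<close> untouched,
    where \<open>X (0 - 1) = X 0 = {}\<close> by truncation\<close>
  let ?Q = "\<lambda>n (f :: ('m \<Rightarrow> 'n) \<times> 'm set) (g :: ('m \<Rightarrow> 'n)
    \<times> 'm set). closed (snd g) \<and> snd g \<subseteq> - X (n - 1) \<inter> - E \<and>
      (\<forall>x. x \<notin> snd g \<longrightarrow> fst g x = fst f x) \<and>
    (\<forall>x. smooth_at (fst f) x \<longrightarrow> smooth_at (fst g) x) \<and>
      (\<forall>x\<in>X (Suc n) - interior (X n) - N. smooth_at (fst g) x)"
  have "\<exists>f. \<forall>n. ?P n (f n) \<and> ?Q n (f n) (f (Suc n))"
  proof (rule dependent_nat_choice)
    show "\<exists>f. ?P 0 f" by (intro exI[of _ "(\<phi>, {})"]) (simp add: tame)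
    fix f :: "('m \<Rightarrow> 'n) \<times> 'm set" and n :: nat assume f: "?P n f"
    have 1: "compact (X (Suc n) - interior (X n) - N)"
      by (intro compact_diff cX open_interior E(2))
    have 2: "open (- X (n - 1) \<inter> - E)"
      using compact_imp_closed[OF cX] E(1) by (simp add: open_Compl open_Int)
    \<comment> \<open>The shell omits the interior of \<open>X n\<close>, hence
      \<open>X (n - 1)\<close>, and it omits \<open>N\<close>, hence \<open>E\<close>; so it lies in
      the open set where changes are allowed.\<close>
    have "X (n - 1) \<subseteq> interior (X n)" using X(2) XS[of "n - 1"] by (cases n) auto
    then have 3: "X (Suc n) - interior (X n) - N \<subseteq> - X (n - 1) \<inter> - E" using E(3) by blast
    have f': "tame s \<P> (fst f)" "\<forall>x. (\<phi> x, fst f x) \<in> (plaque_rel F')\<^sup>*"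
      "\<forall>x. smooth_at \<phi> x \<longrightarrow> smooth_at (fst f) x"
      using f by - (elim conjE, assumption)+
    from compact_stage[OF s adm f'(1) 1 2 3] obtain \<psi> D
      where \<psi>: "tame s \<P> \<psi>" "closed D" "D \<subseteq> - X (n - 1) \<inter> - E"
      "\<forall>x. x \<notin> D \<longrightarrow> \<psi> x = fst f x"
        "\<forall>x. (fst f x, \<psi> x) \<in> (plaque_rel F')\<^sup>*"
      "\<forall>x. smooth_at (fst f) x \<longrightarrow> smooth_at \<psi> x"
        "\<forall>x\<in>X (Suc n) - interior (X n) - N. smooth_at \<psi> x"
      by (elim exE conjE) (rule that; assumption)
    have "\<forall>x. (\<phi> x, \<psi> x) \<in> (plaque_rel F')\<^sup>*"
      by (intro allI) (rule rtrancl_trans[OF f'(2)[rule_format] \<psi>(5)[rule_format]])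
    moreover have "\<forall>x. smooth_at \<phi> x \<longrightarrow> smooth_at \<psi> x"
      using f'(3) \<psi>(6) by blast
    ultimately have "?P (Suc n) (\<psi>, D)" using \<psi>(1) by simp
    moreover have "?Q n f (\<psi>, D)" unfolding fst_conv snd_conv by (intro conjI \<psi>(2-4,6,7))
    ultimately have "?P (Suc n) (\<psi>, D) \<and> ?Q n f (\<psi>, D)" by (rule conjI)
    then show "\<exists>g. ?P (Suc n) g \<and> ?Q n f g" by (rule exI)
  qed
  then obtain f where f: "\<forall>n. ?P n (f n) \<and> ?Q n (f n) (f (Suc n))" ..
  define \<phi>s where "\<phi>s n = fst (f n)" for n
  define D where "D n = snd (f (Suc n))" for n
  have fP: "?P n (f n)" and fQ: "?Q n (f n) (f (Suc n))" for n
    by (rule conjunct1[OF spec[OF f]], rule conjunct2[OF spec[OF f]])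
  have P1: "tame s \<P> (\<phi>s n)"
    and P2: "\<forall>x. (\<phi> x, \<phi>s n x) \<in> (plaque_rel F')\<^sup>*"
    and P3: "\<forall>x. smooth_at \<phi> x \<longrightarrow> smooth_at (\<phi>s n) x" for n
    using fP[of n] unfolding \<phi>s_def by - (elim conjE, assumption)+
  note P = P1 P2[rule_format] P3[rule_format]
  have \<phi>s0: "\<phi>s 0 = \<phi>" using fP[of 0] unfolding \<phi>s_def by simp
  have D1: "closed (D n)" and D2: "D n \<subseteq> - X (n - 1) \<inter> - E"
    and eq': "\<forall>x. x \<notin> D n \<longrightarrow> \<phi>s (Suc n) x = \<phi>s n x"
    and keep': "\<forall>x. smooth_at (\<phi>s n) x \<longrightarrow> smooth_at (\<phi>s (Suc n)) x"
    and new': "\<forall>x\<in>X (Suc n) - interior (X n) - N. smooth_at (\<phi>s (Suc n)) x" for n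
    using fQ[of n] unfolding \<phi>s_def D_def by - (elim conjE, assumption)+
  note eq = eq'[rule_format] and keep = keep'[rule_format] and new = new'[rule_format]
  have D: "closed (D n)" "D n \<subseteq> - X (n - 1)" "D n \<subseteq> - E" for n using D1 D2[of n]
    by blast+
  \<comment> \<open>Stage m alters no point of \<open>X (m - 1)\<close>, so a point of
    \<open>X k\<close> is fixed as soon as k \<le> m - 1: its final value is reached at index k +
    1.\<close>
  have stab: "\<phi>s m x = \<phi>s (Suc k) x" if x: "x \<in> X k" and m: "Suc k \<le> m" for x k m
    using m
  proof (induction m rule: dec_induct)
    case (step m)
    then have "k \<le> m - 1" by linarith
    then have "x \<in> X (m - 1)" using mono x by blast
    then have "x \<notin> D m" using D(2) by blast
    then show ?case using eq step by simp
  qed simp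
  have keeps: "smooth_at (\<phi>s m) x" if "smooth_at (\<phi>s n) x" "n \<le> m" for n m x
    using that(2,1) by (induction m rule: dec_induct) (simp_all add: keep)
  \<comment> \<open>The least index is just a definite choice. By \<open>stab\<close> every
    \<open>k\<close> with \<open>x\<close> in \<open>X k\<close> gives the same value, so on each
    open set \<open>interior (X k)\<close> the limit is one of the stages.\<close>
  define \<psi> where "\<psi> x = \<phi>s (Suc (LEAST k. x \<in> X k)) x" for x
  have \<psi>: "\<psi> x = \<phi>s (Suc k) x" if "x \<in> X k" for x k
  proof -
    have "x \<in> X (LEAST k. x \<in> X k)" by (rule LeastI[of "\<lambda>k. x \<in> X k", OF that])
    moreover have "(LEAST k. x \<in> X k) \<le> k" by (rule Least_le[of "\<lambda>k. x \<in> X k", OF that])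
    ultimately show ?thesis unfolding \<psi>_def using stab[of x "LEAST k. x \<in> X k" "Suc k"] by simp
  qed
  have \<psi>int: "\<phi>s (Suc k) x = \<psi> x" if "x \<in> interior (X k)" for x k
    using \<psi> that interior_subset by fastforce
  have in_int: "\<exists>k. x \<in> interior (X k)" for x using X(3) by blast
  have smooth: "smooth_at \<psi> x" for x
  proof -
    obtain k where k: "x \<in> interior (X k)" "0 < k"
      using in_int[of x] X(2) by (metis empty_iff interior_empty neq0_conv)
    have "smooth_at (\<phi>s (Suc k)) x"
    proof (cases "x \<in> N")
      case True then show ?thesis using E(4) P(3) by blast
    next
      case False
      have xk: "x \<in> X k" using k(1) interior_subset by blast
      \<comment> \<open>By minimality of l the point lies in the shell treated at stage l - 1. It
        has therefore become smooth at index l, and later stages keep this.\<close>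
      define l where "l = (LEAST k. x \<in> X k)"
      have l: "x \<in> X l" "l \<le> k" unfolding l_def
        by (rule LeastI[of "\<lambda>k. x \<in> X k", OF xk], rule Least_le[of
          "\<lambda>k. x \<in> X k", OF xk])
      obtain n where n: "l = Suc n" using l(1) X(2) by (cases l) auto
      have "x \<notin> X n" using not_less_Least[of n "\<lambda>k. x \<in> X k"] n unfolding l_def by simp
      then have "x \<in> X (Suc n) - interior (X n) - N" using l(1) n False interior_subset by blast
      from new[OF this] show ?thesis by (rule keeps) (use l(2) n in simp)
    qed
    then show ?thesis by (rule smooth_at_cong[OF _ open_interior k(1)]) (rule \<psi>int)
  qed
  have "C_at F F' s \<psi> x" for x using smooth s unfolding smooth_at_def by blast
  moreover have "trans_at F F' k \<psi> x" if "enat k \<le> r" for k x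
    using smooth that C_at_imp_trans_at unfolding smooth_at_def by blast
  moreover have "P \<psi>" if KP: "(K, P) \<in> \<P>" for K P
  proof -
    \<comment> \<open>\<open>K\<close> lies in a single \<open>interior (X n)\<close>, where
      \<open>\<psi>\<close> coincides with one of the stages. That stage satisfies \<open>P\<close>,
      and the germ clause of \<open>stable\<close> passes \<open>P\<close> on to
      \<open>\<psi>\<close>.\<close>
    have K: "compact K" "stable s K P" using adm KP unfolding admissible_def by blast+
    have "K \<subseteq> (\<Union>n\<in>UNIV. interior (X n))" using X(3) by blast
    from compactE_image[OF K(1) open_interior this] obtain T
      where T: "finite T" "K \<subseteq> (\<Union>n\<in>T. interior (X n))" .
    have "interior (X n) \<subseteq> interior (X (Max (insert 0 T)))" if "n \<in> T" for n
      by (intro interior_mono mono) (use T(1) that in simp)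
    then have "K \<subseteq> interior (X (Max (insert 0 T)))" using T(2) by blast
    moreover have "P (\<phi>s (Suc (Max (insert 0 T))))" using P(1) KP unfolding tame_def by blast
    ultimately show ?thesis using K(2) \<psi>int open_interior unfolding stable_def by blast
  qed
  ultimately have "tame s \<P> \<psi>" unfolding tame_def by blast
  moreover have "(\<phi> x, \<psi> x) \<in> (plaque_rel F')\<^sup>*" for x unfolding \<psi>_def
    by (rule P(2))
  moreover have
    "\<exists>N'. open N' \<and> E \<subseteq> N' \<and> (\<forall>x\<in>N'. \<psi> x = \<phi> x)"
  \<comment> \<open>Within \<open>interior (X k)\<close> the limit is stage k + 1, so only the sets
    \<open>D m\<close> with m \<le> k can make it differ from \<open>\<phi>\<close>. Their union is
    finite, hence closed, and it misses \<open>E\<close>.\<close>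
  proof (intro exI[of _ "\<Union>k. interior (X k) - (\<Union>m\<le>k. D m)"] conjI ballI)
    show "open (\<Union>k. interior (X k) - (\<Union>m\<le>k. D m))"
      by (intro open_UN ballI open_Diff open_interior closed_UN D(1)) simp
    show "E \<subseteq> (\<Union>k. interior (X k) - (\<Union>m\<le>k. D m))"
    proof
      fix x assume "x \<in> E"
      then have "x \<notin> D m" for m using D(3) by blast
      moreover obtain k where "x \<in> interior (X k)" using in_int by blast
      ultimately have "x \<in> interior (X k) - (\<Union>m\<le>k. D m)" by simp
      then show "x \<in> (\<Union>k. interior (X k) - (\<Union>m\<le>k. D m))" by (rule UN_I[OF UNIV_I])
    qed
    fix x assume "x \<in> (\<Union>k. interior (X k) - (\<Union>m\<le>k. D m))"
    then obtain k where "x \<in> interior (X k) - (\<Union>m\<le>k. D m)" by (rule UN_E)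
    then have k: "x \<in> interior (X k)" "x \<notin> D m" if "m \<le> k" for m using that by auto
    have "\<phi>s m x = \<phi> x" if "m \<le> Suc k" for m
      using that by (induction m) (simp_all add: \<phi>s0 eq k(2))
    then show "\<psi> x = \<phi> x" using \<psi>int[OF k(1)[OF order_refl]] by simp
  qed
  ultimately show ?thesis using smooth by blast
qed

section \<open>From neighbourhoods in the strong plaquewise topology to conditions\<close>

lemma foliation_map_plaque:
  assumes "foliation_map F F' \<phi>" "\<And>x. (\<phi> x, \<psi> x) \<in> (plaque_rel F')\<^sup>*"
  shows "foliation_map F F' \<psi>"
  unfolding foliation_map_def
proof
  fix L assume "L \<in> leaves F"
  then obtain L' where L': "L' \<in> leaves F'" "\<phi> ` L \<subseteq> L'" using assms(1)
    unfolding foliation_map_def by blast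
  then obtain w where w: "L' = (plaque_rel F')\<^sup>* `` {w}" unfolding leaves_def quotient_def by blast
  have "\<psi> ` L \<subseteq> L'"
  proof (rule image_subsetI)
    fix x assume "x \<in> L"
    then have "(w, \<phi> x) \<in> (plaque_rel F')\<^sup>*" using L'(2) w by blast
    from rtrancl_trans[OF this assms(2)] show "\<psi> x \<in> L'" unfolding w by simp
  qed
  then show "\<exists>L'\<in>leaves F'. \<psi> ` L \<subseteq> L'" using L'(1) by blast
qed

text \<open>Different indices may yield the same pair, which only makes the collection smaller.
  Local finiteness passes from the chart domains to the compact sets inside them.\<close>

lemma sp_base_conditions:
  assumes s: "enat s \<le> r" and b: "b \<in> sp_base s F F'"
  shows "\<exists>\<P>. admissible s \<P> \<and>
    (\<forall>\<psi>. \<psi> \<in> b \<longleftrightarrow> \<psi> \<in> C_fol (enat s) F F' \<and>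
      (\<forall>(K, P)\<in>\<P>. P \<psi>))"
proof -
  obtain \<phi>0 I \<Theta> \<Theta>' K \<epsilon>
    where beq: "b = sp_nbhd s F F' \<phi>0 (I :: nat set) \<Theta> \<Theta>' K \<epsilon>"
    and \<phi>0: "\<phi>0 \<in> C_fol (enat s) F F'"
      and lf: "locally_finite_family I (\<lambda>i. fst (\<Theta> i))"
    and ch: "\<forall>i\<in>I. \<Theta> i \<in> charts F \<and> \<Theta>' i \<in> charts F' \<and>
          compact (K i) \<and> K i \<subseteq> fst (\<Theta> i) \<and>
            \<phi>0 ` K i \<subseteq> fst (\<Theta>' i) \<and> \<epsilon> i > 0"
    using b unfolding sp_base_def mem_Collect_eq by (elim exE conjE) (rule that; assumption)
  have \<phi>0C: "C_at F F' s \<phi>0 x" for x using \<phi>0 C_fol_enat_iff[OF s] by blast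
  let ?c = "\<lambda>i. (K i, sp_condition s \<phi>0 (\<Theta> i) (\<Theta>' i) (K i) (\<epsilon> i))"
  have "admissible s (?c ` I)"
    unfolding admissible_def
  proof
    show "\<forall>(K, P)\<in>?c ` I. compact K \<and> stable s K P"
      using ch stable_sp_condition[OF s \<phi>0C] by auto
    show "\<forall>x. \<exists>N. open N \<and> x \<in> N \<and>
      finite {\<kappa> \<in> ?c ` I. fst \<kappa> \<inter> N \<noteq> {}}"
    proof
      fix x
      obtain N where N: "open N" "x \<in> N" "finite {i \<in> I. fst (\<Theta> i) \<inter> N \<noteq> {}}"
        using lf unfolding locally_finite_family_def by blast
      have "{\<kappa> \<in> ?c ` I. fst \<kappa> \<inter> N \<noteq> {}} \<subseteq> ?c ` {i \<in>
        I. fst (\<Theta> i) \<inter> N \<noteq> {}}"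
      proof
        fix \<kappa> assume "\<kappa> \<in> {\<kappa> \<in> ?c ` I. fst \<kappa> \<inter> N \<noteq> {}}"
        then have \<kappa>: "\<kappa> \<in> ?c ` I" "fst \<kappa> \<inter> N \<noteq> {}" by simp_all
        from \<kappa>(1) obtain i where i: "\<kappa> = ?c i" "i \<in> I" by (rule imageE)
        then have "K i \<inter> N \<noteq> {}" using \<kappa>(2) by simp
        then have "fst (\<Theta> i) \<inter> N \<noteq> {}" using ch i(2) by blast
        then show "\<kappa> \<in> ?c ` {i \<in> I. fst (\<Theta> i) \<inter> N \<noteq> {}}" using i by simp
      qed
      then have "finite {\<kappa> \<in> ?c ` I. fst \<kappa> \<inter> N \<noteq> {}}"
        by (rule finite_subset) (use N(3) in simp)
      then show "\<exists>N. open N \<and> x \<in> N \<and>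
        finite {\<kappa> \<in> ?c ` I. fst \<kappa> \<inter> N \<noteq> {}}" using N(1,2) by blast
    qed
  qed
  moreover have
    "\<psi> \<in> b \<longleftrightarrow> \<psi> \<in> C_fol (enat s) F F' \<and>
      (\<forall>(K, P)\<in>?c ` I. P \<psi>)" for \<psi>
    unfolding beq sp_nbhd_def sp_condition_def by simp
  ultimately show ?thesis by (intro exI[of _ "?c ` I"] conjI allI)
qed

text \<open>The intersection of the empty family is the whole function type, so membership is
  compared only within \<open>C_fol (enat s) F F'\<close>.\<close>

lemma finite_sp_base_conditions:
  assumes s: "enat s \<le> r" and "finite \<B>" "\<B> \<subseteq> sp_base s F F'"
  shows "\<exists>\<P>. admissible s \<P> \<and>
    (\<forall>\<psi>\<in>C_fol (enat s) F F'. \<psi> \<in> \<Inter>\<B> \<longleftrightarrow>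
      (\<forall>(K, P)\<in>\<P>. P \<psi>))"
  using assms(2,3)
proof (induction \<B> rule: finite_induct)
  case empty
  have "admissible s {}" by (rule admissible_finite) auto
  then show ?case by (intro exI[of _ "{}"]) simp
next
  case (insert b \<B>)
  obtain \<P> where \<P>: "admissible s \<P>"
    "\<forall>\<psi>\<in>C_fol (enat s) F F'. \<psi> \<in> \<Inter>\<B> \<longleftrightarrow>
      (\<forall>(K, P)\<in>\<P>. P \<psi>)"
    using insert by auto
  have "b \<in> sp_base s F F'" using insert.prems by blast
  from sp_base_conditions[OF s this] obtain \<P>' where \<P>': "admissible s \<P>'"
    "\<forall>\<psi>. \<psi> \<in> b \<longleftrightarrow> \<psi> \<in> C_fol (enat s) F F' \<and>
      (\<forall>(K, P)\<in>\<P>'. P \<psi>)" by blast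
  have "admissible s (\<P> \<union> \<P>')" by (rule admissible_Un[OF \<P>(1) \<P>'(1)])
  moreover have
    "\<forall>\<psi>\<in>C_fol (enat s) F F'. \<psi> \<in> \<Inter>(insert b \<B>)
      \<longleftrightarrow> (\<forall>(K, P)\<in>\<P> \<union> \<P>'. P \<psi>)"
    using \<P>(2) \<P>'(2) by (simp add: ball_Un) blast
  ultimately show ?case by blast
qed

end

text \<open>\<open>sp_topology\<close> is generated by \<open>sp_base\<close> as by a subbase, so an
  open set is exploited through a finite intersection of basic sets around the given map. These sets
  may be centred at other maps.\<close>

lemma generate_topology_on_finite_Inter:
  assumes "generate_topology_on \<S> U" "x \<in> U"
  shows "\<exists>\<B>. finite \<B> \<and> \<B> \<subseteq> \<S> \<and> x \<in> \<Inter>\<B> \<and>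
    \<B> \<noteq> {} \<and> \<Inter>\<B> \<subseteq> U"
  using assms
proof (induction rule: generate_topology_on.induct)
  case (Int a b)
  then obtain \<B> \<B>'
    where "finite \<B>" "\<B> \<subseteq> \<S>" "x \<in> \<Inter>\<B>" "\<B> \<noteq> {}"
      "\<Inter>\<B> \<subseteq> a"
    "finite \<B>'" "\<B>' \<subseteq> \<S>" "x \<in> \<Inter>\<B>'" "\<Inter>\<B>' \<subseteq> b"
      by (metis IntD1 IntD2)
  then show ?case by (intro exI[of _ "\<B> \<union> \<B>'"]) auto
next
  case (UN \<K>)
  then obtain k where k: "k \<in> \<K>" "x \<in> k" by blast
  from UN.IH[OF this] show ?case using k(1) by (meson Sup_upper order_trans)
next
  case (Basis b)
  then show ?case by (intro exI[of _ "{b}"]) auto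
qed simp

theorem theorem4p3:
  fixes r :: enat and s :: nat and p q p' q' :: nat
    and F :: "('m::{t2_space, second_countable_topology}, 'q::euclidean_space, 'p::euclidean_space) fol"
    and F' :: "('n::{t2_space, second_countable_topology}, 'u::euclidean_space, 'v::euclidean_space) fol"
  assumes "enat s < r"
    and "foliation r p q F"
    and "foliation r p' q' F'"
  shows "(\<forall>\<phi> \<in> C2_fol r (enat s) F F'. \<forall>E. closed E \<longrightarrow>
           (\<exists>N. open N \<and> E \<subseteq> N \<and> C_map_on r N F F' \<phi>) \<longrightarrow>
           (\<forall>\<N>. \<phi> \<in> (C2_fol_SP r s F F') interior_of \<N> \<longrightarrow>
             (\<exists>\<psi> \<in> C_fol r F F'. \<psi> \<in> \<N> \<and>
                (\<exists>N'. open N' \<and> E \<subseteq> N' \<and> (\<forall>x\<in>N'. \<psi> x = \<phi> x)))))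
       \<and> (C2_fol_SP r s F F') closure_of (C_fol r F F') = C2_fol r (enat s) F F'"
proof -
  interpret foliated_pair F F' r p q p' q'
    by (intro foliated_pair.intro foliated.intro assms)
  have s: "enat s \<le> r" using assms(1) by simp
  have main: "\<exists>\<psi>\<in>C_fol r F F'. \<psi> \<in> \<N> \<and>
    (\<exists>N'. open N' \<and> E \<subseteq> N' \<and> (\<forall>x\<in>N'. \<psi> x = \<phi> x))"
    if \<phi>: "\<phi> \<in> C2_fol r (enat s) F F'"
      and E: "closed E" "open N" "E \<subseteq> N" "C_map_on r N F F' \<phi>"
      and \<N>: "\<phi> \<in> (C2_fol_SP r s F F') interior_of \<N>" for \<phi> E N \<N>
  proof -
    obtain T where T: "openin (C2_fol_SP r s F F') T" "\<phi> \<in> T" "T \<subseteq> \<N>"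
      using \<N> unfolding interior_of_def by blast
    then obtain S where S: "openin (sp_topology s F F') S" "T = S \<inter> C2_fol r (enat s) F F'"
      unfolding C2_fol_SP_def openin_subtopology by blast
    have "generate_topology_on (sp_base s F F') S"
      using S(1) unfolding sp_topology_def openin_topology_generated_by_iff .
    moreover have "\<phi> \<in> S" using T(2) S(2) by blast
    ultimately have
      "\<exists>\<B>. finite \<B> \<and> \<B> \<subseteq> sp_base s F F' \<and>
        \<phi> \<in> \<Inter>\<B> \<and> \<B> \<noteq> {} \<and> \<Inter>\<B> \<subseteq> S"
      by (rule generate_topology_on_finite_Inter)
    then obtain \<B>
      where \<B>: "finite \<B>" "\<B> \<subseteq> sp_base s F F'" "\<phi> \<in> \<Inter>\<B>"
        "\<Inter>\<B> \<subseteq> S" by blast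
    obtain \<P> where \<P>: "admissible s \<P>"
      "\<forall>\<psi>\<in>C_fol (enat s) F F'. \<psi> \<in> \<Inter>\<B> \<longleftrightarrow>
        (\<forall>(K, P)\<in>\<P>. P \<psi>)"
      using finite_sp_base_conditions[OF s \<B>(1,2)] by blast
    have "foliation_map F F' \<phi>" "\<forall>x. C_at F F' s \<phi> x"
      "\<forall>x k. enat k \<le> r \<longrightarrow> trans_at F F' k \<phi> x"
      using \<phi> C2_fol_iff[OF s] by blast+
    moreover from \<phi> have "\<phi> \<in> C_fol (enat s) F F'" unfolding C2_fol_def by blast
    ultimately have "tame s \<P> \<phi>" unfolding tame_def using \<P>(2) \<B>(3) by blast
    moreover have "\<forall>x\<in>N. smooth_at \<phi> x"
      using E(4) unfolding C_map_on_iff[OF E(2) order_refl] smooth_at_def .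
    ultimately have
      "\<exists>\<psi>. tame s \<P> \<psi> \<and> (\<forall>x. smooth_at \<psi> x) \<and>
        (\<forall>x. (\<phi> x, \<psi> x) \<in> (plaque_rel F')\<^sup>*) \<and>
        (\<exists>N'. open N' \<and> E \<subseteq> N' \<and> (\<forall>x\<in>N'. \<psi> x = \<phi> x))"
      by (rule global_smoothing[OF s \<P>(1) _ E(1-3)])
    then obtain \<psi>
      where \<psi>: "tame s \<P> \<psi>" "\<forall>x. smooth_at \<psi> x"
        "\<forall>x. (\<phi> x, \<psi> x) \<in> (plaque_rel F')\<^sup>*"
      "\<exists>N'. open N' \<and> E \<subseteq> N' \<and> (\<forall>x\<in>N'. \<psi> x = \<phi> x)"
      by blast
    \<comment> \<open>The leaf condition is not part of \<open>tame\<close>; it holds because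
      \<open>\<psi> x\<close> and \<open>\<phi> x\<close> lie on the same leaf for every
      \<open>x\<close>.\<close>
    have "foliation_map F F' \<psi>"
      by (rule foliation_map_plaque[OF \<open>foliation_map F F' \<phi>\<close>]) (use \<psi>(3) in blast)
    then have \<psi>r: "\<psi> \<in> C_fol r F F'" using \<psi>(2) C_fol_iff[OF order_refl]
      unfolding smooth_at_def by blast
    then have \<psi>2: "\<psi> \<in> C2_fol r (enat s) F F'" using C_fol_subset_C2_fol[OF s] by blast
    then have "\<psi> \<in> C_fol (enat s) F F'" unfolding C2_fol_def by blast
    moreover have "\<forall>(K, P)\<in>\<P>. P \<psi>" using \<psi>(1) unfolding tame_def by blast
    ultimately have "\<psi> \<in> \<Inter>\<B>" using \<P>(2) by blast
    then have "\<psi> \<in> \<N>" using \<B>(4) S(2) T(3) \<psi>2 by blast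
    then show ?thesis using \<psi>r \<psi>(4) by blast
  qed
  have top: "topspace (C2_fol_SP r s F F') = C2_fol r (enat s) F F'"
    unfolding C2_fol_SP_def topspace_subtopology topspace_sp_topology C2_fol_def by blast
  have "\<phi> \<in> (C2_fol_SP r s F F') closure_of (C_fol r F F')"
    if \<phi>: "\<phi> \<in> C2_fol r (enat s) F F'" for \<phi>
  proof -
    have "\<exists>\<psi>. \<psi> \<in> C_fol r F F' \<and> \<psi> \<in> T"
      if "\<phi> \<in> T" "openin (C2_fol_SP r s F F') T" for T
    proof -
      have "\<phi> \<in> (C2_fol_SP r s F F') interior_of T" using that by (simp add: interior_of_openin)
      \<comment> \<open>Density is the case in which both \<open>E\<close> and its neighbourhood are
        empty.\<close>
      moreover have "C_map_on r {} F F' \<phi>" using C_map_on_iff[OF open_empty order_refl] by blast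
      ultimately show ?thesis using main[OF \<phi> closed_empty open_empty empty_subsetI] by blast
    qed
    then show ?thesis unfolding in_closure_of top using \<phi> by blast
  qed
  moreover have "(C2_fol_SP r s F F') closure_of (C_fol r F F') \<subseteq> C2_fol r (enat s) F F'"
    using closure_of_subset_topspace[of "C2_fol_SP r s F F'"] unfolding top .
  ultimately show ?thesis using main by blast
qed

end
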